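(* Let $\Gamma$ be a biconnected finite simplicial graph such that the flag complex $\Delta_\Gamma$ is simply connected. Then $\Sigma^1(BB_\Gamma)^c=\mathcal R_1(BB_\Gamma)\cap S(BB_\Gamma)$; that is, for every non-zero character $\chi\colon BB_\Gamma\to\mathbb R$ one has $[\chi]\notin\Sigma^1(BB_\Gamma)$ if and only if $\chi\in\mathcal R_1(BB_\Gamma)$.
   Context: All graphs are finite simplicial graphs. A graph is biconnected if it is connected and has no cut vertex. The flag complex $\Delta_\Gamma$ is the simplicial complex whose simplices are the nonempty sets of pairwise adjacent vertices of $\Gamma$. The right-angled Artin group on $\Gamma$ is $A_\Gamma=\langle V(\Gamma)\mid [v,w] \text{ whenever } (v,w)\in E(\Gamma)\rangle$, and $BB_\Gamma$ is the kernel of the homomorphism $A_\Gamma\to\mathbb Z$ sending every vertex generator to $1$; it is finitely generated when $\Gamma$ is connected. For a finitely generated group $G$, the character sphere $S(G)$ is the set of classes $[\chi]$ of non-zero $\chi\in\operatorname{Hom}(G,\mathbb R)$ up to multiplication by positive reals; it is identified with the unit sphere of $\operatorname{Hom}(G,\mathbb R)$ for some inner product. For a finite generating set $\mathcal S$, the BNS-invariant $\Sigma^1(G)\subseteq S(G)$ is the set of $[\chi]$ such that the full subgraph of $\operatorname{Cay}(G,\mathcal S)$ spanned by $\{g\in G\mid\chi(g)\ge 0\}$ is connected (independent of $\mathcal S$), and $\Sigma^1(G)^c=S(G)\setminus\Sigma^1(G)$. Let $A=H^\ast(G,\mathbb R)$ be the cohomology algebra. For $a\in A^1=H^1(G,\mathbb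 R)=\operatorname{Hom}(G,\mathbb R)$ one has $a^2=0$, giving a cochain complex $(A,a)\colon A^0\to A^1\to A^2\to\cdots$ with coboundary right multiplication by $a$. The (first) resonance variety is $\mathcal R_1(G)=\{a\in A^1\mid H^1(A,a)\neq 0\}$ (it is invariant under non-zero scaling). *)

theory Defs
  imports
    "HOL-Analysis.Analysis"
    "HOL-Algebra.Elementary_Groups"
    "Graph_Theory.Graph_Theory"
begin

section \<open>Graphs and flag complexes\<close>

text \<open>
  A finite simplicial graph is a \<^locale>\<open>pair_graph\<close>: a finite vertex set with a symmetric and
  irreflexive arc relation. \<^const>\<open>Digraph_Component.connected\<close> requires a nonempty vertex set, so
  the case that no vertex remains is excluded explicitly: a single vertex is not a cut vertex.
\<close>

definition cut_vertex :: "'v pair_pre_digraph \<Rightarrow> 'v \<Rightarrow> bool" where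
  "cut_vertex \<Gamma> v \<longleftrightarrow> v \<in> pverts \<Gamma> \<and> pverts \<Gamma> - {v} \<noteq> {} \<and>
     \<not> Digraph_Component.connected (with_proj \<Gamma> \<restriction> (pverts \<Gamma> - {v}))"

definition biconnected :: "'v pair_pre_digraph \<Rightarrow> bool" where
  "biconnected \<Gamma> \<longleftrightarrow>
     Digraph_Component.connected (with_proj \<Gamma>) \<and> (\<forall>v \<in> pverts \<Gamma>. \<not> cut_vertex \<Gamma> v)"

definition flag_complex :: "'v pair_pre_digraph \<Rightarrow> 'v set set" where
  "flag_complex \<Gamma> = {\<sigma>. \<sigma> \<noteq> {} \<and> finite \<sigma> \<and> \<sigma> \<subseteq> pverts \<Gamma> \<and>
     (\<forall>v\<in>\<sigma>. \<forall>w\<in>\<sigma>. v \<noteq> w \<longrightarrow> (v, w) \<in> parcs \<Gamma>)}"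

text \<open>
  The geometric realization, in barycentric coordinates. It carries the subspace topology of the
  product topology on functions, which is the usual topology when the complex is finite.
\<close>

definition geometric_realization :: "'v set set \<Rightarrow> ('v \<Rightarrow> real) set" where
  "geometric_realization K =
     {x. (\<forall>v. 0 \<le> x v) \<and> {v. x v \<noteq> 0} \<in> K \<and> (\<Sum>v | x v \<noteq> 0. x v) = 1}"


section \<open>Group presentations\<close>

text \<open>The letter \<open>(x, True)\<close> stands for the generator \<open>x\<close>, and \<open>(x, False)\<close> for its inverse.\<close>

type_synonym 'x word = "('x \<times> bool) list"

abbreviation words :: "'x set \<Rightarrow> 'x word set" where
  "words X \<equiv> lists (X \<times> UNIV)"

inductive_set word_eq :: "'x set \<Rightarrow> 'x word set \<Rightarrow> ('x word \<times> 'x word) set"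
  for X :: "'x set" and R :: "'x word set" where
  word_eq_refl: "w \<in> words X \<Longrightarrow> (w, w) \<in> word_eq X R"
| word_eq_sym: "(w, w') \<in> word_eq X R \<Longrightarrow> (w', w) \<in> word_eq X R"
| word_eq_trans: "(w, w') \<in> word_eq X R \<Longrightarrow> (w', w'') \<in> word_eq X R \<Longrightarrow> (w, w'') \<in> word_eq X R"
| word_eq_cancel: "u \<in> words X \<Longrightarrow> v \<in> words X \<Longrightarrow> x \<in> X \<Longrightarrow>
    (u @ [(x, b), (x, \<not> b)] @ v, u @ v) \<in> word_eq X R"
| word_eq_relator: "u \<in> words X \<Longrightarrow> v \<in> words X \<Longrightarrow> r \<in> R \<Longrightarrow> r \<in> words X \<Longrightarrow>
    (u @ r @ v, u @ v) \<in> word_eq X R"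

text \<open>The group with generators \<open>X\<close> and relators \<open>R\<close>.\<close>

definition presented_group :: "'x set \<Rightarrow> 'x word set \<Rightarrow> 'x word set monoid" where
  "presented_group X R =
     \<lparr>carrier = words X // word_eq X R,
      monoid.mult = (\<lambda>A B. \<Union>u\<in>A. \<Union>v\<in>B. word_eq X R `` {u @ v}),
      one = word_eq X R `` {[]}\<rparr>"

lemma word_eq_words: "(u, v) \<in> word_eq X R \<Longrightarrow> u \<in> words X \<and> v \<in> words X"
  by (induction rule: word_eq.induct) auto

lemma equiv_word_eq: "equiv (words X) (word_eq X R)"
proof (rule equivI)
  show "word_eq X R \<subseteq> words X \<times> words X"
    by (rule subrelI) (simp only: mem_Sigma_iff word_eq_words simp_thms)
  show "refl_on (words X) (word_eq X R)" by (simp add: refl_on_def word_eq_refl)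
  show "sym (word_eq X R)" by (rule symI) (rule word_eq_sym)
  show "trans (word_eq X R)" by (rule transI) (rule word_eq_trans)
qed

lemma word_eq_append_right:
  "(u, v) \<in> word_eq X R \<Longrightarrow> w \<in> words X \<Longrightarrow> (u @ w, v @ w) \<in> word_eq X R"
proof (induction rule: word_eq.induct)
  case (word_eq_refl u)
  then show ?case by (intro word_eq.intros(1)) simp
next
  case (word_eq_cancel u v x b)
  then show ?case using word_eq.intros(4)[of u X "v @ w" x b R] by simp
next
  case (word_eq_relator u v r)
  then show ?case using word_eq.intros(5)[of u X "v @ w" r R] by simp
next
  case (word_eq_sym u v)
  then show ?case using word_eq.intros(2) by blast
next
  case (word_eq_trans u v v')
  then show ?case using word_eq.intros(3) by blast
qed

lemma word_eq_append_left:
  "(u, v) \<in> word_eq X R \<Longrightarrow> w \<in> words X \<Longrightarrow> (w @ u, w @ v) \<in> word_eq X R"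
proof (induction rule: word_eq.induct)
  case (word_eq_refl u)
  then show ?case by (intro word_eq.intros(1)) simp
next
  case (word_eq_cancel u v x b)
  then show ?case using word_eq.intros(4)[of "w @ u" X v x b R] by simp
next
  case (word_eq_relator u v r)
  then show ?case using word_eq.intros(5)[of "w @ u" X v r R] by simp
next
  case (word_eq_sym u v)
  then show ?case using word_eq.intros(2) by blast
next
  case (word_eq_trans u v v')
  then show ?case using word_eq.intros(3) by blast
qed

lemma word_eq_append:
  "(u, u') \<in> word_eq X R \<Longrightarrow> (v, v') \<in> word_eq X R \<Longrightarrow> (u @ v, u' @ v') \<in> word_eq X R"
  using word_eq_trans[OF word_eq_append_right word_eq_append_left, of u u' X R v v']
    word_eq_words[of u u' X R] word_eq_words[of v v' X R] by blast

lemma presented_group_mult: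
  assumes "u \<in> words X" "v \<in> words X"
  shows "(word_eq X R `` {u}) \<otimes>\<^bsub>presented_group X R\<^esub> (word_eq X R `` {v}) = word_eq X R `` {u @ v}"
proof -
  have *: "word_eq X R `` {u' @ v'} = word_eq X R `` {u @ v}"
    if "u' \<in> word_eq X R `` {u}" "v' \<in> word_eq X R `` {v}" for u' v'
    using that equiv_class_eq[OF equiv_word_eq word_eq_append] unfolding Image_singleton_iff by metis
  have ne: "word_eq X R `` {u} \<noteq> {}" "word_eq X R `` {v} \<noteq> {}"
    using assms word_eq_refl by blast+
  have "(\<Union>u'\<in>word_eq X R `` {u}. \<Union>v'\<in>word_eq X R `` {v}. word_eq X R `` {u' @ v'})
      = (\<Union>u'\<in>word_eq X R `` {u}. \<Union>v'\<in>word_eq X R `` {v}. word_eq X R `` {u @ v})"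
    by (intro SUP_cong refl *)
  also have "\<dots> = word_eq X R `` {u @ v}"
    using ne by (simp only: UN_constant if_False)
  finally show ?thesis
    by (simp add: presented_group_def)
qed

definition word_inv :: "'x word \<Rightarrow> 'x word" where
  "word_inv w = rev (map (\<lambda>(x, b). (x, \<not> b)) w)"

lemma word_inv_words: "w \<in> words X \<Longrightarrow> word_inv w \<in> words X"
  by (induction w) (auto simp: word_inv_def)

lemma word_inv_left: "w \<in> words X \<Longrightarrow> (word_inv w @ w, []) \<in> word_eq X R"
proof (induction w)
  case Nil
  then show ?case by (auto simp: word_inv_def intro: word_eq_refl)
next
  case (Cons a w)
  obtain x b where a: "a = (x, b)" by (cases a)
  have "(word_inv w @ [(x, \<not> b), (x, \<not> \<not> b)] @ w, word_inv w @ w) \<in> word_eq X R"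
    using Cons.prems a by (intro word_eq_cancel word_inv_words) auto
  moreover have "word_inv w @ [(x, \<not> b), (x, \<not> \<not> b)] @ w = word_inv (a # w) @ (a # w)"
    by (simp add: word_inv_def a)
  moreover have "(word_inv w @ w, []) \<in> word_eq X R"
    using Cons by simp
  ultimately show ?case
    using word_eq_trans by metis
qed

lemma group_presented_group: "group (presented_group X R)"
proof (rule groupI)
  let ?P = "presented_group X R"
  have carr: "carrier ?P = words X // word_eq X R" and one: "\<one>\<^bsub>?P\<^esub> = word_eq X R `` {[]}"
    by (simp_all add: presented_group_def)
  show "\<one>\<^bsub>?P\<^esub> \<in> carrier ?P"
    unfolding carr one by (rule quotientI) simp
  have rep: "\<exists>u\<in>words X. x = word_eq X R `` {u}" if "x \<in> carrier ?P" for x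
    using that unfolding carr by (auto simp: quotient_def)
  have repI: "word_eq X R `` {u} \<in> carrier ?P" if "u \<in> words X" for u
    using that unfolding carr by (rule quotientI)
  show "x \<otimes>\<^bsub>?P\<^esub> y \<in> carrier ?P" if xy: "x \<in> carrier ?P" "y \<in> carrier ?P" for x y
  proof -
    obtain u v where "u \<in> words X" "v \<in> words X" "x = word_eq X R `` {u}" "y = word_eq X R `` {v}"
      using rep[OF xy(1)] rep[OF xy(2)] by metis
    then show ?thesis
      using repI[of "u @ v"] presented_group_mult[of u X v R] append_in_lists_conv by metis
  qed
  show "x \<otimes>\<^bsub>?P\<^esub> y \<otimes>\<^bsub>?P\<^esub> z = x \<otimes>\<^bsub>?P\<^esub> (y \<otimes>\<^bsub>?P\<^esub> z)"
    if xyz: "x \<in> carrier ?P" "y \<in> carrier ?P" "z \<in> carrier ?P" for x y z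
  proof -
    obtain u v w where *: "u \<in> words X" "v \<in> words X" "w \<in> words X"
      "x = word_eq X R `` {u}" "y = word_eq X R `` {v}" "z = word_eq X R `` {w}"
      using rep[OF xyz(1)] rep[OF xyz(2)] rep[OF xyz(3)] by metis
    then have "u @ v \<in> words X" "v @ w \<in> words X" by auto
    then show ?thesis unfolding *(4-6) using *(1-3) by (simp only: presented_group_mult append_assoc)
  qed
  show "\<one>\<^bsub>?P\<^esub> \<otimes>\<^bsub>?P\<^esub> x = x" if "x \<in> carrier ?P" for x
    using rep[OF that] presented_group_mult[of "[]" X _ R] unfolding one by auto
  show "\<exists>y\<in>carrier ?P. y \<otimes>\<^bsub>?P\<^esub> x = \<one>\<^bsub>?P\<^esub>" if x: "x \<in> carrier ?P" for x
  proof -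
    obtain w where w: "w \<in> words X" "x = word_eq X R `` {w}"
      using rep[OF x] by blast
    have "word_eq X R `` {word_inv w} \<in> carrier ?P"
      using w by (intro repI word_inv_words)
    moreover have "word_eq X R `` {word_inv w} \<otimes>\<^bsub>?P\<^esub> x = \<one>\<^bsub>?P\<^esub>"
      unfolding one w(2) presented_group_mult[OF word_inv_words[OF w(1)] w(1)]
      using w by (intro equiv_class_eq[OF equiv_word_eq] word_inv_left)
    ultimately show ?thesis by blast
  qed
qed


section \<open>Right-angled Artin groups and Bestvina--Brady groups\<close>

definition commutator_word :: "'x \<Rightarrow> 'x \<Rightarrow> 'x word" where
  "commutator_word v w = [(v, True), (w, True), (v, False), (w, False)]"

definition raag_relators :: "'v pair_pre_digraph \<Rightarrow> 'v word set" where
  "raag_relators \<Gamma> = {commutator_word v w | v w. (v, w) \<in> parcs \<Gamma>}"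

definition raag :: "'v pair_pre_digraph \<Rightarrow> 'v word set monoid" where
  "raag \<Gamma> = presented_group (pverts \<Gamma>) (raag_relators \<Gamma>)"

definition raag_gen :: "'v pair_pre_digraph \<Rightarrow> 'v \<Rightarrow> 'v word set" where
  "raag_gen \<Gamma> v = word_eq (pverts \<Gamma>) (raag_relators \<Gamma>) `` {[(v, True)]}"

definition exponent_sum :: "'x word \<Rightarrow> int" where
  "exponent_sum w = (\<Sum>(x, b)\<leftarrow>w. if b then 1 else - 1)"

text \<open>
  The homomorphism to the integers sending every vertex generator to 1. The exponent sum is
  constant on the elements of the group, which are classes of words.
\<close>

definition raag_height :: "'v word set \<Rightarrow> int" where
  "raag_height A = (THE k. \<forall>w\<in>A. exponent_sum w = k)"

definition bestvina_brady :: "'v pair_pre_digraph \<Rightarrow> 'v word set monoid" where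
  "bestvina_brady \<Gamma> = (raag \<Gamma>)\<lparr>carrier := kernel (raag \<Gamma>) integer_group raag_height\<rparr>"

lemma exponent_sum_append: "exponent_sum (u @ v) = exponent_sum u + exponent_sum v"
  by (simp add: exponent_sum_def)

lemma exponent_sum_word_eq:
  "(u, v) \<in> word_eq X (raag_relators \<Gamma>) \<Longrightarrow> exponent_sum u = exponent_sum v"
proof (induction rule: word_eq.induct)
  case (word_eq_cancel u v x b)
  then show ?case by (simp add: exponent_sum_def)
next
  case (word_eq_relator u v r)
  then have "exponent_sum r = 0" by (auto simp: raag_relators_def exponent_sum_def commutator_word_def)
  then show ?case by (simp add: exponent_sum_append)
qed simp_all

lemma raag_height_class:
  assumes "w \<in> words (pverts \<Gamma>)"
  shows "raag_height (word_eq (pverts \<Gamma>) (raag_relators \<Gamma>) `` {w}) = exponent_sum w"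
  unfolding raag_height_def
proof (rule the_equality)
  fix k
  assume "\<forall>w\<in>word_eq (pverts \<Gamma>) (raag_relators \<Gamma>) `` {w}. exponent_sum w = k"
  moreover have "w \<in> word_eq (pverts \<Gamma>) (raag_relators \<Gamma>) `` {w}"
    using word_eq_refl[OF assms] by (simp only: Image_singleton_iff)
  ultimately have "exponent_sum w = k" by (rule bspec)
  then show "k = exponent_sum w" by simp
next
  show "\<forall>w'\<in>word_eq (pverts \<Gamma>) (raag_relators \<Gamma>) `` {w}. exponent_sum w' = exponent_sum w"
  proof
    fix w'
    assume "w' \<in> word_eq (pverts \<Gamma>) (raag_relators \<Gamma>) `` {w}"
    then show "exponent_sum w' = exponent_sum w"
      unfolding Image_singleton_iff by (rule exponent_sum_word_eq[symmetric])
  qed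
qed

lemma raag_height_gen: "v \<in> pverts \<Gamma> \<Longrightarrow> raag_height (raag_gen \<Gamma> v) = 1"
  unfolding raag_gen_def using raag_height_class[of "[(v, True)]" \<Gamma>] by (simp add: exponent_sum_def)

lemma raag_height_hom: "raag_height \<in> hom (raag \<Gamma>) integer_group"
proof (rule homI)
  fix x y
  assume "x \<in> carrier (raag \<Gamma>)" "y \<in> carrier (raag \<Gamma>)"
  then obtain u v where *: "u \<in> words (pverts \<Gamma>)" "v \<in> words (pverts \<Gamma>)"
    "x = word_eq (pverts \<Gamma>) (raag_relators \<Gamma>) `` {u}"
    "y = word_eq (pverts \<Gamma>) (raag_relators \<Gamma>) `` {v}"
    unfolding raag_def presented_group_def by (auto simp: quotient_def)
  then have "u @ v \<in> words (pverts \<Gamma>)" by simp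
  then show "raag_height (x \<otimes>\<^bsub>raag \<Gamma>\<^esub> y) = raag_height x \<otimes>\<^bsub>integer_group\<^esub> raag_height y"
    unfolding raag_def *(3,4) presented_group_mult[OF *(1,2)] raag_height_class[OF *(1)]
      raag_height_class[OF *(2)] mult_integer_group exponent_sum_append[symmetric]
    by (rule raag_height_class)
qed simp

lemma group_raag: "group (raag \<Gamma>)"
  unfolding raag_def by (rule group_presented_group)

lemma group_bestvina_brady: "group (bestvina_brady \<Gamma>)"
proof -
  interpret group_hom "raag \<Gamma>" integer_group raag_height
    by (simp add: group_hom_def group_hom_axioms_def group_raag raag_height_hom)
  show ?thesis
    unfolding bestvina_brady_def by (rule subgroup.subgroup_is_group[OF subgroup_kernel group_raag])
qed


section \<open>Characters and the BNS invariant\<close>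

definition real_group :: "real monoid" where
  "real_group = \<lparr>carrier = UNIV, monoid.mult = (+), one = 0\<rparr>"

definition characters :: "('g, 'm) monoid_scheme \<Rightarrow> ('g \<Rightarrow> real) set" where
  "characters G = hom G real_group \<inter> extensional (carrier G)"

definition nonzero_characters :: "('g, 'm) monoid_scheme \<Rightarrow> ('g \<Rightarrow> real) set" where
  "nonzero_characters G = characters G - {\<lambda>g\<in>carrier G. 0}"

definition character_class :: "('g, 'm) monoid_scheme \<Rightarrow> ('g \<Rightarrow> real) \<Rightarrow> ('g \<Rightarrow> real) set" where
  "character_class G \<phi> = {\<lambda>g\<in>carrier G. c * \<phi> g | c. c > 0}"

definition character_sphere :: "('g, 'm) monoid_scheme \<Rightarrow> ('g \<Rightarrow> real) set set" where
  "character_sphere G = character_class G ` nonzero_characters G"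

text \<open>
  Connectedness in the sense of \<^const>\<open>Digraph_Component.connected\<close> ignores the orientation of arcs,
  so it suffices to list the arcs of the Cayley graph in one direction.
\<close>

definition cayley_graph :: "('g, 'm) monoid_scheme \<Rightarrow> 'g set \<Rightarrow> 'g pair_pre_digraph" where
  "cayley_graph G S =
     \<lparr>pverts = carrier G, parcs = {(g, g \<otimes>\<^bsub>G\<^esub> s) | g s. g \<in> carrier G \<and> s \<in> S}\<rparr>"

definition finite_generating_set :: "('g, 'm) monoid_scheme \<Rightarrow> 'g set \<Rightarrow> bool" where
  "finite_generating_set G S \<longleftrightarrow> finite S \<and> S \<subseteq> carrier G \<and> generate G S = carrier G"

definition half_connected :: "('g, 'm) monoid_scheme \<Rightarrow> 'g set \<Rightarrow> ('g \<Rightarrow> real) \<Rightarrow> bool" where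
  "half_connected G S \<phi> \<longleftrightarrow>
     Digraph_Component.connected (with_proj (cayley_graph G S) \<restriction> {g \<in> carrier G. \<phi> g \<ge> 0})"

context
  fixes G :: "('g, 'm) monoid_scheme" (structure) and \<phi> :: "'g \<Rightarrow> real"
  assumes G: "group G" and \<phi>: "\<phi> \<in> characters G"
begin

interpretation group G by (rule G)

private lemma char_mult: "x \<in> carrier G \<Longrightarrow> y \<in> carrier G \<Longrightarrow> \<phi> (x \<otimes> y) = \<phi> x + \<phi> y"
  using \<phi> by (auto simp: characters_def hom_def real_group_def)

private lemma char_one: "\<phi> \<one> = 0"
  using char_mult[of \<one> \<one>] by simp

private lemma char_inv: "x \<in> carrier G \<Longrightarrow> \<phi> (inv x) = - \<phi> x"
  using char_mult[of x "inv x"] char_one by simp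

private definition edges :: "'g set \<Rightarrow> ('g \<times> 'g) set" where
  "edges T = {(g, h). g \<in> carrier G \<and> h \<in> carrier G \<and> (\<exists>t\<in>T. h = g \<otimes> t \<or> g = h \<otimes> t)}"

private definition above :: "real \<Rightarrow> 'g set" where
  "above c = {g \<in> carrier G. c \<le> \<phi> g}"

private definition joined :: "'g set \<Rightarrow> real \<Rightarrow> ('g \<times> 'g) set" where
  "joined T c = rtrancl_on (above c) (edges T)"

private lemma half_connected_iff:
  assumes "S \<subseteq> carrier G"
  shows "half_connected G S \<phi> \<longleftrightarrow> (\<forall>g\<in>above 0. \<forall>h\<in>above 0. (g, h) \<in> joined S 0)"
proof -
  let ?H = "with_proj (mk_symmetric (with_proj (cayley_graph G S) \<restriction> above 0))"
  let ?E = "{(g, h) \<in> edges S. g \<in> above 0 \<and> h \<in> above 0}"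
  have above_carrier: "above 0 \<subseteq> carrier G" by (auto simp: above_def)
  have "(g, h) \<in> arcs_ends ?H \<longleftrightarrow> (g, h) \<in> ?E" for g h
  proof -
    have "(g, h) \<in> arcs_ends ?H \<longleftrightarrow>
        g \<in> above 0 \<and> h \<in> above 0 \<and> ((g, h) \<in> parcs (cayley_graph G S) \<or> (h, g) \<in> parcs (cayley_graph G S))"
      unfolding mk_symmetric_def arcs_ends_conv by (auto simp: image_iff)
    also have "\<dots> \<longleftrightarrow> (g, h) \<in> ?E"
      unfolding cayley_graph_def edges_def using above_carrier by auto
    finally show ?thesis .
  qed
  then have arcs: "arcs_ends ?H = ?E" by (simp add: set_eq_iff)
  have "rtrancl_on (above 0) ?E = rtrancl_on (above 0) (edges S)"
  proof (intro equalityI subrelI)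
    fix g h
    assume "(g, h) \<in> rtrancl_on (above 0) (edges S)"
    then show "(g, h) \<in> rtrancl_on (above 0) ?E"
    proof (induction rule: rtrancl_on_induct)
      case (step y z)
      then show ?case by (auto intro: rtrancl_on_into_rtrancl_on[of g y])
    qed simp
  next
    fix g h
    assume "(g, h) \<in> rtrancl_on (above 0) ?E"
    then show "(g, h) \<in> rtrancl_on (above 0) (edges S)"
    proof (induction rule: rtrancl_on_induct)
      case (step y z)
      then show ?case by (auto intro: rtrancl_on_into_rtrancl_on[of g y])
    qed simp
  qed
  moreover have "\<one> \<in> above 0" by (simp add: above_def char_one)
  moreover have "verts ?H = above 0" by (simp add: mk_symmetric_def)
  ultimately show ?thesis
    unfolding half_connected_def Digraph_Component.connected_def strongly_connected_def
      reachable_def joined_def above_def[symmetric] arcs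
    by auto
qed

private lemma joined_mono: "(g, h) \<in> joined T c \<Longrightarrow> d \<le> c \<Longrightarrow> (g, h) \<in> joined T d"
  unfolding joined_def
  by (induction rule: rtrancl_on_induct)
    (auto simp: above_def intro: rtrancl_on_into_rtrancl_on)

private lemma joined_trans: "(g, h) \<in> joined T c \<Longrightarrow> (h, k) \<in> joined T c \<Longrightarrow> (g, k) \<in> joined T c"
  unfolding joined_def by (rule rtrancl_on_trans)

private lemma joined_sym: "(g, h) \<in> joined T c \<Longrightarrow> (h, g) \<in> joined T c"
  unfolding joined_def
  by (rule symE[OF rtrancl_on_sym]) (auto simp: sym_def edges_def)

private lemma joined_refl: "g \<in> above c \<Longrightarrow> (g, g) \<in> joined T c"
  unfolding joined_def by simp

private lemma joined_edge: "(g, h) \<in> edges T \<Longrightarrow> g \<in> above c \<Longrightarrow> h \<in> above c \<Longrightarrow> (g, h) \<in> joined T c"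
  unfolding joined_def by (blast intro: rtrancl_on_into_rtrancl_on)

private lemma joined_translate:
  assumes "(g, h) \<in> joined T c" "a \<in> carrier G" "T \<subseteq> carrier G"
  shows "(a \<otimes> g, a \<otimes> h) \<in> joined T (\<phi> a + c)"
  using assms(1) unfolding joined_def
proof (induction rule: rtrancl_on_induct)
  case base
  then show ?case using assms(2) by (auto simp: above_def char_mult)
next
  case (step y z)
  then have yz: "y \<in> carrier G" "z \<in> carrier G" by (auto simp: above_def)
  have "(a \<otimes> y, a \<otimes> z) \<in> edges T"
    using step.hyps(2) assms(2,3) by (auto simp: edges_def m_assoc subset_eq intro!: bexI)
  moreover have "a \<otimes> z \<in> above (\<phi> a + c)"
    using step.hyps(4) assms(2) by (auto simp: above_def char_mult)
  ultimately show ?case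
    using step.IH by (blast intro: rtrancl_on_into_rtrancl_on)
qed

private lemma joined_generate:
  assumes "T \<subseteq> carrier G" "g \<in> generate G T"
  shows "\<exists>c\<le>0. (\<one>, g) \<in> joined T c"
  using assms(2)
proof induction
  case one
  then show ?case by (intro exI[of _ 0]) (auto intro!: joined_refl simp: above_def char_one)
next
  case (incl h)
  then have "h \<in> carrier G" using assms(1) by blast
  then show ?case using incl
    by (intro exI[of _ "min 0 (\<phi> h)"])
      (auto intro!: joined_edge bexI[of _ h] simp: above_def char_one edges_def)
next
  case (inv h)
  then have "h \<in> carrier G" using assms(1) by blast
  then show ?case using inv
    by (intro exI[of _ "min 0 (\<phi> (inv h))"])
      (auto intro!: joined_edge bexI[of _ h] simp: above_def char_one edges_def)
next
  case (eng h1 h2)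
  then obtain c1 c2 where c: "c1 \<le> 0" "c2 \<le> 0" "(\<one>, h1) \<in> joined T c1" "(\<one>, h2) \<in> joined T c2"
    by blast
  have h1: "h1 \<in> carrier G" using eng assms generate_in_carrier by blast
  have "(h1, h1 \<otimes> h2) \<in> joined T (\<phi> h1 + c2)"
    using joined_translate[OF c(4) h1 assms(1)] h1 by simp
  then show ?case
    using c(1) joined_trans[OF joined_mono[OF c(3)] joined_mono]
    by (intro exI[of _ "min c1 (\<phi> h1 + c2)"]) auto
qed

private lemma char_zero_generate:
  assumes "T \<subseteq> carrier G" "\<forall>t\<in>T. \<phi> t = 0" "g \<in> generate G T"
  shows "\<phi> g = 0"
  using assms(3)
proof induction
  case (eng h1 h2)
  then show ?case using assms(1) generate_in_carrier by (simp add: char_mult)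
qed (use assms(1,2) in \<open>auto simp: char_one char_inv subset_eq\<close>)

lemma half_connected_independent:
  assumes nz: "\<phi> \<in> nonzero_characters G"
    and S: "finite_generating_set G S" and T: "finite_generating_set G T"
    and conn: "half_connected G S \<phi>"
  shows "half_connected G T \<phi>"
proof -
  have S': "finite S" "S \<subseteq> carrier G" and T': "T \<subseteq> carrier G" "generate G T = carrier G"
    using S T by (auto simp: finite_generating_set_def)
  have "\<forall>s\<in>S. \<exists>c\<le>0. (\<one>, s) \<in> joined T c"
    using joined_generate[OF T'(1)] S'(2) T'(2) by auto
  then obtain f where f: "\<And>s. s \<in> S \<Longrightarrow> f s \<le> (0::real)" "\<And>s. s \<in> S \<Longrightarrow> (\<one>, s) \<in> joined T (f s)"
    by metis
  define c where "c = Min (insert 0 (f ` S))"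
  have c: "(\<one>, s) \<in> joined T c" if "s \<in> S" for s
    using f(2)[OF that] that S'(1) by (auto simp: c_def intro: joined_mono)
  have c0: "c \<le> 0" using S'(1) by (auto simp: c_def)
  have step: "(y, y \<otimes> s) \<in> joined T c" if "s \<in> S" "y \<in> above 0" for s y
    using joined_translate[OF c[OF that(1)] _ T'(1), of y] that
    by (auto simp: above_def elim: joined_mono)
  have low: "(\<one>, g) \<in> joined T c" if "g \<in> above 0" for g
  proof -
    have "(\<one>, g) \<in> rtrancl_on (above 0) (edges S)"
      using conn that unfolding half_connected_iff[OF S'(2)] joined_def
      by (simp add: above_def char_one)
    then show ?thesis
    proof (induction rule: rtrancl_on_induct)
      case base
      then show ?case using c0 by (intro joined_refl) (simp add: above_def char_one)
    next
      case (step y z)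
      then obtain s where "s \<in> S" "z = y \<otimes> s \<or> y = z \<otimes> s" by (auto simp: edges_def)
      then have "(y, z) \<in> joined T c"
        using \<open>\<And>s y. s \<in> S \<Longrightarrow> y \<in> above 0 \<Longrightarrow> (y, y \<otimes> s) \<in> joined T c\<close> step.hyps(3,4) joined_sym
        by blast
      then show ?case using step.IH joined_trans by blast
    qed
  qed
  obtain t0 where t0: "t0 \<in> T" "\<phi> t0 \<noteq> 0"
  proof (rule ccontr)
    assume "\<not> thesis"
    then have "\<forall>g\<in>carrier G. \<phi> g = 0"
      using char_zero_generate[OF T'(1)] that T'(2) by auto
    then have "\<phi> = (\<lambda>g\<in>carrier G. 0)"
      using \<phi> by (intro extensionalityI[of _ "carrier G"]) (auto simp: characters_def)
    then show False using nz by (simp add: nonzero_characters_def)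
  qed
  define t where "t = (if \<phi> t0 > 0 then t0 else inv t0)"
  have t: "t \<in> carrier G" "\<phi> t > 0"
    using t0 T'(1) by (auto simp: t_def char_inv subset_eq)
  have t_edge: "(g, g \<otimes> t) \<in> edges T" if "g \<in> carrier G" for g
    using that t0 t(1) T'(1)
    by (auto simp: t_def edges_def m_assoc subset_eq intro!: bexI[of _ t0])
  have pow: "\<phi> (t [^] n) = real n * \<phi> t" for n :: nat
    using t by (induction n) (auto simp: char_one char_mult algebra_simps)
  have pow_joined: "(\<one>, t [^] n) \<in> joined T 0" for n :: nat
  proof (induction n)
    case 0
    then show ?case by (auto intro: joined_refl simp: above_def char_one)
  next
    case (Suc n)
    have "(t [^] n, t [^] Suc n) \<in> joined T 0"
      using t t_edge[of "t [^] n"] pow[of n] pow[of "Suc n"]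
      by (intro joined_edge) (auto simp: above_def)
    then show ?case using Suc joined_trans by blast
  qed
  obtain n :: nat where n: "- c \<le> real n * \<phi> t"
    using reals_Archimedean3[OF t(2)] by (meson less_imp_le)
  define a where "a = t [^] n"
  have a: "a \<in> carrier G" "- c \<le> \<phi> a" "(\<one>, a) \<in> joined T 0"
    using t n pow_joined pow by (auto simp: a_def)
  have *: "(\<one>, g) \<in> joined T 0" if g: "g \<in> above 0" for g
  proof -
    have gc: "g \<in> carrier G" "0 \<le> \<phi> g" using g by (auto simp: above_def)
    have "inv a \<otimes> (g \<otimes> a) \<in> above 0"
      using gc a(1) by (simp add: above_def char_mult char_inv)
    from joined_translate[OF low[OF this] a(1) T'(1)]
    have "(a, g \<otimes> a) \<in> joined T (\<phi> a + c)"
      using a(1) gc by (simp add: m_assoc[symmetric])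
    then have "(a, g \<otimes> a) \<in> joined T 0" using a(2) by (auto elim: joined_mono)
    moreover have "(g, g \<otimes> a) \<in> joined T 0"
      using joined_translate[OF a(3) gc(1) T'(1)] gc a(1) by (auto elim: joined_mono)
    ultimately show ?thesis using a(3) joined_trans joined_sym by blast
  qed
  have "(g, h) \<in> joined T 0" if "g \<in> above 0" "h \<in> above 0" for g h
    by (rule joined_trans[OF joined_sym]) (use that * in auto)
  then show ?thesis
    unfolding half_connected_iff[OF T'(1)] by blast
qed

end

text \<open>
  The existential quantifier ranges over generating sets that all give the same answer,
  see \<open>bns_invariant_independent\<close> below.
\<close>

definition bns_invariant :: "('g, 'm) monoid_scheme \<Rightarrow> ('g \<Rightarrow> real) set set" where
  "bns_invariant G = {character_class G \<phi> | \<phi>.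
     \<phi> \<in> nonzero_characters G \<and> (\<exists>S. finite_generating_set G S \<and> half_connected G S \<phi>)}"

lemma half_connected_scale:
  "c > 0 \<Longrightarrow> half_connected G S (\<lambda>g\<in>carrier G. c * \<phi> g) \<longleftrightarrow> half_connected G S \<phi>"
  unfolding half_connected_def
  by (rule arg_cong[of _ _ "\<lambda>P. Digraph_Component.connected (with_proj (cayley_graph G S) \<restriction> P)"])
    (auto simp: zero_le_mult_iff)

lemma mem_character_class: "\<phi> \<in> characters G \<Longrightarrow> \<phi> \<in> character_class G \<phi>"
  unfolding character_class_def characters_def
  by (intro CollectI exI[of _ 1]) (auto simp: extensional_def restrict_def)

text \<open>Membership in the invariant depends neither on the generating set nor on the representative.\<close>

lemma bns_invariant_independent:
  assumes G: "group G" and S: "finite_generating_set G S" and \<phi>: "\<phi> \<in> nonzero_characters G"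
  shows "character_class G \<phi> \<in> bns_invariant G \<longleftrightarrow> half_connected G S \<phi>"
proof
  assume "character_class G \<phi> \<in> bns_invariant G"
  then obtain \<psi> T where \<psi>: "character_class G \<phi> = character_class G \<psi>"
    "\<psi> \<in> nonzero_characters G" "finite_generating_set G T" "half_connected G T \<psi>"
    by (auto simp: bns_invariant_def)
  have "\<phi> \<in> character_class G \<psi>"
    using mem_character_class[of \<phi> G] \<phi> \<psi>(1) by (auto simp: nonzero_characters_def)
  then obtain c where "c > 0" "\<phi> = (\<lambda>g\<in>carrier G. c * \<psi> g)"
    by (auto simp: character_class_def)
  moreover have "half_connected G S \<psi>"
    using half_connected_independent[OF G _ \<psi>(2,3) S \<psi>(4)] \<psi>(2)
    by (auto simp: nonzero_characters_def)
  ultimately show "half_connected G S \<phi>" using half_connected_scale by blast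
qed (use S \<phi> in \<open>auto simp: bns_invariant_def\<close>)

definition bns_complement :: "('g, 'm) monoid_scheme \<Rightarrow> ('g \<Rightarrow> real) set set" where
  "bns_complement G = character_sphere G - bns_invariant G"


section \<open>The real cohomology algebra of a group and its resonance variety\<close>

text \<open>
  Inhomogeneous cochains with trivial real coefficients; an \<open>n\<close>-tuple of group elements is a list
  of length \<open>n\<close>.
\<close>

definition tuples :: "('g, 'm) monoid_scheme \<Rightarrow> nat \<Rightarrow> 'g list set" where
  "tuples G n = {xs \<in> lists (carrier G). length xs = n}"

definition cochains :: "('g, 'm) monoid_scheme \<Rightarrow> nat \<Rightarrow> ('g list \<Rightarrow> real) monoid" where
  "cochains G n =
     \<lparr>carrier = extensional (tuples G n),
      monoid.mult = (\<lambda>f h. \<lambda>xs\<in>tuples G n. f xs + h xs),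
      one = (\<lambda>xs\<in>tuples G n. 0)\<rparr>"

definition coboundary :: "('g, 'm) monoid_scheme \<Rightarrow> nat \<Rightarrow> ('g list \<Rightarrow> real) \<Rightarrow> ('g list \<Rightarrow> real)" where
  "coboundary G n f = (\<lambda>xs\<in>tuples G (Suc n).
     f (tl xs)
     + (\<Sum>i<n. (- 1) ^ Suc i * f (take i xs @ [xs ! i \<otimes>\<^bsub>G\<^esub> xs ! Suc i] @ drop (i + 2) xs))
     + (- 1) ^ Suc n * f (butlast xs))"

lemma coboundary_0: "g \<in> carrier G \<Longrightarrow> coboundary G 0 f [g] = 0"
  by (simp add: coboundary_def tuples_def)

lemma coboundary_1:
  "g \<in> carrier G \<Longrightarrow> h \<in> carrier G \<Longrightarrow> coboundary G 1 f [g, h] = f [h] - f [g \<otimes>\<^bsub>G\<^esub> h] + f [g]"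
  by (simp add: coboundary_def tuples_def)

definition cocycles :: "('g, 'm) monoid_scheme \<Rightarrow> nat \<Rightarrow> ('g list \<Rightarrow> real) set" where
  "cocycles G n = kernel (cochains G n) (cochains G (Suc n)) (coboundary G n)"

definition coboundaries :: "('g, 'm) monoid_scheme \<Rightarrow> nat \<Rightarrow> ('g list \<Rightarrow> real) set" where
  "coboundaries G n = (case n of
     0 \<Rightarrow> {\<one>\<^bsub>cochains G 0\<^esub>}
   | Suc m \<Rightarrow> coboundary G m ` carrier (cochains G m))"

definition cohomology :: "('g, 'm) monoid_scheme \<Rightarrow> nat \<Rightarrow> ('g list \<Rightarrow> real) set monoid" where
  "cohomology G n = (cochains G n)\<lparr>carrier := cocycles G n\<rparr> Mod coboundaries G n"

definition cup_cochain ::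
  "('g, 'm) monoid_scheme \<Rightarrow> nat \<Rightarrow> nat \<Rightarrow> ('g list \<Rightarrow> real) \<Rightarrow> ('g list \<Rightarrow> real) \<Rightarrow> ('g list \<Rightarrow> real)"
where
  "cup_cochain G p q f h = (\<lambda>xs\<in>tuples G (p + q). f (take p xs) * h (drop p xs))"

definition cup ::
  "('g, 'm) monoid_scheme \<Rightarrow> nat \<Rightarrow> nat \<Rightarrow>
     ('g list \<Rightarrow> real) set \<Rightarrow> ('g list \<Rightarrow> real) set \<Rightarrow> ('g list \<Rightarrow> real) set"
where
  "cup G p q \<alpha> \<beta> =
     (\<Union>f\<in>\<alpha>. \<Union>h\<in>\<beta>. coboundaries G (p + q) #>\<^bsub>cochains G (p + q)\<^esub> cup_cochain G p q f h)"

text \<open>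
  The cohomology in degree \<open>n\<close> of the complex given by right multiplication by a degree-1 class
  \<open>a\<close> on the cohomology algebra.
\<close>

definition mult_cocycles ::
  "('g, 'm) monoid_scheme \<Rightarrow> ('g list \<Rightarrow> real) set \<Rightarrow> nat \<Rightarrow> ('g list \<Rightarrow> real) set set" where
  "mult_cocycles G a n = kernel (cohomology G n) (cohomology G (Suc n)) (\<lambda>x. cup G n 1 x a)"

definition mult_coboundaries ::
  "('g, 'm) monoid_scheme \<Rightarrow> ('g list \<Rightarrow> real) set \<Rightarrow> nat \<Rightarrow> ('g list \<Rightarrow> real) set set" where
  "mult_coboundaries G a n = (case n of
     0 \<Rightarrow> {\<one>\<^bsub>cohomology G 0\<^esub>}
   | Suc m \<Rightarrow> (\<lambda>x. cup G m 1 x a) ` carrier (cohomology G m))"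

definition mult_cohomology ::
  "('g, 'm) monoid_scheme \<Rightarrow> ('g list \<Rightarrow> real) set \<Rightarrow> nat \<Rightarrow> ('g list \<Rightarrow> real) set set monoid" where
  "mult_cohomology G a n =
     (cohomology G n)\<lparr>carrier := mult_cocycles G a n\<rparr> Mod mult_coboundaries G a n"

text \<open>The identification of a character with a degree-1 cohomology class.\<close>

definition char_cohomology_class ::
  "('g, 'm) monoid_scheme \<Rightarrow> ('g \<Rightarrow> real) \<Rightarrow> ('g list \<Rightarrow> real) set" where
  "char_cohomology_class G \<phi> = coboundaries G 1 #>\<^bsub>cochains G 1\<^esub> (\<lambda>xs\<in>tuples G 1. \<phi> (hd xs))"

definition resonance_variety :: "('g, 'm) monoid_scheme \<Rightarrow> ('g \<Rightarrow> real) set" where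
  "resonance_variety G = {\<phi> \<in> characters G.
     carrier (mult_cohomology G (char_cohomology_class G \<phi>) 1)
       \<noteq> {\<one>\<^bsub>mult_cohomology G (char_cohomology_class G \<phi>) 1\<^esub>}}"

definition resonance_sphere :: "('g, 'm) monoid_scheme \<Rightarrow> ('g \<Rightarrow> real) set set" where
  "resonance_sphere G = character_class G ` (resonance_variety G \<inter> nonzero_characters G)"

end

theory Submission
  imports Defs
begin

text \<open>
  Since the flag complex is simply connected, every real edge cocycle is a coboundary. So a character
  of the Bestvina--Brady group is given by a potential \<open>x\<close> on the vertices, unique up to a
  constant, with value \<open>x u - x v\<close> on the element \<open>u v\<^sup>-\<^sup>1\<close>. Both sides of the theorem turn out to be
  equivalent to the failure of one condition on \<open>x\<close>: for every real \<open>t\<close> the vertices with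
  \<open>x \<noteq> t\<close> span a connected subgraph that dominates the graph.

  If the condition holds, then a function of the edges with \<open>x u \<noteq> x v\<close> that is constant on triangles
  is constant. Hence the elements of these edges generate the group and form a connected commutation
  graph, which makes the half space connected. Moreover, if the cup product of a second character, with
  potential \<open>y\<close>, and the first one vanishes, then evaluating it on commuting elements shows that
  the slope \<open>(y u - y v) / (x u - x v)\<close> is constant on triangles, so the two characters are proportional.

  If the condition fails for \<open>t\<close>, then a homomorphism from the right-angled Artin group to the
  Heisenberg group yields a resonant second character, and a homomorphism to a semidirect product of a
  group of functions on the reals with the reals disconnects the half space.
\<close>

section \<open>Real edge cocycles on simply connected flag complexes\<close>

text \<open>The parameter t is the choice of an extension: the characters of
  \<open>raag \<Gamma>\<close> that restrict to the given one send v to x v - t. The condition on x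
  therefore says that every extension satisfies the Meier-VanWyk criterion for \<Sigma>^1 of a
  right-angled Artin group: the vertices of nonzero value span a connected dominating subgraph.

  The obstacle in the robust case is the edges on which x is constant. The character kills their
  elements, so a chain of triangles that compares two other edges cannot pass through them. Instead
  of rerouting chains, a quantity on the living edges is cut along one level set of x at a time;
  this gives a real edge cocycle, to which the vanishing of cohomology applies once more. Questions
  of reachability take this form through the indicator of a component.

  In the other case the freedom comes from vertices with x = t that are sent to the identity. They
  surround a component of the remaining vertices, or a single vertex u, whose images can then be
  altered without spoiling a commutation relation.\<close>

lemma telescope_in_simplex:
  fixes C :: "'v \<Rightarrow> 'v \<Rightarrow> real" and g :: "nat \<Rightarrow> 'v"
  assumes C: "\<And>a b d. a \<in> \<sigma> \<Longrightarrow> b \<in> \<sigma> \<Longrightarrow> d \<in> \<sigma> \<Longrightarrow> C a b + C b d = C a d"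
    and g: "\<And>i. i \<le> n \<Longrightarrow> g i \<in> \<sigma>"
  shows "(\<Sum>i<n. C (g i) (g (Suc i))) = C (g 0) (g n)"
  using g
proof (induction n)
  case 0
  then show ?case using C[of "g 0" "g 0" "g 0"] by simp
next
  case (Suc n)
  then show ?case using C[of "g 0" "g n" "g (Suc n)"] by simp
qed

text \<open>A discrete homotopy: across one strip of the grid the values \<open>V\<close> on the
  vertical edges telescope, and the last row lies in one simplex. The labels at the two ends of a
  row are chosen independently, so a row closes up only through the extra edge from
  \<open>g i n\<close> to \<open>g i 0\<close>; \<open>sides\<close> treats this edge like one more
  column of squares.\<close>

lemma grid_sum_zero:
  fixes C :: "'v \<Rightarrow> 'v \<Rightarrow> real" and g :: "nat \<Rightarrow> nat \<Rightarrow> 'v"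
  assumes C: "\<And>\<sigma> a b d. \<sigma> \<in> K \<Longrightarrow> a \<in> \<sigma> \<Longrightarrow> b \<in> \<sigma> \<Longrightarrow> d \<in> \<sigma> \<Longrightarrow> C a b + C b d = C a d"
    and squares: "\<And>i j. i < n \<Longrightarrow> j < n \<Longrightarrow>
      \<exists>\<sigma>\<in>K. {g i j, g i (Suc j), g (Suc i) j, g (Suc i) (Suc j)} \<subseteq> \<sigma>"
    and sides: "\<And>i. i < n \<Longrightarrow> \<exists>\<sigma>\<in>K. {g i 0, g i n, g (Suc i) 0, g (Suc i) n} \<subseteq> \<sigma>"
    and top: "\<exists>\<sigma>\<in>K. \<forall>j\<le>n. g n j \<in> \<sigma>"
  shows "(\<Sum>j<n. C (g 0 j) (g 0 (Suc j))) + C (g 0 n) (g 0 0) = 0"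
proof -
  define T where "T i = (\<Sum>j<n. C (g i j) (g i (Suc j))) + C (g i n) (g i 0)" for i
  have step: "T i = T (Suc i)" if i: "i < n" for i
  proof -
    define V where "V j = C (g i j) (g (Suc i) j)" for j
    have "C (g i j) (g i (Suc j)) - C (g (Suc i) j) (g (Suc i) (Suc j)) = V j - V (Suc j)"
      if "j < n" for j
    proof -
      obtain \<sigma> where \<sigma>: "\<sigma> \<in> K" "{g i j, g i (Suc j), g (Suc i) j, g (Suc i) (Suc j)} \<subseteq> \<sigma>"
        using squares[OF i \<open>j < n\<close>] by blast
      then have "C (g i j) (g i (Suc j)) + V (Suc j) = C (g i j) (g (Suc i) (Suc j))"
        "V j + C (g (Suc i) j) (g (Suc i) (Suc j)) = C (g i j) (g (Suc i) (Suc j))"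
        unfolding V_def by (auto intro!: C[OF \<sigma>(1)])
      then show ?thesis by simp
    qed
    then have "(\<Sum>j<n. C (g i j) (g i (Suc j)) - C (g (Suc i) j) (g (Suc i) (Suc j)))
        = (\<Sum>j<n. V j - V (Suc j))"
      by (intro sum.cong) auto
    also have "\<dots> = V 0 - V n" by (rule sum_lessThan_telescope')
    finally have "T i - T (Suc i) = V 0 - V n + C (g i n) (g i 0) - C (g (Suc i) n) (g (Suc i) 0)"
      unfolding T_def by (simp add: sum_subtractf)
    moreover obtain \<sigma> where \<sigma>: "\<sigma> \<in> K" "{g i 0, g i n, g (Suc i) 0, g (Suc i) n} \<subseteq> \<sigma>"
      using sides[OF i] by blast
    then have "C (g i n) (g i 0) + V 0 = C (g i n) (g (Suc i) 0)"
      "V n + C (g (Suc i) n) (g (Suc i) 0) = C (g i n) (g (Suc i) 0)"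
      unfolding V_def by (auto intro!: C[OF \<sigma>(1)])
    ultimately show ?thesis by simp
  qed
  have "T 0 = T i" if "i \<le> n" for i
    using that by (induction i) (auto simp: step)
  then have "T 0 = T n" by simp
  obtain \<sigma> where \<sigma>: "\<sigma> \<in> K" "\<forall>j\<le>n. g n j \<in> \<sigma>" using top by blast
  have "(\<Sum>j<n. C (g n j) (g n (Suc j))) = C (g n 0) (g n n)"
    using \<sigma> C by (intro telescope_in_simplex[of \<sigma>]) auto
  then have "T n = C (g n 0) (g n 0)"
    unfolding T_def using \<sigma> C[OF \<sigma>(1), of "g n 0" "g n n" "g n 0"] by auto
  also have "\<dots> = 0"
    using \<sigma> C[OF \<sigma>(1), of "g n 0" "g n 0" "g n 0"] by auto
  finally show ?thesis using \<open>T 0 = T n\<close> unfolding T_def by simp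
qed

section \<open>Piecewise linear loops and the grid argument\<close>

text \<open>Tent functions centred at the times j / n are the barycentric coordinates of a path that
  runs linearly from \<open>v j\<close> to \<open>v (Suc j)\<close>. The sum over j allows a vertex
  to be visited several times.\<close>

definition edge_path :: "nat \<Rightarrow> (nat \<Rightarrow> 'v) \<Rightarrow> real \<Rightarrow> 'v \<Rightarrow> real" where
  "edge_path n v s = (\<lambda>w. \<Sum>j\<le>n. if v j = w then max 0 (1 - \<bar>real n * s - real j\<bar>) else 0)"

lemma continuous_on_edge_path: "continuous_on S (edge_path n v)"
proof (rule continuous_on_coordinatewise_then_product)
  fix w
  have "continuous_on S (\<lambda>s. if v j = w then max 0 (1 - \<bar>real n * s - real j\<bar>) else 0)" for j
    by (cases "v j = w") (auto intro!: continuous_intros)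
  then show "continuous_on S (\<lambda>s. edge_path n v s w)"
    unfolding edge_path_def by (intro continuous_on_sum) auto
qed

lemma edge_path_segment:
  assumes "j < n" "real j \<le> real n * s" "real n * s \<le> real j + 1"
  shows "edge_path n v s w = (if v j = w then 1 - (real n * s - real j) else 0)
    + (if v (Suc j) = w then real n * s - real j else 0)"
proof -
  have "edge_path n v s w =
      (\<Sum>i\<in>{j, Suc j}. if v i = w then max 0 (1 - \<bar>real n * s - real i\<bar>) else 0)"
    unfolding edge_path_def
  proof (rule sum.mono_neutral_right)
    show "\<forall>i\<in>{..n} - {j, Suc j}. (if v i = w then max 0 (1 - \<bar>real n * s - real i\<bar>) else 0) = 0"
    proof
      fix i
      assume "i \<in> {..n} - {j, Suc j}"
      then have "real i + 1 \<le> real j \<or> real j + 2 \<le> real i" by auto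
      then show "(if v i = w then max 0 (1 - \<bar>real n * s - real i\<bar>) else 0) = 0"
        using assms by auto
    qed
  qed (use assms in auto)
  then show ?thesis using assms by auto
qed

lemma edge_path_vertex:
  assumes "j \<le> n" "0 < n"
  shows "edge_path n v (real j / real n) w = (if v j = w then 1 else 0)"
proof (cases "j = n")
  case True
  then obtain i where "j = Suc i" "i < n" using assms by (cases j) auto
  then show ?thesis using edge_path_segment[of i n "real j / real n" v w] assms by auto
next
  case False
  then show ?thesis using edge_path_segment[of j n "real j / real n" v w] assms by auto
qed

lemma edge_path_support:
  assumes "j < n" "real j \<le> real n * s" "real n * s \<le> real j + 1"
  shows "{w. edge_path n v s w \<noteq> 0} \<subseteq> {v j, v (Suc j)}"
  unfolding edge_path_segment[OF assms] by auto

lemma edge_path_in_realization: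
  assumes K: "\<And>\<sigma> \<tau>. \<sigma> \<in> K \<Longrightarrow> \<tau> \<subseteq> \<sigma> \<Longrightarrow> \<tau> \<noteq> {} \<Longrightarrow> \<tau> \<in> K"
    and v: "\<And>i. i < n \<Longrightarrow> {v i, v (Suc i)} \<in> K" and "0 < n" and s: "s \<in> {0..1}"
  shows "edge_path n v s \<in> geometric_realization K"
proof -
  \<comment> \<open>At s = 1 the floor of n * s would be n, one past the last segment.\<close>
  obtain j where j: "j < n" "real j \<le> real n * s" "real n * s \<le> real j + 1"
  proof (cases "s = 1")
    case True
    then show thesis using that[of "n - 1"] \<open>0 < n\<close> by auto
  next
    case False
    then have "real n * s < real n" using s \<open>0 < n\<close> by auto
    moreover have "0 \<le> real n * s" using s by simp
    ultimately show thesis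
      using that[of "nat \<lfloor>real n * s\<rfloor>"] by (auto simp: nat_less_iff floor_less_iff)
  qed
  note seg = edge_path_segment[OF j]
  let ?A = "{w. edge_path n v s w \<noteq> 0}"
  have "(\<Sum>w\<in>?A. edge_path n v s w) = (\<Sum>w\<in>{v j, v (Suc j)}. edge_path n v s w)"
    using edge_path_support[OF j, of v] by (intro sum.mono_neutral_left) auto
  also have "\<dots> = 1" unfolding seg by (cases "v j = v (Suc j)") auto
  finally have one: "(\<Sum>w\<in>?A. edge_path n v s w) = 1" .
  then have "?A \<noteq> {}" by (metis sum.empty zero_neq_one)
  then have "?A \<in> K" using K[OF v[OF j(1)] edge_path_support[OF j, of v]] by blast
  then show ?thesis
    unfolding geometric_realization_def using one j by (auto simp: seg)
qed

text \<open>
  Divide a null-homotopy into a fine grid and label each grid point by a vertex whose open star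
  contains the image of a neighbourhood of the point. Labels around a small square lie in a common
  simplex, so the sum of \<open>C\<close> along a row of the grid is the same for all rows.
\<close>

lemma loop_sum_zero:
  fixes C :: "'v \<Rightarrow> 'v \<Rightarrow> real"
  assumes K: "\<And>\<sigma> \<tau>. \<sigma> \<in> K \<Longrightarrow> \<tau> \<subseteq> \<sigma> \<Longrightarrow> \<tau> \<noteq> {} \<Longrightarrow> \<tau> \<in> K"
    and sc: "simply_connected (geometric_realization K)"
    and C: "\<And>\<sigma> a b d. \<sigma> \<in> K \<Longrightarrow> a \<in> \<sigma> \<Longrightarrow> b \<in> \<sigma> \<Longrightarrow> d \<in> \<sigma> \<Longrightarrow> C a b + C b d = C a d"
    and v: "\<And>i. i < m \<Longrightarrow> {v i, v (Suc i)} \<in> K" and loop: "v m = v 0"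
  shows "(\<Sum>i<m. C (v i) (v (Suc i))) = 0"
proof (cases "m = 0")
  case False
  let ?R = "geometric_realization K"
  let ?Q = "{0..1::real} \<times> {0..1::real}"
  define p where "p = edge_path m v"
  have ends: "p 0 = p 1"
    using edge_path_vertex[of 0 m v] edge_path_vertex[of m m v] False loop
    by (auto simp: p_def fun_eq_iff)
  have "p s \<in> ?R" if "s \<in> {0..1}" for s
    unfolding p_def using edge_path_in_realization[of K m v s] K v False that by auto
  then have p: "path p" "path_image p \<subseteq> ?R"
    unfolding path_def path_image_def p_def by (auto intro: continuous_on_edge_path)
  have "path (\<lambda>_. p 0)" "path_image (\<lambda>_. p 0) \<subseteq> ?R"
    using p by (auto simp: path_def path_image_def)
  \<comment> \<open>The homotopy is one of free loops. On the vertical sides only h (t, 0) = h (t,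
    1) is known, which is what the hypothesis \<open>sides\<close> of the grid lemma is made
    for.\<close>
  then have "homotopic_loops ?R p (\<lambda>_. p 0)"
    using sc p ends unfolding simply_connected_def by (simp add: pathstart_def pathfinish_def)
  then obtain h where h_cont: "continuous_on ?Q h" and h_raw: "h \<in> ?Q \<rightarrow> ?R"
      "\<forall>s\<in>{0..1}. h (0, s) = p s" "\<forall>s\<in>{0..1}. h (1, s) = p 0"
      "\<forall>t\<in>{0..1}. h (t, 1) = h (t, 0)"
    unfolding homotopic_loops by (auto simp: pathstart_def pathfinish_def)
  have h: "continuous_on ?Q h" "\<And>z. z \<in> ?Q \<Longrightarrow> h z \<in> ?R"
      "\<And>s. s \<in> {0..1} \<Longrightarrow> h (0, s) = p s" "\<And>s. s \<in> {0..1} \<Longrightarrow> h (1, s) = p 0"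
      "\<And>t. t \<in> {0..1} \<Longrightarrow> h (t, 0) = h (t, 1)"
    using h_cont funcset_mem[OF h_raw(1)] h_raw(2-) by (blast, blast, blast, blast, metis)
  have "\<exists>A. open A \<and> A \<inter> ?Q = {z \<in> ?Q. 0 < h z w}" for w
  proof -
    have "continuous_on ?Q (\<lambda>z. h z w)"
      using h(1) by (rule continuous_on_product_then_coordinatewise)
    then obtain A where "open A" "A \<inter> ?Q = (\<lambda>z. h z w) -` {0<..} \<inter> ?Q"
      using open_greaterThan unfolding continuous_on_open_invariant by metis
    then show ?thesis by blast
  qed
  then obtain A where A: "\<And>w. open (A w)" "\<And>w. A w \<inter> ?Q = {z \<in> ?Q. 0 < h z w}" by metis
  have pos: "\<exists>w. 0 < h z w" if "z \<in> ?Q" for z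
  proof (rule ccontr)
    assume "\<nexists>w. 0 < h z w"
    then have "h z w = 0" for w
      using h(2)[OF that] unfolding geometric_realization_def by (auto simp: order.antisym not_less)
    then show False using h(2)[OF that] unfolding geometric_realization_def by simp
  qed
  have "?Q \<subseteq> \<Union>(range A)"
  proof
    fix z
    assume z: "z \<in> ?Q"
    then obtain w where "0 < h z w" using pos by blast
    then have "z \<in> A w \<inter> ?Q" unfolding A(2) using z by simp
    then show "z \<in> \<Union>(range A)" by auto
  qed
  moreover have "compact ?Q" by (intro compact_Times) auto
  moreover have "open G" if "G \<in> range A" for G using A(1) that by blast
  \<comment> \<open>e is a Lebesgue number of the cover of the square by preimages of open
    stars.\<close>
  ultimately obtain e where e: "0 < e" "\<And>z. z \<in> ?Q \<Longrightarrow> \<exists>G\<in>range A. ball z e \<subseteq> G"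
    using Heine_Borel_lemma[of ?Q "range A"] by metis
  obtain M :: nat where M: "0 < M" "2 / e < real M"
    using reals_Archimedean2[of "2 / e"] e(1)
    by (metis divide_pos_pos gr0I less_le_trans not_less of_nat_0 zero_less_numeral less_asym)
  \<comment> \<open>A multiple of m, so that the loop passes \<open>v i\<close> exactly at the grid
    point i * M of the bottom row.\<close>
  define n where "n = m * M"
  have n: "0 < n" "2 / real n < e"
  proof -
    have "real M \<le> real n" using False M(1) unfolding n_def by (simp del: of_nat_mult)
    then have "2 / e < real n" using M by simp
    moreover have "0 < real n" using False M(1) by (simp add: n_def)
    ultimately show "2 / real n < e" using e(1) by (simp add: field_simps)
  qed (use False M in \<open>simp add: n_def\<close>)
  define P where "P i j = (real i / real n, real j / real n)" for i j
  have PQ: "P i j \<in> ?Q" if "i \<le> n" "j \<le> n" for i j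
    using that n by (auto simp: P_def)
  have "\<exists>w. \<forall>z\<in>?Q. dist (P i j) z < e \<longrightarrow> 0 < h z w" if ij: "i \<le> n" "j \<le> n" for i j
  proof -
    obtain w where w: "ball (P i j) e \<subseteq> A w" using e(2)[OF PQ[OF ij]] by blast
    have "0 < h z w" if "z \<in> ?Q" "dist (P i j) z < e" for z
      using A(2)[of w] w that by (auto simp: subset_eq)
    then show ?thesis by blast
  qed
  then obtain g where g: "\<And>i j z. i \<le> n \<Longrightarrow> j \<le> n \<Longrightarrow> z \<in> ?Q \<Longrightarrow> dist (P i j) z < e \<Longrightarrow> 0 < h z (g i j)"
    by metis
  have near: "dist (P i j) (P i' j') < e" if "\<bar>real i - real i'\<bar> \<le> 1" "\<bar>real j - real j'\<bar> \<le> 1" for i j i' j'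
  proof -
    have "dist (P i j) (P i' j') \<le> \<bar>real i / real n - real i' / real n\<bar> + \<bar>real j / real n - real j' / real n\<bar>"
      unfolding P_def dist_Pair_Pair dist_real_def by (rule sqrt_sum_squares_le_sum_abs[THEN order_trans]) simp
    also have "\<dots> = \<bar>real i - real i'\<bar> / real n + \<bar>real j - real j'\<bar> / real n"
      by (simp add: diff_divide_distrib[symmetric])
    also have "\<dots> \<le> 1 / real n + 1 / real n"
      using that by (intro add_mono divide_right_mono) auto
    also have "\<dots> < e" using n by simp
    finally show ?thesis .
  qed
  have supp: "{w. 0 < h z w} \<in> K" if "z \<in> ?Q" for z
  proof -
    have "{w. 0 < h z w} = {w. h z w \<noteq> 0}"
      using h(2)[OF that] unfolding geometric_realization_def by (auto simp: less_le)
    then show ?thesis using h(2)[OF that] unfolding geometric_realization_def by simp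
  qed
  have self: "0 < h (P i j) (g i j)" if "i \<le> n" "j \<le> n" for i j
    using g[OF that PQ[OF that]] e(1) by simp
  have grid: "(\<Sum>j<n. C (g 0 j) (g 0 (Suc j))) + C (g 0 n) (g 0 0) = 0"
  proof (rule grid_sum_zero[of K])
    show "C a b + C b d = C a d" if "\<sigma> \<in> K" "a \<in> \<sigma>" "b \<in> \<sigma>" "d \<in> \<sigma>" for \<sigma> a b d
      using that by (rule C)
  next
    fix i j
    assume ij: "i < n" "j < n"
    have "{g i j, g i (Suc j), g (Suc i) j, g (Suc i) (Suc j)} \<subseteq> {w. 0 < h (P i j) w}"
      using ij by (auto intro!: g PQ near simp: e)
    then show "\<exists>\<sigma>\<in>K. {g i j, g i (Suc j), g (Suc i) j, g (Suc i) (Suc j)} \<subseteq> \<sigma>"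
      using supp[OF PQ] ij by (meson less_imp_le)
  next
    fix i
    assume i: "i < n"
    have "h (P i 0) = h (P i n)" using h(5)[of "real i / real n"] i n by (simp add: P_def)
    moreover have "{g i 0, g (Suc i) 0} \<subseteq> {w. 0 < h (P i 0) w}"
      "{g i n, g (Suc i) n} \<subseteq> {w. 0 < h (P i n) w}"
      using i by (auto intro!: g PQ near simp: e)
    ultimately have "{g i 0, g i n, g (Suc i) 0, g (Suc i) n} \<subseteq> {w. 0 < h (P i 0) w}" by auto
    then show "\<exists>\<sigma>\<in>K. {g i 0, g i n, g (Suc i) 0, g (Suc i) n} \<subseteq> \<sigma>"
      using supp[OF PQ] i by (meson less_imp_le zero_le)
  next
    have "g n j \<in> {w. 0 < h (P n 0) w}" if "j \<le> n" for j
      using self[OF order_refl that] h(4)[of "real j / real n"] h(4)[of 0] that n by (simp add: P_def)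
    then show "\<exists>\<sigma>\<in>K. \<forall>j\<le>n. g n j \<in> \<sigma>" using supp[OF PQ] by (meson order_refl zero_le)
  qed
  have bottom: "0 < edge_path m v (real j / real n) (g 0 j)" if "j \<le> n" for j
    using self[OF _ that, of 0] h(3)[of "real j / real n"] that n by (simp add: P_def p_def)
  \<comment> \<open>At time i / m the only positive coordinate is that of \<open>v i\<close>, which
    forces the label. Between two such times the labels lie in the edge from \<open>v i\<close> to
    \<open>v (Suc i)\<close>, so C telescopes over each block of M steps.\<close>
  have corner: "g 0 (i * M) = v i" if "i \<le> m" for i
  proof -
    have "real (i * M) / real n = real i / real m" using M(1) by (simp add: n_def)
    then have "0 < edge_path m v (real i / real m) (g 0 (i * M))"
      using bottom[of "i * M"] that by (simp add: n_def)
    then show ?thesis using edge_path_vertex[of i m v "g 0 (i * M)"] that False by (auto split: if_splits)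
  qed
  have segment: "(\<Sum>j<M. C (g 0 (i * M + j)) (g 0 (Suc (i * M + j)))) = C (v i) (v (Suc i))"
    if i: "i < m" for i
  proof -
    have "g 0 (i * M + j) \<in> {v i, v (Suc i)}" if "j \<le> M" for j
    proof -
      have "i * M + j \<le> n"
      proof -
        have "i * M + j \<le> Suc i * M" using that by simp
        also have "\<dots> \<le> n" unfolding n_def using i by (intro mult_right_mono) auto
        finally show ?thesis .
      qed
      moreover have "real m * (real (i * M + j) / real n) = real i + real j / real M"
        using False M(1) by (simp add: n_def field_simps)
      moreover have "real j / real M \<le> 1" using that M(1) by simp
      ultimately have "{w. edge_path m v (real (i * M + j) / real n) w \<noteq> 0} \<subseteq> {v i, v (Suc i)}"
        "0 < edge_path m v (real (i * M + j) / real n) (g 0 (i * M + j))"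
        using edge_path_support[OF i, of "real (i * M + j) / real n" v] bottom[of "i * M + j"] by auto
      then show ?thesis by (metis (mono_tags, lifting) less_irrefl mem_Collect_eq subsetD)
    qed
    then have "(\<Sum>j<M. C (g 0 (i * M + j)) (g 0 (i * M + Suc j))) = C (g 0 (i * M + 0)) (g 0 (i * M + M))"
      using C[OF v[OF i]] by (intro telescope_in_simplex[of "{v i, v (Suc i)}"]) auto
    then show ?thesis
      using corner[of i] corner[of "Suc i"] i by (simp add: add.commute)
  qed
  have "(\<Sum>j<n. C (g 0 j) (g 0 (Suc j))) = (\<Sum>i<m. \<Sum>j = i * M..<i * M + M. C (g 0 j) (g 0 (Suc j)))"
    unfolding n_def by (rule sum.nat_group[symmetric])
  also have "\<dots> = (\<Sum>i<m. C (v i) (v (Suc i)))"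
  proof (rule sum.cong)
    fix i
    assume i: "i \<in> {..<m}"
    have "(\<Sum>j = i * M..<i * M + M. C (g 0 j) (g 0 (Suc j))) = (\<Sum>j<M. C (g 0 (i * M + j)) (g 0 (Suc (i * M + j))))"
      by (rule sum.reindex_bij_witness[of _ "\<lambda>j. i * M + j" "\<lambda>j. j - i * M"]) auto
    then show "(\<Sum>j = i * M..<i * M + M. C (g 0 j) (g 0 (Suc j))) = C (v i) (v (Suc i))"
      using segment i by simp
  qed simp
  finally have "(\<Sum>j<n. C (g 0 j) (g 0 (Suc j))) = (\<Sum>i<m. C (v i) (v (Suc i)))" .
  moreover have "C (g 0 n) (g 0 0) = 0"
    using corner[of 0] corner[of m] loop False v[of 0] C[of "{v 0, v (Suc 0)}" "v 0" "v 0" "v 0"]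
    by (simp add: n_def)
  ultimately show ?thesis using grid by simp
qed simp

section \<open>Potentials of edge cocycles by summation along walks\<close>

lemma symmetric_rtrancl:
  assumes "sym E" "(u, v) \<in> E\<^sup>*"
  shows "(v, u) \<in> E\<^sup>*"
  using assms sym_rtrancl symD by metis

text \<open>A relation and not a function of the end points: the total r depends on the walk until
  sums over closed walks are known to vanish.\<close>

inductive walk_sum :: "('v \<times> 'v) set \<Rightarrow> ('v \<Rightarrow> 'v \<Rightarrow> real) \<Rightarrow> 'v \<Rightarrow> 'v \<Rightarrow> real \<Rightarrow> bool"
  for E c where
  walk_refl: "walk_sum E c u u 0"
| walk_step: "walk_sum E c u v r \<Longrightarrow> (v, w) \<in> E \<Longrightarrow> walk_sum E c u w (r + c v w)"

lemma walk_sum_trans: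
  assumes "walk_sum E c u v r" "walk_sum E c v w s"
  shows "walk_sum E c u w (r + s)"
  using assms(2,1)
proof (induction rule: walk_sum.induct)
  case (walk_step v w s z)
  then show ?case using walk_sum.walk_step[of E c u w "r + s" z] by (simp add: add.assoc)
qed simp

lemma walk_sum_sym:
  assumes "sym E" "\<And>u v. (u, v) \<in> E \<Longrightarrow> c v u = - c u v" "walk_sum E c u v r"
  shows "walk_sum E c v u (- r)"
  using assms(3)
proof (induction rule: walk_sum.induct)
  case (walk_step u v r w)
  have "walk_sum E c w v (0 + c w v)"
    using walk_step.hyps(2) assms(1) by (intro walk_sum.walk_step walk_sum.walk_refl) (auto dest: symD)
  from walk_sum_trans[OF this walk_step.IH] show ?case using assms(2)[OF walk_step.hyps(2)] by (simp add: algebra_simps)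
qed (use walk_refl[of E c] in auto)

lemma walk_sum_sequence:
  assumes "walk_sum E c u v r"
  obtains n f where "f 0 = u" "f n = v" "\<And>i. i < n \<Longrightarrow> (f i, f (Suc i)) \<in> E"
    "r = (\<Sum>i<n. c (f i) (f (Suc i)))"
proof -
  have "\<exists>n f. f 0 = u \<and> f n = v \<and> (\<forall>i<n. (f i, f (Suc i)) \<in> E) \<and> r = (\<Sum>i<n. c (f i) (f (Suc i)))"
    using assms
  proof (induction rule: walk_sum.induct)
    case (walk_refl u)
    show ?case by (intro exI[of _ 0] exI[of _ "\<lambda>_. u"]) simp
  next
    case (walk_step u v r w)
    then obtain n f where f: "f 0 = u" "f n = v" "\<forall>i<n. (f i, f (Suc i)) \<in> E"
      "r = (\<Sum>i<n. c (f i) (f (Suc i)))" by blast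
    have "(\<Sum>i<n. c ((f(Suc n := w)) i) ((f(Suc n := w)) (Suc i))) = r"
      unfolding f(4) by (intro sum.cong) auto
    then show ?case using f walk_step.hyps(2)
      by (intro exI[of _ "Suc n"] exI[of _ "f(Suc n := w)"]) (auto simp: less_Suc_eq)
  qed
  then show thesis using that by blast
qed

lemma walk_sum_exists: "(u, v) \<in> E\<^sup>* \<Longrightarrow> \<exists>r. walk_sum E c u v r"
  by (induction rule: rtrancl_induct) (blast intro: walk_sum.intros)+

lemma connected_rtrancl:
  assumes "pair_graph \<Gamma>" "Digraph_Component.connected (with_proj \<Gamma>)" "u \<in> pverts \<Gamma>" "v \<in> pverts \<Gamma>"
  shows "(u, v) \<in> (parcs \<Gamma>)\<^sup>*"
proof -
  interpret pair_graph \<Gamma> by (rule assms(1))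
  have "parcs (mk_symmetric (with_proj \<Gamma>)) = parcs \<Gamma>"
    unfolding mk_symmetric_def using pair_sym_arcs
    by (auto simp: symmetric_def arcs_ends_conv dest: symD)
  moreover have "u \<rightarrow>\<^sup>*\<^bsub>with_proj (mk_symmetric (with_proj \<Gamma>))\<^esub> v"
    using assms(2-4) unfolding Digraph_Component.connected_def strongly_connected_def
    by (simp add: mk_symmetric_def)
  ultimately have "(u, v) \<in> rtrancl_on (pverts \<Gamma>) (parcs \<Gamma>)"
    unfolding reachable_def by (simp add: mk_symmetric_def)
  then show ?thesis
    by (induction rule: rtrancl_on_induct) auto
qed

text \<open>The potential at v is the sum of c along any walk from a base vertex; two walks differ
  by a closed walk, whose sum vanishes by the grid argument.\<close>

lemma simply_connected_potential:
  fixes c :: "'v \<Rightarrow> 'v \<Rightarrow> real"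
  assumes \<Gamma>: "pair_graph \<Gamma>" and conn: "Digraph_Component.connected (with_proj \<Gamma>)"
    and sc: "simply_connected (geometric_realization (flag_complex \<Gamma>))"
    and anti: "\<And>u v. (u, v) \<in> parcs \<Gamma> \<Longrightarrow> c v u = - c u v"
    and triangle: "\<And>u v w. (u, v) \<in> parcs \<Gamma> \<Longrightarrow> (v, w) \<in> parcs \<Gamma> \<Longrightarrow> (u, w) \<in> parcs \<Gamma> \<Longrightarrow>
      c u v + c v w = c u w"
  shows "\<exists>x. \<forall>(u, v)\<in>parcs \<Gamma>. c u v = x v - x u"
proof -
  interpret pair_graph \<Gamma> by (rule \<Gamma>)
  have sym: "sym (parcs \<Gamma>)" using pair_sym_arcs by (simp add: symmetric_def arcs_ends_conv)
  \<comment> \<open>Labels around a grid square may coincide, so c is extended by 0 to degenerate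
    edges; additivity on a simplex with repeated vertices then comes from
    \<open>anti\<close>.\<close>
  define C where "C a b = (if a = b then 0 else c a b)" for a b
  let ?K = "flag_complex \<Gamma>"
  have loops: "r = 0" if walk: "walk_sum (parcs \<Gamma>) c u u r" for u r
  proof -
    obtain n f where f: "f 0 = u" "f n = u" "\<And>i. i < n \<Longrightarrow> (f i, f (Suc i)) \<in> parcs \<Gamma>"
      "r = (\<Sum>i<n. c (f i) (f (Suc i)))"
      using walk_sum_sequence[OF walk] by metis
    have neq: "f i \<noteq> f (Suc i)" if "i < n" for i using pair_no_loops[OF f(3)[OF that]] by simp
    have "(\<Sum>i<n. C (f i) (f (Suc i))) = 0"
    proof (rule loop_sum_zero[OF _ sc])
      show "\<tau> \<in> ?K" if "\<sigma> \<in> ?K" "\<tau> \<subseteq> \<sigma>" "\<tau> \<noteq> {}" for \<sigma> \<tau>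
        using that unfolding flag_complex_def by (auto intro: finite_subset)
      show "{f i, f (Suc i)} \<in> ?K" if "i < n" for i
        using f(3)[OF that] sym in_arcsD1 in_arcsD2 unfolding flag_complex_def by (auto dest: symD)
      show "C a b + C b d = C a d" if "\<sigma> \<in> ?K" "a \<in> \<sigma>" "b \<in> \<sigma>" "d \<in> \<sigma>" for \<sigma> a b d
        using that anti[of a b] triangle[of a b d] unfolding flag_complex_def C_def by auto
    qed (use f in simp)
    moreover have "(\<Sum>i<n. C (f i) (f (Suc i))) = r"
      unfolding f(4) using neq by (intro sum.cong) (auto simp: C_def)
    ultimately show ?thesis by simp
  qed
  show ?thesis
  proof (cases "pverts \<Gamma> = {}")
    case True
    then have "parcs \<Gamma> = {}" using in_arcsD1 by fast
    then show ?thesis by simp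
  next
    case False
    then obtain b where b: "b \<in> pverts \<Gamma>" by blast
    have "\<exists>r. walk_sum (parcs \<Gamma>) c b v r" if "v \<in> pverts \<Gamma>" for v
      using walk_sum_exists[OF connected_rtrancl[OF \<Gamma> conn b that]] .
    then obtain x where x: "\<And>v. v \<in> pverts \<Gamma> \<Longrightarrow> walk_sum (parcs \<Gamma>) c b v (x v)" by metis
    have "c u v = x v - x u" if uv: "(u, v) \<in> parcs \<Gamma>" for u v
    proof -
      have "walk_sum (parcs \<Gamma>) c b v (x u + c u v)"
        using x[OF in_arcsD1[OF uv]] uv by (rule walk_step)
      moreover have "walk_sum (parcs \<Gamma>) c v b (- x v)"
        by (rule walk_sum_sym[OF sym]) (use anti x[OF in_arcsD2[OF uv]] in auto)
      ultimately have "walk_sum (parcs \<Gamma>) c b b (x u + c u v + - x v)"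
        by (rule walk_sum_trans)
      from loops[OF this] show ?thesis by simp
    qed
    then show ?thesis by auto
  qed
qed

section \<open>Robustly connected potentials and triangle-invariant functions\<close>

text \<open>The second conjunct is domination. It concerns a vertex u only at the level t = x u,
  which u determines, so no t occurs in it.\<close>

definition robustly_connected :: "'v set \<Rightarrow> ('v \<times> 'v) set \<Rightarrow> ('v \<Rightarrow> real) \<Rightarrow> bool" where
  "robustly_connected V E x \<longleftrightarrow>
     (\<forall>t. \<forall>u\<in>V. \<forall>v\<in>V. x u \<noteq> t \<longrightarrow> x v \<noteq> t \<longrightarrow> (u, v) \<in> {(a, b) \<in> E. x a \<noteq> t \<and> x b \<noteq> t}\<^sup>*) \<and>
     (\<forall>u\<in>V. \<exists>v. (u, v) \<in> E \<and> x v \<noteq> x u)"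

text \<open>\<open>potential\<close> expresses that the first real cohomology of the flag complex
  vanishes, in terms of antisymmetric edge functions. Taking it as an assumption separates the
  cocycle arguments from the topology.\<close>

locale acyclic_graph =
  fixes V :: "'v set" and E :: "('v \<times> 'v) set"
  assumes edges: "E \<subseteq> V \<times> V"
    and sym_edges: "sym E"
    and connected_edges: "u \<in> V \<Longrightarrow> v \<in> V \<Longrightarrow> (u, v) \<in> E\<^sup>*"
    and potential: "(\<And>u v. (u, v) \<in> E \<Longrightarrow> c v u = - c u v) \<Longrightarrow>
      (\<And>u v w. (u, v) \<in> E \<Longrightarrow> (v, w) \<in> E \<Longrightarrow> (u, w) \<in> E \<Longrightarrow> c u v + c v w = c u w) \<Longrightarrow>
      \<exists>x::'v \<Rightarrow> real. \<forall>(u, v)\<in>E. c u v = x v - x u"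
begin

lemma edge_sym: "(u, v) \<in> E \<Longrightarrow> (v, u) \<in> E"
  using sym_edges by (rule symD)

lemma constant_of_edges:
  assumes "\<And>u v. (u, v) \<in> E \<Longrightarrow> s u = s v" "u \<in> V" "v \<in> V"
  shows "s u = s v"
  using connected_edges[OF assms(2,3)] by (induction rule: rtrancl_induct) (use assms(1) in auto)

text \<open>
  For each \<open>t\<close>, extend \<open>k\<close> from the edges leading out of the level set \<open>x = t\<close> to an edge cocycle by
  zero. Its potential is constant on the connected set \<open>x \<noteq> t\<close>, so the value of \<open>k\<close> on an edge out of
  the level set depends only on the component of the level set in which the edge starts.
\<close>

lemma triangle_invariant_constant:
  fixes k :: "'v \<Rightarrow> 'v \<Rightarrow> real" and x :: "'v \<Rightarrow> real"
  assumes x: "robustly_connected V E x"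
    and k_sym: "\<And>u v. (u, v) \<in> E \<Longrightarrow> x u \<noteq> x v \<Longrightarrow> k v u = k u v"
    and k_triangle: "\<And>u v w. (u, v) \<in> E \<Longrightarrow> (v, w) \<in> E \<Longrightarrow> (u, w) \<in> E \<Longrightarrow> x u \<noteq> x v \<Longrightarrow> x u \<noteq> x w \<Longrightarrow>
      k u v = k u w"
  shows "\<exists>m. \<forall>(u, v)\<in>E. x u \<noteq> x v \<longrightarrow> k u v = m"
proof -
  define c where "c t u v = (if x u = t \<and> x v \<noteq> t then k u v
    else if x u \<noteq> t \<and> x v = t then - k v u else 0)" for t u v
  have "\<exists>d. \<forall>(u, v)\<in>E. c t u v = d v - d u" for t
  proof (rule potential)
    show "c t v u = - c t u v" for u v by (auto simp: c_def)
    \<comment> \<open>A triangle with one vertex on the level set needs \<open>k_triangle\<close> at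
      that vertex. A triangle with two vertices on it needs \<open>k_triangle\<close> at the third
      vertex, together with \<open>k_sym\<close>. In all other cases every term is zero.\<close>
    show "c t u v + c t v w = c t u w" if "(u, v) \<in> E" "(v, w) \<in> E" "(u, w) \<in> E" for u v w
    proof -
      consider "x u = t" "x v \<noteq> t" "x w \<noteq> t" | "x u \<noteq> t" "x v = t" "x w \<noteq> t"
        | "x u \<noteq> t" "x v \<noteq> t" "x w = t" | "x u = t" "x v = t" "x w \<noteq> t"
        | "x u = t" "x v \<noteq> t" "x w = t" | "x u \<noteq> t" "x v = t" "x w = t"
        | "x u = t" "x v = t" "x w = t" | "x u \<noteq> t" "x v \<noteq> t" "x w \<noteq> t" by blast
      moreover have "x u \<noteq> x v \<longrightarrow> k v u = k u v" "x u \<noteq> x w \<longrightarrow> k w u = k u w" "x v \<noteq> x w \<longrightarrow> k w v = k v w"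
        using k_sym that by blast+
      moreover have "x u \<noteq> x v \<longrightarrow> x u \<noteq> x w \<longrightarrow> k u v = k u w"
        "x v \<noteq> x u \<longrightarrow> x v \<noteq> x w \<longrightarrow> k v u = k v w"
        "x w \<noteq> x u \<longrightarrow> x w \<noteq> x v \<longrightarrow> k w u = k w v"
        using k_triangle that edge_sym by blast+
      ultimately show ?thesis unfolding c_def by cases simp_all
    qed
  qed
  then have "\<forall>t. \<exists>d. \<forall>(u, v)\<in>E. c t u v = d v - d u" by (rule allI)
  from choice[OF this] obtain d where "\<forall>t. \<forall>(u, v)\<in>E. c t u v = d t v - d t u" ..
  then have d: "c t u v = d t v - d t u" if "(u, v) \<in> E" for t u v
    using that by (auto dest: spec[of _ t])
  have flat: "d t u = d t v" if "u \<in> V" "v \<in> V" "x u \<noteq> t" "x v \<noteq> t" for t u v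
  proof -
    have "(u, v) \<in> {(a, b) \<in> E. x a \<noteq> t \<and> x b \<noteq> t}\<^sup>*"
      using x that unfolding robustly_connected_def by blast
    then show ?thesis
    proof (induction rule: rtrancl_induct)
      case (step y z)
      then show ?case using d[of y z t] by (auto simp: c_def)
    qed simp
  qed
  have "\<exists>v. (u, v) \<in> E \<and> x u \<noteq> x v" if "u \<in> V" for u
    using x that unfolding robustly_connected_def by metis
  then obtain n where n: "\<And>u. u \<in> V \<Longrightarrow> (u, n u) \<in> E \<and> x u \<noteq> x (n u)" by metis
  define s where "s u = k u (n u)" for u
  have nV: "n u \<in> V" if "u \<in> V" for u using n[OF that] edges by auto
  have val: "k u v = s u" if "(u, v) \<in> E" "x u \<noteq> x v" for u v
  proof -
    have uv: "u \<in> V" "v \<in> V" using that edges by auto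
    have "d (x u) v = d (x u) (n u)"
      using uv nV[OF uv(1)] n[OF uv(1)] that by (intro flat) auto
    moreover have "k u v = d (x u) v - d (x u) u" using d[OF that(1), of "x u"] that by (simp add: c_def)
    moreover have "s u = d (x u) (n u) - d (x u) u"
      using d[of u "n u" "x u"] n[OF uv(1)] by (simp add: c_def s_def)
    ultimately show ?thesis by simp
  qed
  \<comment> \<open>An edge with equal values of x lies inside one level set. There the cocycle is
    zero, so \<open>d\<close> agrees at both ends, while off the level set \<open>d\<close> is flat.
    This carries s across the edges on which k says nothing.\<close>
  have s_edge: "s u = s v" if "(u, v) \<in> E" for u v
  proof (cases "x u = x v")
    case True
    have uv: "u \<in> V" "v \<in> V" using that edges by auto
    have "d (x u) (n u) = d (x u) (n v)"
      using uv nV[OF uv(1)] nV[OF uv(2)] n[OF uv(1)] n[OF uv(2)] True by (intro flat) auto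
    moreover have "d (x u) u = d (x u) v" using d[OF that, of "x u"] True by (simp add: c_def)
    moreover have "s u = d (x u) (n u) - d (x u) u"
      using d[of u "n u" "x u"] n[OF uv(1)] by (simp add: c_def s_def)
    moreover have "s v = d (x u) (n v) - d (x u) v"
      using d[of v "n v" "x u"] n[OF uv(2)] True by (simp add: c_def s_def)
    ultimately show ?thesis by simp
  next
    case False
    then show ?thesis using val[OF that] val[OF edge_sym[OF that]] k_sym[OF that] by simp
  qed
  show ?thesis
  proof (cases "V = {}")
    case True
    then show ?thesis using edges by auto
  next
    case False
    then obtain b where b: "b \<in> V" by blast
    have "k u v = s b" if "(u, v) \<in> E" "x u \<noteq> x v" for u v
      using val[OF that] constant_of_edges[of s u b] s_edge b edges that by auto
    then show ?thesis by blast
  qed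
qed

text \<open>
  A function of the vertices that is invariant along these edges is also a triangle-invariant function
  of the edges.
\<close>

lemma living_edges_connected:
  assumes x: "robustly_connected V E x" and uv: "u \<in> V" "v \<in> V"
  shows "(u, v) \<in> {(a, b) \<in> E. x a \<noteq> x b}\<^sup>*"
proof -
  let ?L = "{(a, b) \<in> E. x a \<noteq> x b}"
  have symL: "sym ?L" using edge_sym by (auto intro: symI)
  \<comment> \<open>Used as the edge function that reads only the first end point:
    \<open>k_triangle\<close> is then trivial, and \<open>k_sym\<close> is \<open>inv\<close>
    below.\<close>
  define \<kappa> :: "'v \<Rightarrow> real" where "\<kappa> w = (if (u, w) \<in> ?L\<^sup>* then 1 else 0)" for w
  have inv: "\<kappa> a = \<kappa> b" if "(a, b) \<in> E" "x a \<noteq> x b" for a b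
  proof -
    have "(a, b) \<in> ?L" "(b, a) \<in> ?L" using that edge_sym by auto
    then have "(u, a) \<in> ?L\<^sup>* \<longleftrightarrow> (u, b) \<in> ?L\<^sup>*" by (meson rtrancl.rtrancl_into_rtrancl)
    then show ?thesis by (simp add: \<kappa>_def)
  qed
  have "\<exists>m. \<forall>(a, b)\<in>E. x a \<noteq> x b \<longrightarrow> \<kappa> a = m"
    by (rule triangle_invariant_constant[OF x]) (use inv in auto)
  then obtain m where m: "\<forall>(a, b)\<in>E. x a \<noteq> x b \<longrightarrow> \<kappa> a = m" ..
  have "\<kappa> w = m" if w: "w \<in> V" for w
  proof -
    obtain z where "(w, z) \<in> E" "x z \<noteq> x w" using x w unfolding robustly_connected_def by blast
    then show ?thesis using m by force
  qed
  then have "\<kappa> u = \<kappa> v" using uv by simp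
  then show ?thesis by (simp add: \<kappa>_def split: if_splits)
qed

end

section \<open>Right-angled Artin groups and generators of Bestvina--Brady groups\<close>

fun word_value :: "('g, 'm) monoid_scheme \<Rightarrow> ('x \<Rightarrow> 'g) \<Rightarrow> 'x word \<Rightarrow> 'g" where
  "word_value H f [] = \<one>\<^bsub>H\<^esub>"
| "word_value H f ((x, b) # w) = (if b then f x else inv\<^bsub>H\<^esub> f x) \<otimes>\<^bsub>H\<^esub> word_value H f w"

context group
begin

lemma word_value_closed:
  assumes f: "\<And>x. x \<in> X \<Longrightarrow> f x \<in> carrier G" and "w \<in> words X"
  shows "word_value G f w \<in> carrier G"
  using assms(2)
proof (induction w)
  case (Cons a w)
  then show ?case using f by (cases a) auto
qed simp

lemma word_value_append:
  assumes f: "\<And>x. x \<in> X \<Longrightarrow> f x \<in> carrier G" and u: "u \<in> words X" and v: "v \<in> words X"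
  shows "word_value G f (u @ v) = word_value G f u \<otimes> word_value G f v"
  using u
proof (induction u)
  case Nil
  then show ?case using word_value_closed[of X f, OF f v] by simp
next
  case (Cons a u)
  then have "word_value G f u \<in> carrier G" using word_value_closed[of X f, OF f] by auto
  then show ?case using Cons f word_value_closed[of X f, OF f v] by (cases a) (auto simp: m_assoc)
qed

lemma word_value_word_eq:
  assumes f: "\<And>x. x \<in> X \<Longrightarrow> f x \<in> carrier G" and R: "\<And>r. r \<in> R \<Longrightarrow> r \<in> words X \<Longrightarrow> word_value G f r = \<one>"
    and "(u, v) \<in> word_eq X R"
  shows "word_value G f u = word_value G f v"
  using assms(3)
proof (induction rule: word_eq.induct)
  case (word_eq_cancel u v x b)
  then have cl: "f x \<in> carrier G" "word_value G f u \<in> carrier G" "word_value G f v \<in> carrier G"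
    using f word_value_closed[of X f, OF f] by auto
  have w: "[(x, b), (x, \<not> b)] \<in> words X" using word_eq_cancel by simp
  have "word_value G f (u @ [(x, b), (x, \<not> b)] @ v)
      = word_value G f u \<otimes> (word_value G f [(x, b), (x, \<not> b)] \<otimes> word_value G f v)"
    using word_eq_cancel w by (simp only: word_value_append[of X f, OF f] append_in_lists_conv)
  moreover have "word_value G f [(x, b), (x, \<not> b)] = \<one>" using cl by simp
  ultimately show ?case using cl word_eq_cancel by (simp add: word_value_append[of X f, OF f])
next
  case (word_eq_relator u v r)
  then have "word_value G f (u @ r @ v) = word_value G f u \<otimes> (word_value G f r \<otimes> word_value G f v)"
    by (simp only: word_value_append[of X f, OF f] append_in_lists_conv)
  then show ?case using R word_eq_relator word_value_closed[of X f, OF f] by (simp add: word_value_append[of X f, OF f])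
qed auto

end

lemma presented_group_lift:
  assumes "group H" and f: "\<And>x. x \<in> X \<Longrightarrow> f x \<in> carrier H"
    and R: "\<And>r. r \<in> R \<Longrightarrow> r \<in> words X \<Longrightarrow> word_value H f r = \<one>\<^bsub>H\<^esub>"
  shows "\<exists>h\<in>hom (presented_group X R) H. \<forall>w\<in>words X. h (word_eq X R `` {w}) = word_value H f w"
proof -
  interpret H: group H by (rule assms(1))
  define h where "h A = word_value H f (SOME w. w \<in> A)" for A
  have val: "h (word_eq X R `` {w}) = word_value H f w" if "w \<in> words X" for w
  proof -
    have "w \<in> word_eq X R `` {w}" using word_eq_refl[OF that] by simp
    then have "(SOME u. u \<in> word_eq X R `` {w}) \<in> word_eq X R `` {w}" by (rule someI)
    then have "(w, SOME u. u \<in> word_eq X R `` {w}) \<in> word_eq X R" by (simp only: Image_singleton_iff)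
    from H.word_value_word_eq[of X f R, OF f R this] show ?thesis by (simp add: h_def)
  qed
  have rep: "\<exists>u\<in>words X. A = word_eq X R `` {u}" if "A \<in> carrier (presented_group X R)" for A
    using that unfolding presented_group_def by (auto simp: quotient_def)
  have "h \<in> hom (presented_group X R) H"
  proof (rule homI)
    fix A
    assume "A \<in> carrier (presented_group X R)"
    then show "h A \<in> carrier H" using rep val H.word_value_closed[of X f, OF f] by metis
  next
    fix A B
    assume "A \<in> carrier (presented_group X R)" "B \<in> carrier (presented_group X R)"
    then obtain u v where uv: "u \<in> words X" "v \<in> words X" "A = word_eq X R `` {u}" "B = word_eq X R `` {v}"
      using rep by metis
    then have "u @ v \<in> words X" by simp
    then show "h (A \<otimes>\<^bsub>presented_group X R\<^esub> B) = h A \<otimes>\<^bsub>H\<^esub> h B"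
      using uv H.word_value_append[of X f, OF f uv(1,2)] by (simp only: presented_group_mult val)
  qed
  then show ?thesis using val by blast
qed

lemma raag_lift:
  assumes "group H" and f: "\<And>v. v \<in> pverts \<Gamma> \<Longrightarrow> f v \<in> carrier H"
    and comm: "\<And>u v. (u, v) \<in> parcs \<Gamma> \<Longrightarrow> f u \<otimes>\<^bsub>H\<^esub> f v = f v \<otimes>\<^bsub>H\<^esub> f u"
  shows "\<exists>h\<in>hom (raag \<Gamma>) H. \<forall>v\<in>pverts \<Gamma>. h (raag_gen \<Gamma> v) = f v"
proof -
  interpret H: group H by (rule assms(1))
  have "word_value H f r = \<one>\<^bsub>H\<^esub>" if r: "r \<in> raag_relators \<Gamma>" "r \<in> words (pverts \<Gamma>)" for r
  proof -
    obtain u v where uv: "r = commutator_word u v" "(u, v) \<in> parcs \<Gamma>"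
      using r(1) by (auto simp: raag_relators_def)
    have V: "f u \<in> carrier H" "f v \<in> carrier H"
      using r(2) f unfolding uv(1) commutator_word_def by auto
    have "f u \<otimes>\<^bsub>H\<^esub> (f v \<otimes>\<^bsub>H\<^esub> (inv\<^bsub>H\<^esub> f u \<otimes>\<^bsub>H\<^esub> inv\<^bsub>H\<^esub> f v))
        = (f v \<otimes>\<^bsub>H\<^esub> f u) \<otimes>\<^bsub>H\<^esub> inv\<^bsub>H\<^esub> (f v \<otimes>\<^bsub>H\<^esub> f u)"
      using V comm[OF uv(2)] by (simp add: H.m_assoc[symmetric] H.inv_mult_group)
    also have "\<dots> = \<one>\<^bsub>H\<^esub>" using V by simp
    finally show ?thesis using V by (simp add: uv(1) commutator_word_def)
  qed
  then have "\<exists>h\<in>hom (presented_group (pverts \<Gamma>) (raag_relators \<Gamma>)) H.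
      \<forall>w\<in>words (pverts \<Gamma>). h (word_eq (pverts \<Gamma>) (raag_relators \<Gamma>) `` {w}) = word_value H f w"
    by (intro presented_group_lift[OF assms(1)] f)
  then obtain h where "h \<in> hom (presented_group (pverts \<Gamma>) (raag_relators \<Gamma>)) H"
    and val: "\<forall>w\<in>words (pverts \<Gamma>). h (word_eq (pverts \<Gamma>) (raag_relators \<Gamma>) `` {w}) = word_value H f w"
    by (elim bexE)
  then have h: "h \<in> hom (raag \<Gamma>) H" by (simp only: raag_def)
  have "h (raag_gen \<Gamma> v) = f v" if "v \<in> pverts \<Gamma>" for v
    using bspec[OF val, of "[(v, True)]"] that f[OF that] by (simp add: raag_gen_def)
  then show ?thesis using h by blast
qed

lemma raag_gen_closed: "v \<in> pverts \<Gamma> \<Longrightarrow> raag_gen \<Gamma> v \<in> carrier (raag \<Gamma>)"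
  unfolding raag_gen_def raag_def presented_group_def by (auto intro: quotientI)

lemma raag_class_Cons:
  assumes "v \<in> pverts \<Gamma>" "w \<in> words (pverts \<Gamma>)"
  shows "word_eq (pverts \<Gamma>) (raag_relators \<Gamma>) `` {(v, b) # w} =
    (if b then raag_gen \<Gamma> v else inv\<^bsub>raag \<Gamma>\<^esub> raag_gen \<Gamma> v) \<otimes>\<^bsub>raag \<Gamma>\<^esub>
      (word_eq (pverts \<Gamma>) (raag_relators \<Gamma>) `` {w})"
proof -
  interpret group "raag \<Gamma>" by (rule group_raag)
  let ?c = "\<lambda>w. word_eq (pverts \<Gamma>) (raag_relators \<Gamma>) `` {w}"
  have mult: "?c u \<otimes>\<^bsub>raag \<Gamma>\<^esub> ?c w = ?c (u @ w)" if "u \<in> words (pverts \<Gamma>)" "w \<in> words (pverts \<Gamma>)" for u w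
    unfolding raag_def by (rule presented_group_mult[OF that])
  have "?c ([(v, False)] @ [(v, True)]) = ?c []"
    using word_eq_cancel[of "[]" "pverts \<Gamma>" "[]" v False "raag_relators \<Gamma>"] assms(1)
    by (intro equiv_class_eq[OF equiv_word_eq]) auto
  then have "?c [(v, False)] \<otimes>\<^bsub>raag \<Gamma>\<^esub> raag_gen \<Gamma> v = \<one>\<^bsub>raag \<Gamma>\<^esub>"
    using mult[of "[(v, False)]" "[(v, True)]"] assms(1)
    unfolding raag_gen_def by (simp add: raag_def presented_group_def)
  moreover have "?c [(v, False)] \<in> carrier (raag \<Gamma>)"
    using assms(1) unfolding raag_def presented_group_def by (auto intro: quotientI)
  ultimately have "inv\<^bsub>raag \<Gamma>\<^esub> raag_gen \<Gamma> v = ?c [(v, False)]"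
    using raag_gen_closed[OF assms(1)] by (intro inv_equality)
  then show ?thesis
    using mult[of "[(v, b)]" w] assms unfolding raag_gen_def by (cases b) auto
qed

lemma raag_carrier_rep:
  assumes "g \<in> carrier (raag \<Gamma>)"
  obtains w where "w \<in> words (pverts \<Gamma>)" "g = word_eq (pverts \<Gamma>) (raag_relators \<Gamma>) `` {w}"
  using assms unfolding raag_def presented_group_def by (auto simp: quotient_def)

lemma raag_gen_commute:
  assumes "(u, v) \<in> parcs \<Gamma>" "u \<in> pverts \<Gamma>" "v \<in> pverts \<Gamma>"
  shows "raag_gen \<Gamma> u \<otimes>\<^bsub>raag \<Gamma>\<^esub> raag_gen \<Gamma> v = raag_gen \<Gamma> v \<otimes>\<^bsub>raag \<Gamma>\<^esub> raag_gen \<Gamma> u"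
proof -
  interpret group "raag \<Gamma>" by (rule group_raag)
  let ?c = "\<lambda>w. word_eq (pverts \<Gamma>) (raag_relators \<Gamma>) `` {w}"
  let ?u = "raag_gen \<Gamma> u" and ?v = "raag_gen \<Gamma> v"
  note cl = raag_gen_closed[OF assms(2)] raag_gen_closed[OF assms(3)]
  have e: "?c [] = \<one>\<^bsub>raag \<Gamma>\<^esub>" by (simp add: raag_def presented_group_def)
  have "?c (commutator_word u v) = ?c []"
    using word_eq_relator[of "[]" "pverts \<Gamma>" "[]" "commutator_word u v" "raag_relators \<Gamma>"] assms
    by (intro equiv_class_eq[OF equiv_word_eq]) (auto simp: commutator_word_def raag_relators_def)
  then have "?u \<otimes>\<^bsub>raag \<Gamma>\<^esub> (?v \<otimes>\<^bsub>raag \<Gamma>\<^esub> (inv\<^bsub>raag \<Gamma>\<^esub> ?u \<otimes>\<^bsub>raag \<Gamma>\<^esub> inv\<^bsub>raag \<Gamma>\<^esub> ?v)) = \<one>\<^bsub>raag \<Gamma>\<^esub>"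
    using cl assms by (simp add: commutator_word_def raag_class_Cons e)
  then have "(?u \<otimes>\<^bsub>raag \<Gamma>\<^esub> ?v) \<otimes>\<^bsub>raag \<Gamma>\<^esub> inv\<^bsub>raag \<Gamma>\<^esub> (?v \<otimes>\<^bsub>raag \<Gamma>\<^esub> ?u) = \<one>\<^bsub>raag \<Gamma>\<^esub>"
    using cl by (simp add: m_assoc inv_mult_group)
  then show ?thesis using cl by (metis inv_closed inv_equality inv_inv m_closed)
qed

section \<open>Generation of the Bestvina-Brady group by edge elements\<close>

lemma (in group) cancel_left:
  assumes "x \<in> carrier G" "y \<in> carrier G"
  shows "inv x \<otimes> (x \<otimes> y) = y" "x \<otimes> (inv x \<otimes> y) = y"
  using assms by (simp_all add: m_assoc[symmetric])

text \<open>Since a centralizes s, the elements c and c a^-1 conjugate s alike, and the second one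
  lies in H.\<close>

lemma (in group) conj_closed_of_coset:
  assumes "subgroup H G" "c \<in> carrier G" "a \<in> carrier G" "c \<otimes> inv a \<in> H" "s \<in> H" "a \<otimes> s = s \<otimes> a"
  shows "c \<otimes> s \<otimes> inv c \<in> H"
proof -
  have s: "s \<in> carrier G" using assms(1,5) by (rule subgroup.mem_carrier)
  have "inv (c \<otimes> inv a) \<in> H" using assms(1,4) by (rule subgroup.m_inv_closed)
  then have "a \<otimes> inv c \<in> H" using assms(2,3) by (simp add: inv_mult_group)
  then have "(c \<otimes> inv a) \<otimes> s \<otimes> (a \<otimes> inv c) \<in> H"
    using assms(1,4,5) subgroup.m_closed[OF assms(1)] by blast
  moreover have "(c \<otimes> inv a) \<otimes> s \<otimes> (a \<otimes> inv c) = c \<otimes> (inv a \<otimes> (s \<otimes> a)) \<otimes> inv c"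
    using assms(2,3) s by (simp add: m_assoc)
  moreover have "inv a \<otimes> (s \<otimes> a) = s"
    using assms(3) s by (simp flip: assms(6) add: m_assoc[symmetric])
  ultimately show ?thesis by simp
qed

lemma (in group) conj_generate:
  assumes "S \<subseteq> carrier G" "c \<in> carrier G" "\<And>s. s \<in> S \<Longrightarrow> c \<otimes> s \<otimes> inv c \<in> generate G S" "h \<in> generate G S"
  shows "c \<otimes> h \<otimes> inv c \<in> generate G S"
  using assms(4)
proof (induction rule: generate.induct)
  case one
  then show ?case using assms(2) generate.one by simp
next
  case (incl h)
  then show ?case by (rule assms(3))
next
  case (inv h)
  then have "inv (c \<otimes> h \<otimes> inv c) \<in> generate G S"
    using assms(1) by (intro generate_m_inv_closed assms(3))
  moreover have "h \<in> carrier G" using inv assms(1) by blast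
  ultimately show ?case using assms(2) by (simp add: inv_mult_group m_assoc)
next
  case (eng h1 h2)
  then have "h1 \<in> carrier G" "h2 \<in> carrier G" using assms(1) generate_in_carrier by blast+
  then have "c \<otimes> (h1 \<otimes> h2) \<otimes> inv c = (c \<otimes> h1 \<otimes> inv c) \<otimes> (c \<otimes> h2 \<otimes> inv c)"
    using assms(2) by (simp add: m_assoc cancel_left)
  then show ?case using eng generate.eng by metis
qed

definition edge_elements :: "'v pair_pre_digraph \<Rightarrow> ('v \<times> 'v) set \<Rightarrow> 'v word set set" where
  "edge_elements \<Gamma> E = (\<lambda>(u, v). raag_gen \<Gamma> u \<otimes>\<^bsub>raag \<Gamma>\<^esub> inv\<^bsub>raag \<Gamma>\<^esub> raag_gen \<Gamma> v) ` E"

lemma subgroup_bestvina_brady: "subgroup (carrier (bestvina_brady \<Gamma>)) (raag \<Gamma>)"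
proof -
  interpret group_hom "raag \<Gamma>" integer_group raag_height
    by (simp add: group_hom_def group_hom_axioms_def group_raag raag_height_hom)
  show ?thesis unfolding bestvina_brady_def using subgroup_kernel by simp
qed

lemma bestvina_brady_simps:
  "g \<in> carrier (bestvina_brady \<Gamma>) \<longleftrightarrow> g \<in> carrier (raag \<Gamma>) \<and> raag_height g = 0"
  "g \<otimes>\<^bsub>bestvina_brady \<Gamma>\<^esub> h = g \<otimes>\<^bsub>raag \<Gamma>\<^esub> h"
  "\<one>\<^bsub>bestvina_brady \<Gamma>\<^esub> = \<one>\<^bsub>raag \<Gamma>\<^esub>"
  by (auto simp: bestvina_brady_def kernel_def integer_group_def)

lemma raag_height_mult:
  "g \<in> carrier (raag \<Gamma>) \<Longrightarrow> h \<in> carrier (raag \<Gamma>) \<Longrightarrow> raag_height (g \<otimes>\<^bsub>raag \<Gamma>\<^esub> h) = raag_height g + raag_height h"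
  using hom_mult[OF raag_height_hom] by simp

lemma raag_height_inv:
  assumes "g \<in> carrier (raag \<Gamma>)"
  shows "raag_height (inv\<^bsub>raag \<Gamma>\<^esub> g) = - raag_height g"
proof -
  interpret group_hom "raag \<Gamma>" integer_group raag_height
    by (simp add: group_hom_def group_hom_axioms_def group_raag raag_height_hom)
  show ?thesis using hom_inv[OF assms] by simp
qed

lemma edge_element_closed:
  assumes "u \<in> pverts \<Gamma>" "v \<in> pverts \<Gamma>"
  shows "raag_gen \<Gamma> u \<otimes>\<^bsub>raag \<Gamma>\<^esub> inv\<^bsub>raag \<Gamma>\<^esub> raag_gen \<Gamma> v \<in> carrier (bestvina_brady \<Gamma>)"
proof -
  interpret group "raag \<Gamma>" by (rule group_raag)
  show ?thesis using raag_gen_closed[OF assms(1)] raag_gen_closed[OF assms(2)] assms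
    by (simp add: bestvina_brady_simps raag_height_mult raag_height_inv raag_height_gen)
qed

text \<open>Let H be generated by the edge elements. The element s = a_u a_w^-1 of an edge commutes
  with a_u, so conjugating it by a_v amounts to conjugating by a_v a_u^-1, which is in H because E
  is connected. Thus H is normal and every group element is an element of H times a power of one
  fixed a_b; height zero makes the power trivial. As E need only be connected, edges on which a
  character vanishes can later be left out.\<close>

lemma bestvina_brady_generate:
  assumes "pair_graph \<Gamma>" and E: "E \<subseteq> parcs \<Gamma>" "sym E"
    and conn: "\<And>u v. u \<in> pverts \<Gamma> \<Longrightarrow> v \<in> pverts \<Gamma> \<Longrightarrow> (u, v) \<in> E\<^sup>*"
  shows "generate (bestvina_brady \<Gamma>) (edge_elements \<Gamma> E) = carrier (bestvina_brady \<Gamma>)"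
proof -
  interpret pair_graph \<Gamma> by (rule assms(1))
  interpret A: group "raag \<Gamma>" by (rule group_raag)
  let ?A = "raag \<Gamma>" and ?B = "bestvina_brady \<Gamma>" and ?S = "edge_elements \<Gamma> E" and ?V = "pverts \<Gamma>"
  let ?a = "raag_gen \<Gamma>"
  define H where "H = generate ?A ?S"
  have a: "?a v \<in> carrier ?A" if "v \<in> ?V" for v using that by (rule raag_gen_closed)
  have EV: "u \<in> ?V" "v \<in> ?V" if "(u, v) \<in> E" for u v using that E(1) in_arcsD1 in_arcsD2 by auto
  have comm: "?a u \<otimes>\<^bsub>?A\<^esub> ?a v = ?a v \<otimes>\<^bsub>?A\<^esub> ?a u" if "(u, v) \<in> E" for u v
    by (rule raag_gen_commute) (use that E(1) EV[OF that] in auto)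
  have SB: "?S \<subseteq> carrier ?B"
    unfolding edge_elements_def by (clarify, rule edge_element_closed) (auto dest: EV)
  then have SA: "?S \<subseteq> carrier ?A" by (auto simp: bestvina_brady_simps)
  have gB: "generate ?B ?S = H"
    unfolding H_def bestvina_brady_def
    using A.generate_consistent[OF SB subgroup_bestvina_brady] by (simp add: bestvina_brady_def)
  have HB: "H \<subseteq> carrier ?B"
    unfolding H_def using A.generate_subgroup_incl[OF SB subgroup_bestvina_brady] .
  have sub: "subgroup H ?A" unfolding H_def using SA by (rule A.generate_is_subgroup)
  have SH: "?a u \<otimes>\<^bsub>?A\<^esub> inv\<^bsub>?A\<^esub> ?a v \<in> H" if "(u, v) \<in> E" for u v
    unfolding H_def edge_elements_def using that by (force intro: generate.incl)
  have r1: "?a u \<otimes>\<^bsub>?A\<^esub> inv\<^bsub>?A\<^esub> ?a v \<in> H" if "u \<in> ?V" "v \<in> ?V" for u v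
    using conn[OF that]
  proof (induction rule: rtrancl_induct)
    case base
    then show ?case using a[OF that(1)] subgroup.one_closed[OF sub] by simp
  next
    case (step v w)
    have "(?a u \<otimes>\<^bsub>?A\<^esub> inv\<^bsub>?A\<^esub> ?a v) \<otimes>\<^bsub>?A\<^esub> (?a v \<otimes>\<^bsub>?A\<^esub> inv\<^bsub>?A\<^esub> ?a w) \<in> H"
      by (rule subgroup.m_closed[OF sub step.IH SH[OF step(2)]])
    then show ?case using a EV[OF step(2)] that(1) by (simp add: A.m_assoc A.cancel_left)
  qed
  \<comment> \<open>Along an edge the generators commute, so a_v^-1 a_w = a_w a_v^-1 is the element
    of the reversed edge; this is where symmetry of E enters.\<close>
  have r2: "inv\<^bsub>?A\<^esub> ?a u \<otimes>\<^bsub>?A\<^esub> ?a v \<in> H" if "u \<in> ?V" "v \<in> ?V" for u v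
    using conn[OF that]
  proof (induction rule: rtrancl_induct)
    case base
    then show ?case using a[OF that(1)] subgroup.one_closed[OF sub] by simp
  next
    case (step v w)
    note vw = a[OF EV(1)[OF step(2)]] a[OF EV(2)[OF step(2)]]
    have "?a w \<otimes>\<^bsub>?A\<^esub> inv\<^bsub>?A\<^esub> ?a v \<in> H" using SH step(2) E(2) by (blast dest: symD)
    moreover have "?a w \<otimes>\<^bsub>?A\<^esub> inv\<^bsub>?A\<^esub> ?a v = inv\<^bsub>?A\<^esub> ?a v \<otimes>\<^bsub>?A\<^esub> ?a w"
      using comm[OF step(2)] vw by (metis A.inv_closed A.inv_solve_left A.inv_solve_right A.m_assoc A.m_closed)
    ultimately have "(inv\<^bsub>?A\<^esub> ?a u \<otimes>\<^bsub>?A\<^esub> ?a v) \<otimes>\<^bsub>?A\<^esub> (inv\<^bsub>?A\<^esub> ?a v \<otimes>\<^bsub>?A\<^esub> ?a w) \<in> H"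
      by (intro subgroup.m_closed[OF sub step.IH]) simp
    moreover have "?a v \<otimes>\<^bsub>?A\<^esub> (inv\<^bsub>?A\<^esub> ?a v \<otimes>\<^bsub>?A\<^esub> ?a w) = ?a w"
      using vw by (simp add: A.m_assoc[symmetric])
    ultimately show ?case using vw a[OF that(1)] by (simp add: A.m_assoc)
  qed
  have conj_gen: "c \<otimes>\<^bsub>?A\<^esub> h \<otimes>\<^bsub>?A\<^esub> inv\<^bsub>?A\<^esub> c \<in> H"
    if c: "c = ?a v \<or> c = inv\<^bsub>?A\<^esub> ?a v" and v: "v \<in> ?V" and h: "h \<in> H" for c v h
    unfolding H_def
  proof (rule A.conj_generate[OF SA])
    show cc: "c \<in> carrier ?A" using c a[OF v] by auto
    show "h \<in> generate ?A ?S" using h by (simp add: H_def)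
    fix s
    assume "s \<in> ?S"
    then obtain u w where uw: "(u, w) \<in> E" and s: "s = ?a u \<otimes>\<^bsub>?A\<^esub> inv\<^bsub>?A\<^esub> ?a w"
      by (auto simp: edge_elements_def)
    note cl = a[OF EV(1)[OF uw]] a[OF EV(2)[OF uw]]
    have us: "?a u \<otimes>\<^bsub>?A\<^esub> s = s \<otimes>\<^bsub>?A\<^esub> ?a u"
    proof -
      have "?a u \<otimes>\<^bsub>?A\<^esub> inv\<^bsub>?A\<^esub> ?a w = inv\<^bsub>?A\<^esub> ?a w \<otimes>\<^bsub>?A\<^esub> ?a u"
        using comm[OF uw] cl by (metis A.inv_closed A.inv_solve_left A.inv_solve_right A.m_assoc A.m_closed)
      then have "?a u \<otimes>\<^bsub>?A\<^esub> s = ?a u \<otimes>\<^bsub>?A\<^esub> (inv\<^bsub>?A\<^esub> ?a w \<otimes>\<^bsub>?A\<^esub> ?a u)" unfolding s by simp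
      also have "\<dots> = s \<otimes>\<^bsub>?A\<^esub> ?a u" unfolding s using cl by (simp add: A.m_assoc)
      finally show ?thesis .
    qed
    have sH: "s \<in> H" using SH[OF uw] s by simp
    then have sc: "s \<in> carrier ?A" using subgroup.mem_carrier[OF sub] by blast
    show "c \<otimes>\<^bsub>?A\<^esub> s \<otimes>\<^bsub>?A\<^esub> inv\<^bsub>?A\<^esub> c \<in> generate ?A ?S"
      using c
    proof
      assume "c = ?a v"
      then show ?thesis
        using A.conj_closed_of_coset[OF sub cc cl(1) _ sH us] r1[OF v EV(1)[OF uw]] by (simp add: H_def)
    next
      assume c: "c = inv\<^bsub>?A\<^esub> ?a v"
      have "inv\<^bsub>?A\<^esub> ?a u \<otimes>\<^bsub>?A\<^esub> s = s \<otimes>\<^bsub>?A\<^esub> inv\<^bsub>?A\<^esub> ?a u"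
        using us sc cl by (metis A.inv_closed A.inv_solve_left A.inv_solve_right A.m_assoc A.m_closed)
      then show ?thesis
        using A.conj_closed_of_coset[OF sub cc A.inv_closed[OF cl(1)] _ sH] r2[OF v EV(1)[OF uw]] c cl
        by (simp add: H_def)
    qed
  qed
  have BH: "carrier ?B \<subseteq> H"
  proof (cases "?V = {}")
    case True
    then have "words ?V = {[]}" by auto
    show ?thesis
    proof
      fix g
      assume "g \<in> carrier ?B"
      then have "g = \<one>\<^bsub>?A\<^esub>"
        using \<open>words ?V = {[]}\<close> by (auto simp: bestvina_brady_simps raag_def presented_group_def quotient_def)
      then show "g \<in> H" using subgroup.one_closed[OF sub] by simp
    qed
  next
    case False
    then obtain b where b: "b \<in> ?V" by blast
    note ab = a[OF b]
    have "\<exists>h\<in>H. word_eq ?V (raag_relators \<Gamma>) `` {w} = h \<otimes>\<^bsub>?A\<^esub> ?a b [^]\<^bsub>?A\<^esub> exponent_sum w"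
      if "w \<in> words ?V" for w
      using that
    proof (induction rule: lists.induct)
      case Nil
      have "word_eq ?V (raag_relators \<Gamma>) `` {[]} = \<one>\<^bsub>?A\<^esub>" by (simp add: raag_def presented_group_def)
      then show ?case using subgroup.one_closed[OF sub]
        by (intro bexI[of _ "\<one>\<^bsub>?A\<^esub>"]) (auto simp: exponent_sum_def)
    next
      case (Cons l w)
      obtain v e where l: "l = (v, e)" by (cases l)
      have v: "v \<in> ?V" and w: "w \<in> words ?V" using Cons.hyps l by auto
      obtain h where h: "h \<in> H"
        "word_eq ?V (raag_relators \<Gamma>) `` {w} = h \<otimes>\<^bsub>?A\<^esub> ?a b [^]\<^bsub>?A\<^esub> exponent_sum w"
        using Cons.IH by blast
      have hc: "h \<in> carrier ?A" using subgroup.mem_carrier[OF sub h(1)] .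
      \<comment> \<open>c is the new letter and d the same power of the base generator. Prepending c
        to h b^k gives (c d^-1) (d h d^-1) (d b^k), whose first two factors lie in H.\<close>
      define c d i where "c = (if e then ?a v else inv\<^bsub>?A\<^esub> ?a v)"
        and "d = (if e then ?a b else inv\<^bsub>?A\<^esub> ?a b)" and "i = (if e then 1 else - 1 :: int)"
      have cd: "c \<in> carrier ?A" "d \<in> carrier ?A" "c \<otimes>\<^bsub>?A\<^esub> inv\<^bsub>?A\<^esub> d \<in> H" "d = ?a b [^]\<^bsub>?A\<^esub> i"
        using a[OF v] ab r1[OF v b] r2[OF v b] by (auto simp: c_def d_def i_def A.int_pow_neg)
      have dh: "d \<otimes>\<^bsub>?A\<^esub> h \<otimes>\<^bsub>?A\<^esub> inv\<^bsub>?A\<^esub> d \<in> H" using conj_gen[of d b h] b h(1) by (auto simp: d_def)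
      have "word_eq ?V (raag_relators \<Gamma>) `` {l # w} = c \<otimes>\<^bsub>?A\<^esub> (h \<otimes>\<^bsub>?A\<^esub> ?a b [^]\<^bsub>?A\<^esub> exponent_sum w)"
        unfolding l c_def raag_class_Cons[OF v w] h(2) ..
      also have "\<dots> = (c \<otimes>\<^bsub>?A\<^esub> inv\<^bsub>?A\<^esub> d) \<otimes>\<^bsub>?A\<^esub> (d \<otimes>\<^bsub>?A\<^esub> h \<otimes>\<^bsub>?A\<^esub> inv\<^bsub>?A\<^esub> d)
          \<otimes>\<^bsub>?A\<^esub> (d \<otimes>\<^bsub>?A\<^esub> ?a b [^]\<^bsub>?A\<^esub> exponent_sum w)"
        using cd(1,2) hc A.int_pow_closed[OF ab] by (simp add: A.m_assoc A.cancel_left)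
      also have "d \<otimes>\<^bsub>?A\<^esub> ?a b [^]\<^bsub>?A\<^esub> exponent_sum w = ?a b [^]\<^bsub>?A\<^esub> exponent_sum (l # w)"
        unfolding cd(4) A.int_pow_mult[OF ab, symmetric] by (simp add: l i_def exponent_sum_def)
      finally show ?case using subgroup.m_closed[OF sub cd(3) dh] by blast
    qed
    note rep = this
    show ?thesis
    proof
      fix g
      assume g: "g \<in> carrier ?B"
      then obtain w where w: "w \<in> words ?V" "g = word_eq ?V (raag_relators \<Gamma>) `` {w}"
        using raag_carrier_rep by (metis bestvina_brady_simps(1))
      then have "exponent_sum w = 0" using raag_height_class g by (metis bestvina_brady_simps(1))
      then show "g \<in> H" using rep[OF w(1)] w(2) subgroup.mem_carrier[OF sub] by auto
    qed
  qed
  show ?thesis using gB HB BH by blast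
qed

section \<open>Criteria for connected half spaces\<close>

lemma
  assumes "group G" "\<phi> \<in> characters G"
  shows character_mult: "x \<in> carrier G \<Longrightarrow> y \<in> carrier G \<Longrightarrow> \<phi> (x \<otimes>\<^bsub>G\<^esub> y) = \<phi> x + \<phi> y"
    and character_one: "\<phi> \<one>\<^bsub>G\<^esub> = 0"
    and character_inv: "x \<in> carrier G \<Longrightarrow> \<phi> (inv\<^bsub>G\<^esub> x) = - \<phi> x"
proof -
  interpret group G by (rule assms(1))
  show mult: "\<phi> (x \<otimes>\<^bsub>G\<^esub> y) = \<phi> x + \<phi> y" if "x \<in> carrier G" "y \<in> carrier G" for x y
    using that assms(2) by (auto simp: characters_def hom_def real_group_def)
  show one: "\<phi> \<one>\<^bsub>G\<^esub> = 0" using mult[of "\<one>\<^bsub>G\<^esub>" "\<one>\<^bsub>G\<^esub>"] by simp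
  show "\<phi> (inv\<^bsub>G\<^esub> x) = - \<phi> x" if "x \<in> carrier G"
    using mult[of x "inv\<^bsub>G\<^esub> x"] one that by simp
qed

lemma characterI:
  "(\<And>x y. x \<in> carrier G \<Longrightarrow> y \<in> carrier G \<Longrightarrow> \<phi> (x \<otimes>\<^bsub>G\<^esub> y) = \<phi> x + \<phi> y) \<Longrightarrow>
    \<phi> \<in> extensional (carrier G) \<Longrightarrow> \<phi> \<in> characters G"
  by (auto simp: characters_def hom_def real_group_def)

lemma additive_eq_on_generate:
  fixes \<phi> \<psi> :: "'g \<Rightarrow> real"
  assumes "group G" "S \<subseteq> carrier G"
    and \<phi>: "\<And>x y. x \<in> carrier G \<Longrightarrow> y \<in> carrier G \<Longrightarrow> \<phi> (x \<otimes>\<^bsub>G\<^esub> y) = \<phi> x + \<phi> y"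
    and \<psi>: "\<And>x y. x \<in> carrier G \<Longrightarrow> y \<in> carrier G \<Longrightarrow> \<psi> (x \<otimes>\<^bsub>G\<^esub> y) = \<psi> x + \<psi> y"
    and eq: "\<And>s. s \<in> S \<Longrightarrow> \<phi> s = \<psi> s" and g: "g \<in> generate G S"
  shows "\<phi> g = \<psi> g"
proof -
  interpret group G by (rule assms(1))
  have one: "\<phi> \<one>\<^bsub>G\<^esub> = 0" "\<psi> \<one>\<^bsub>G\<^esub> = 0"
    using \<phi>[of "\<one>\<^bsub>G\<^esub>" "\<one>\<^bsub>G\<^esub>"] \<psi>[of "\<one>\<^bsub>G\<^esub>" "\<one>\<^bsub>G\<^esub>"] by simp_all
  show ?thesis
    using g
  proof (induction rule: generate.induct)
    case (inv h)
    then have "h \<in> carrier G" using assms(2) by blast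
    then show ?case using \<phi>[of h "inv\<^bsub>G\<^esub> h"] \<psi>[of h "inv\<^bsub>G\<^esub> h"] eq[OF inv] one by simp
  next
    case (eng h1 h2)
    then show ?case using \<phi> \<psi> generate_in_carrier[OF assms(2)] by simp
  qed (simp_all add: one eq)
qed

text \<open>The height c is a parameter because left translation by a carries paths at height c to
  paths at height \<phi> a + c.\<close>

definition cayley_step :: "('g, 'm) monoid_scheme \<Rightarrow> 'g set \<Rightarrow> ('g \<Rightarrow> real) \<Rightarrow> real \<Rightarrow> ('g \<times> 'g) set" where
  "cayley_step G S \<phi> c = {(g, h). g \<in> carrier G \<and> h \<in> carrier G \<and> c \<le> \<phi> g \<and> c \<le> \<phi> h \<and>
     (\<exists>s\<in>S. h = g \<otimes>\<^bsub>G\<^esub> s \<or> g = h \<otimes>\<^bsub>G\<^esub> s)}"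

lemma half_connected_iff_rtrancl:
  assumes "group G" "\<phi> \<in> characters G" "S \<subseteq> carrier G"
  shows "half_connected G S \<phi> \<longleftrightarrow>
    (\<forall>g\<in>carrier G. \<forall>h\<in>carrier G. 0 \<le> \<phi> g \<longrightarrow> 0 \<le> \<phi> h \<longrightarrow> (g, h) \<in> (cayley_step G S \<phi> 0)\<^sup>*)"
proof -
  interpret group G by (rule assms(1))
  let ?P = "{g \<in> carrier G. 0 \<le> \<phi> g}"
  let ?H = "with_proj (mk_symmetric (with_proj (cayley_graph G S) \<restriction> ?P))"
  let ?E = "cayley_step G S \<phi> 0"
  have "(g, h) \<in> arcs_ends ?H \<longleftrightarrow> (g, h) \<in> ?E" for g h
  proof -
    have "(g, h) \<in> arcs_ends ?H \<longleftrightarrow>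
        g \<in> ?P \<and> h \<in> ?P \<and> ((g, h) \<in> parcs (cayley_graph G S) \<or> (h, g) \<in> parcs (cayley_graph G S))"
      unfolding mk_symmetric_def arcs_ends_conv by (auto simp: image_iff)
    also have "\<dots> \<longleftrightarrow> (g, h) \<in> ?E"
      unfolding cayley_graph_def cayley_step_def using assms(3) by auto
    finally show ?thesis .
  qed
  then have arcs: "arcs_ends ?H = ?E" by (simp add: set_eq_iff)
  have rt: "(g, h) \<in> rtrancl_on ?P ?E \<longleftrightarrow> (g, h) \<in> ?E\<^sup>*" if "g \<in> ?P" "h \<in> ?P" for g h
  proof
    assume "(g, h) \<in> rtrancl_on ?P ?E"
    then show "(g, h) \<in> ?E\<^sup>*" by (induction rule: rtrancl_on_induct) auto
  next
    assume "(g, h) \<in> ?E\<^sup>*"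
    then show "(g, h) \<in> rtrancl_on ?P ?E"
    proof (induction rule: rtrancl_induct)
      case base
      then show ?case using that(1) by simp
    next
      case (step y z)
      then have "z \<in> ?P" by (auto simp: cayley_step_def)
      with step show ?case by (blast intro: rtrancl_on_into_rtrancl_on)
    qed
  qed
  moreover have "\<one>\<^bsub>G\<^esub> \<in> ?P" by (simp add: character_one[OF assms(1,2)])
  then have "?P \<noteq> {}" by blast
  moreover have "verts ?H = ?P" by (simp add: mk_symmetric_def)
  ultimately show ?thesis
    unfolding half_connected_def Digraph_Component.connected_def strongly_connected_def
      reachable_def arcs
    by auto
qed

section \<open>Commuting generators and crossed homomorphisms\<close>

context group
begin

lemma cayley_step_sym: "(g, h) \<in> (cayley_step G S \<phi> c)\<^sup>* \<Longrightarrow> (h, g) \<in> (cayley_step G S \<phi> c)\<^sup>*"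
  by (rule symmetric_rtrancl) (auto simp: cayley_step_def intro: symI)

lemma cayley_step_mono: "(g, h) \<in> (cayley_step G S \<phi> c)\<^sup>* \<Longrightarrow> d \<le> c \<Longrightarrow> (g, h) \<in> (cayley_step G S \<phi> d)\<^sup>*"
  by (erule rtrancl_mono[THEN subsetD, rotated]) (auto simp: cayley_step_def)

lemma cayley_step_translate:
  assumes \<phi>: "\<phi> \<in> characters G" and S: "S \<subseteq> carrier G" and a: "a \<in> carrier G"
    and "(g, h) \<in> (cayley_step G S \<phi> c)\<^sup>*"
  shows "(a \<otimes> g, a \<otimes> h) \<in> (cayley_step G S \<phi> (\<phi> a + c))\<^sup>*"
  using assms(4)
proof (induction rule: rtrancl_induct)
  case (step y z)
  then have yz: "y \<in> carrier G" "z \<in> carrier G" "c \<le> \<phi> y" "c \<le> \<phi> z"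
    and s: "\<exists>s\<in>S. z = y \<otimes> s \<or> y = z \<otimes> s" by (auto simp: cayley_step_def)
  have "\<exists>s\<in>S. a \<otimes> z = a \<otimes> y \<otimes> s \<or> a \<otimes> y = a \<otimes> z \<otimes> s"
    using s yz a S by (metis m_assoc subsetD)
  then have "(a \<otimes> y, a \<otimes> z) \<in> cayley_step G S \<phi> (\<phi> a + c)"
    using yz a by (simp add: cayley_step_def character_mult[OF is_group \<phi>])
  then show ?case using step.IH by simp
qed simp

text \<open>
  Right translation by a fixed positive element \<open>t\<close> raises a path by a fixed amount: the
  commutation graph lets the two end points of every translated edge be joined high up.
\<close>

lemma half_connected_of_commuting:
  assumes \<phi>: "\<phi> \<in> characters G" and S: "S \<subseteq> carrier G" "finite S" "generate G S = carrier G"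
    and s0: "s0 \<in> S" and nz: "\<And>s. s \<in> S \<Longrightarrow> \<phi> s \<noteq> 0"
    and comm: "\<And>s. s \<in> S \<Longrightarrow> (s0, s) \<in> {(s, t). s \<in> S \<and> t \<in> S \<and> s \<otimes> t = t \<otimes> s}\<^sup>*"
  shows "half_connected G S \<phi>"
proof -
  let ?J = "\<lambda>c. (cayley_step G S \<phi> c)\<^sup>*"
  note mult = character_mult[OF is_group \<phi>] and inv = character_inv[OF is_group \<phi>]
    and one = character_one[OF is_group \<phi>]
  define p where "p s = (if 0 < \<phi> s then s else inv s)" for s
  have Sc: "s \<in> carrier G" if "s \<in> S" for s using that S(1) by blast
  have p: "p s \<in> carrier G" "0 < \<phi> (p s)" if "s \<in> S" for s
    using Sc[OF that] nz[OF that] inv by (auto simp: p_def)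
  have p_edge: "\<exists>s'\<in>S. g \<otimes> p s = g \<otimes> s' \<or> g = g \<otimes> p s \<otimes> s'" if "s \<in> S" "g \<in> carrier G" for s g
    using that Sc by (intro bexI[of _ s]) (auto simp: p_def m_assoc)
  define \<epsilon> where "\<epsilon> = Min ((\<lambda>s. \<phi> (p s)) ` S)"
  have "0 < \<epsilon>" unfolding \<epsilon>_def using S(2) s0 p(2) by (subst Min_gr_iff) auto
  moreover have "\<epsilon> \<le> \<phi> (p s)" if "s \<in> S" for s using S(2) that by (auto simp: \<epsilon>_def)
  ultimately have \<epsilon>: "0 < \<epsilon>" "\<And>s. s \<in> S \<Longrightarrow> \<epsilon> \<le> \<phi> (p s)" by auto
  \<comment> \<open>The two elements are joined through their product, which is higher than either
    of them, so the path stays at height \<epsilon> or above.\<close>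
  have commute_step: "(p s, p t) \<in> ?J \<epsilon>" if "s \<in> S" "t \<in> S" "s \<otimes> t = t \<otimes> s" for s t
  proof -
    note cl = Sc[OF that(1)] Sc[OF that(2)] p(1)[OF that(1)] p(1)[OF that(2)]
    have c1: "inv s \<otimes> t = t \<otimes> inv s"
      using that(3) cl by (metis inv_solve_left inv_solve_right m_assoc inv_closed m_closed)
    have c2: "x \<otimes> inv t = inv t \<otimes> x" if "x \<otimes> t = t \<otimes> x" "x \<in> carrier G" for x
      using that cl by (metis inv_solve_left inv_solve_right m_assoc inv_closed m_closed)
    have st: "p s \<otimes> p t = p t \<otimes> p s"
      using that(3) c1 c2[OF that(3)] c2[OF c1] cl by (auto simp: p_def)
    have e: "\<epsilon> \<le> \<phi> (p s)" "\<epsilon> \<le> \<phi> (p t)" "\<phi> (p s \<otimes> p t) = \<phi> (p s) + \<phi> (p t)"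
      using \<epsilon>(2) that cl mult by auto
    have "(p s, p s \<otimes> p t) \<in> cayley_step G S \<phi> \<epsilon>"
      using e \<epsilon>(1) p_edge[OF that(2) cl(3)] cl by (simp add: cayley_step_def)
    moreover have "(p t, p s \<otimes> p t) \<in> cayley_step G S \<phi> \<epsilon>"
      using e \<epsilon>(1) p_edge[OF that(1) cl(4)] cl by (simp add: cayley_step_def st)
    ultimately show ?thesis using cayley_step_sym by (meson r_into_rtrancl rtrancl_trans)
  qed
  have all: "(p s0, p s) \<in> ?J \<epsilon>" if "s \<in> S" for s
    using comm[OF that]
  proof (induction rule: rtrancl_induct)
    case (step y z)
    then show ?case using commute_step[of y z] by (auto intro: rtrancl_trans)
  qed simp
  define t where "t = p s0"
  have t: "t \<in> carrier G" "0 < \<phi> t" using p[OF s0] by (auto simp: t_def)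
  \<comment> \<open>The path is t, p s, p s s = s p s, s t: first along the commutation graph, then
    one edge, then the translate by s of the way back. Its bound is \<epsilon> above the lower end
    of the edge from the identity to s, so the same gain results for every translate of that
    edge.\<close>
  have swap: "(t, s \<otimes> t) \<in> ?J (min 0 (\<phi> s) + \<epsilon>)" if s: "s \<in> S" for s
  proof -
    have "(t, p s) \<in> ?J (min 0 (\<phi> s) + \<epsilon>)"
      using all[OF s] cayley_step_mono[of t "p s" S \<phi> \<epsilon>] by (simp add: t_def)
    moreover have ps: "p s \<otimes> s = s \<otimes> p s" using Sc[OF s] by (auto simp: p_def)
    have "(p s, s \<otimes> p s) \<in> cayley_step G S \<phi> (min 0 (\<phi> s) + \<epsilon>)"
      using \<epsilon>(2)[OF s] \<epsilon>(1) p[OF s] Sc[OF s] mult s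
      by (auto simp: cayley_step_def ps[symmetric])
    moreover have "(s \<otimes> p s, s \<otimes> t) \<in> ?J (min 0 (\<phi> s) + \<epsilon>)"
      using cayley_step_mono[OF cayley_step_translate[OF \<phi> S(1) Sc[OF s] cayley_step_sym[OF all[OF s]]]]
      by (simp add: t_def)
    ultimately show ?thesis by (meson r_into_rtrancl rtrancl_trans)
  qed
  have push: "(g \<otimes> t, h \<otimes> t) \<in> ?J (c + \<epsilon>)" if "(g, h) \<in> ?J c" for g h c
    using that
  proof (induction rule: rtrancl_induct)
    case (step y z)
    have one_edge: "(y \<otimes> t, y \<otimes> s \<otimes> t) \<in> ?J (c + \<epsilon>)"
      if "y \<in> carrier G" "s \<in> S" "c \<le> \<phi> y" "c \<le> \<phi> (y \<otimes> s)" for y s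
    proof -
      have "c + \<epsilon> \<le> \<phi> y + (min 0 (\<phi> s) + \<epsilon>)" using that mult[OF that(1) Sc[OF that(2)]] by simp
      then show ?thesis
        using cayley_step_mono[OF cayley_step_translate[OF \<phi> S(1) that(1) swap[OF that(2)]]]
          that t Sc[OF that(2)] by (simp add: m_assoc)
    qed
    obtain s where s: "s \<in> S" "z = y \<otimes> s \<or> y = z \<otimes> s" "y \<in> carrier G" "z \<in> carrier G" "c \<le> \<phi> y" "c \<le> \<phi> z"
      using step.hyps(2) by (auto simp: cayley_step_def)
    then have "(y \<otimes> t, z \<otimes> t) \<in> ?J (c + \<epsilon>)"
      using one_edge[of y s] cayley_step_sym[OF one_edge[of z s]] by auto
    then show ?case using step.IH by (rule rtrancl_trans[rotated])
  qed simp
  have low: "\<exists>n::nat. (\<one>, g) \<in> ?J (- real n * \<epsilon>)" if "g \<in> generate G S" for g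
  proof -
    have bound: "\<exists>n::nat. - real n * \<epsilon> \<le> c" for c
    proof -
      obtain n :: nat where "- c < real n * \<epsilon>" using reals_Archimedean3[OF \<epsilon>(1)] by blast
      then show ?thesis by (intro exI[of _ n]) simp
    qed
    have "\<exists>c. (\<one>, g) \<in> ?J c"
      using that
    proof (induction rule: generate.induct)
      case one
      then show ?case by blast
    next
      case (incl h)
      then have "(\<one>, h) \<in> cayley_step G S \<phi> (min 0 (\<phi> h))" using Sc[OF incl] one by (auto simp: cayley_step_def intro!: bexI[of _ h])
      then show ?case by blast
    next
      case (inv h)
      then have "(\<one>, inv h) \<in> cayley_step G S \<phi> (min 0 (\<phi> (inv h)))"
        using Sc[OF inv] one by (auto simp: cayley_step_def intro!: bexI[of _ h])
      then show ?case by blast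
    next
      case (eng h1 h2)
      then obtain c1 c2 where c: "(\<one>, h1) \<in> ?J c1" "(\<one>, h2) \<in> ?J c2" by blast
      have h1: "h1 \<in> carrier G" using eng generate_in_carrier[OF S(1)] by blast
      have "(h1, h1 \<otimes> h2) \<in> ?J (\<phi> h1 + c2)"
        using cayley_step_translate[OF \<phi> S(1) h1 c(2)] h1 by simp
      then have "(\<one>, h1 \<otimes> h2) \<in> ?J (min c1 (\<phi> h1 + c2))"
        using c(1) cayley_step_mono by (meson min.cobounded1 min.cobounded2 rtrancl_trans)
      then show ?case by blast
    qed
    then show ?thesis using bound cayley_step_mono by blast
  qed
  have up: "(g, g \<otimes> t) \<in> ?J 0" if "g \<in> carrier G" "0 \<le> \<phi> g" for g
  proof -
    have "(g, g \<otimes> t) \<in> cayley_step G S \<phi> 0"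
      using that t p_edge[OF s0 that(1)] mult[OF that(1) t(1)] by (simp add: cayley_step_def t_def)
    then show ?thesis by blast
  qed
  \<comment> \<open>Every push by t gains \<epsilon>, and the end points are rejoined by the edges
    from g to g t, which stay in the half space. After n pushes the path lies in the half
    space.\<close>
  have reach: "(\<one>, g) \<in> ?J 0" if "(\<one>, g) \<in> ?J (- real n * \<epsilon>)" "g \<in> carrier G" "0 \<le> \<phi> g" for g n
    using that(1)
  proof (induction n)
    case (Suc n)
    have "(\<one> \<otimes> t, g \<otimes> t) \<in> ?J (- real n * \<epsilon>)"
      using push[OF Suc.prems] by (simp add: algebra_simps)
    moreover have "(\<one>, \<one> \<otimes> t) \<in> ?J (- real n * \<epsilon>)" "(g \<otimes> t, g) \<in> ?J (- real n * \<epsilon>)"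
      using up[of \<one>] cayley_step_sym[OF up[OF that(2,3)]] one \<epsilon>(1) by (auto intro: cayley_step_mono)
    ultimately show ?case using Suc.IH by (meson rtrancl_trans)
  qed simp
  have "(\<one>, g) \<in> ?J 0" if "g \<in> carrier G" "0 \<le> \<phi> g" for g
    using reach[OF _ that] low S(3) that by blast
  then have "(g, h) \<in> ?J 0" if "g \<in> carrier G" "0 \<le> \<phi> g" "h \<in> carrier G" "0 \<le> \<phi> h" for g h
    using that cayley_step_sym by (meson rtrancl_trans)
  then show ?thesis unfolding half_connected_iff_rtrancl[OF is_group \<phi> S(1)] by blast
qed

text \<open>
  A crossed homomorphism into functions on the reals, on which \<open>g\<close> acts as translation by \<open>\<phi> g\<close>:
  along a path in the half space its values only change above a fixed bound.
\<close>

lemma not_half_connected_of_crossed_hom: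
  fixes D :: "'a \<Rightarrow> real \<Rightarrow> real"
  assumes \<phi>: "\<phi> \<in> characters G" and S: "S \<subseteq> carrier G" "finite S"
    and D: "\<And>g h z. g \<in> carrier G \<Longrightarrow> h \<in> carrier G \<Longrightarrow> D (g \<otimes> h) z = D g z + D h (z - \<phi> g)"
    and bounded: "\<And>s. s \<in> S \<Longrightarrow> \<exists>b. \<forall>z<b. D s z = 0"
    and unbounded: "\<And>b. \<exists>g\<in>carrier G. 0 \<le> \<phi> g \<and> (\<exists>z<b. D g z \<noteq> 0)"
  shows "\<not> half_connected G S \<phi>"
proof
  assume conn: "half_connected G S \<phi>"
  obtain B where B: "\<And>s z. s \<in> S \<Longrightarrow> z < B s \<Longrightarrow> D s z = 0" using bounded by metis
  define b where "b = Min (insert 0 (B ` S))"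
  have b: "D s z = 0" if "s \<in> S" "z < b" for s z
    using that S(2) B[OF that(1), of z] by (auto simp: b_def)
  obtain g z where g: "g \<in> carrier G" "0 \<le> \<phi> g" "z < b" "D g z \<noteq> 0" using unbounded by blast
  have "(\<one>, g) \<in> (cayley_step G S \<phi> 0)\<^sup>*"
    using conn g character_one[OF is_group \<phi>] unfolding half_connected_iff_rtrancl[OF is_group \<phi> S(1)] by simp
  then have "D g z = D \<one> z"
  proof (induction rule: rtrancl_induct)
    case (step x y)
    then obtain s where s: "s \<in> S" "y = x \<otimes> s \<or> x = y \<otimes> s" "x \<in> carrier G" "y \<in> carrier G"
      "0 \<le> \<phi> x" "0 \<le> \<phi> y" by (auto simp: cayley_step_def)
    have "D s (z - \<phi> x) = 0" "D s (z - \<phi> y) = 0" using b[OF s(1)] s g(3) by auto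
    then show ?case using s S(1) D[of x s z] D[of y s z] step.IH by auto
  qed simp
  moreover have "D \<one> z = 0" using D[of \<one> \<one> z] character_one[OF is_group \<phi>] by simp
  ultimately show False using g(4) by simp
qed

end

section \<open>The resonance variety in terms of characters\<close>

lemma tuples_simps:
  "xs \<in> tuples G 0 \<longleftrightarrow> xs = []"
  "xs \<in> tuples G 1 \<longleftrightarrow> (\<exists>g\<in>carrier G. xs = [g])"
  "xs \<in> tuples G (Suc 0) \<longleftrightarrow> (\<exists>g\<in>carrier G. xs = [g])"
  "xs \<in> tuples G (Suc 1) \<longleftrightarrow> (\<exists>g\<in>carrier G. \<exists>h\<in>carrier G. xs = [g, h])"
  "xs \<in> tuples G (Suc (Suc 0)) \<longleftrightarrow> (\<exists>g\<in>carrier G. \<exists>h\<in>carrier G. xs = [g, h])"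
  by (auto simp: tuples_def length_Suc_conv)

lemma cochains_simps:
  "carrier (cochains G n) = extensional (tuples G n)"
  "f \<otimes>\<^bsub>cochains G n\<^esub> h = (\<lambda>xs\<in>tuples G n. f xs + h xs)"
  "\<one>\<^bsub>cochains G n\<^esub> = (\<lambda>xs\<in>tuples G n. 0)"
  by (simp_all add: cochains_def)

lemma group_cochains: "group (cochains G n)"
proof (rule groupI)
  fix f
  assume "f \<in> carrier (cochains G n)"
  then show "\<exists>h\<in>carrier (cochains G n). h \<otimes>\<^bsub>cochains G n\<^esub> f = \<one>\<^bsub>cochains G n\<^esub>"
    by (intro bexI[of _ "\<lambda>xs\<in>tuples G n. - f xs"]) (auto simp: cochains_simps fun_eq_iff restrict_def extensional_def)
next
  fix f
  assume "f \<in> carrier (cochains G n)"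
  then show "\<one>\<^bsub>cochains G n\<^esub> \<otimes>\<^bsub>cochains G n\<^esub> f = f"
    by (auto simp: cochains_simps fun_eq_iff restrict_def extensional_def)
qed (auto simp: cochains_simps fun_eq_iff restrict_def extensional_def)

lemma char_cochain:
  assumes "group G" "\<phi> \<in> characters G"
  shows "(\<lambda>xs\<in>tuples G 1. \<phi> (hd xs)) \<in> cocycles G 1"
  unfolding cocycles_def kernel_def
proof (intro CollectI conjI)
  show "(\<lambda>xs\<in>tuples G 1. \<phi> (hd xs)) \<in> carrier (cochains G 1)" by (simp add: cochains_simps)
  show "coboundary G 1 (\<lambda>xs\<in>tuples G 1. \<phi> (hd xs)) = \<one>\<^bsub>cochains G (Suc 1)\<^esub>"
  proof
    fix xs
    interpret group G by (rule assms(1))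
    show "coboundary G 1 (\<lambda>xs\<in>tuples G 1. \<phi> (hd xs)) xs = \<one>\<^bsub>cochains G (Suc 1)\<^esub> xs"
    proof (cases "xs \<in> tuples G (Suc 1)")
      case True
      then obtain g h where "g \<in> carrier G" "h \<in> carrier G" "xs = [g, h]" unfolding tuples_simps by blast
      then show ?thesis using True
        by (simp only: coboundary_1) (simp add: tuples_simps cochains_simps character_mult[OF assms])
    next
      case False
      then show ?thesis by (simp add: coboundary_def cochains_simps)
    qed
  qed
qed

lemma cocycle_char:
  assumes "f \<in> cocycles G 1" "group G"
  obtains \<beta> where "\<beta> \<in> characters G" "f = (\<lambda>xs\<in>tuples G 1. \<beta> (hd xs))"
proof -
  interpret group G by (rule assms(2))
  define \<beta> where "\<beta> = (\<lambda>g\<in>carrier G. f [g])"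
  have f: "f \<in> extensional (tuples G 1)" "coboundary G 1 f = (\<lambda>xs\<in>tuples G (Suc 1). 0)"
    using assms(1) unfolding cocycles_def kernel_def by (auto simp: cochains_simps)
  have "f [g \<otimes>\<^bsub>G\<^esub> h] = f [g] + f [h]" if "g \<in> carrier G" "h \<in> carrier G" for g h
    using coboundary_1[OF that, of f] that unfolding f(2) by (simp add: tuples_def)
  then have "\<beta> \<in> characters G" by (intro characterI) (auto simp: \<beta>_def)
  moreover have "f = (\<lambda>xs\<in>tuples G 1. \<beta> (hd xs))"
    using f(1) by (auto simp: fun_eq_iff tuples_simps \<beta>_def extensional_def)
  ultimately show thesis using that by blast
qed

text \<open>With trivial coefficients a degree-1 class is therefore a single cocycle, that is, a
  character; cosets in degrees 0 and 1 are singletons.\<close>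

lemma coboundary_0_trivial: "coboundary G 0 f = \<one>\<^bsub>cochains G (Suc 0)\<^esub>"
proof
  fix xs
  show "coboundary G 0 f xs = \<one>\<^bsub>cochains G (Suc 0)\<^esub> xs"
  proof (cases "xs \<in> tuples G (Suc 0)")
    case True
    then obtain g where "g \<in> carrier G" "xs = [g]" unfolding tuples_simps by blast
    then show ?thesis using True coboundary_0[of g G f] by (simp add: cochains_simps)
  next
    case False
    then show ?thesis by (simp add: coboundary_def cochains_simps)
  qed
qed

lemma coboundaries_0: "coboundaries G 0 = {\<one>\<^bsub>cochains G 0\<^esub>}"
  by (simp add: coboundaries_def)

lemma coboundaries_1: "coboundaries G (Suc 0) = {\<one>\<^bsub>cochains G (Suc 0)\<^esub>}"
proof -
  have "\<one>\<^bsub>cochains G 0\<^esub> \<in> carrier (cochains G 0)" by (simp add: cochains_simps)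
  then show ?thesis by (auto simp: coboundaries_def coboundary_0_trivial)
qed

lemma trivial_coset:
  assumes "f \<in> carrier (cochains G n)"
  shows "{\<one>\<^bsub>cochains G n\<^esub>} #>\<^bsub>cochains G n\<^esub> f = {f}"
  using group.is_monoid[OF group_cochains[of G n]] assms by (simp add: r_coset_def monoid.l_one)

lemma cohomology_0: "carrier (cohomology G 0) = (\<lambda>f. {f}) ` extensional (tuples G 0)"
proof -
  have "cocycles G 0 = extensional (tuples G 0)"
    by (auto simp: cocycles_def kernel_def cochains_simps(1) coboundary_0_trivial)
  then show ?thesis
    using trivial_coset[of _ G 0]
    by (auto simp: cohomology_def FactGroup_def RCOSETS_def coboundaries_0 r_coset_def cochains_simps(1))
qed

lemma cohomology_1: "carrier (cohomology G 1) = (\<lambda>f. {f}) ` cocycles G 1"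
proof -
  have "carrier (cohomology G 1) = (\<lambda>f. coboundaries G 1 #>\<^bsub>cochains G 1\<^esub> f) ` cocycles G 1"
    by (auto simp: cohomology_def FactGroup_def RCOSETS_def r_coset_def)
  also have "\<dots> = (\<lambda>f. {f}) ` cocycles G 1"
  proof (rule image_cong)
    fix f
    assume "f \<in> cocycles G 1"
    then have "f \<in> carrier (cochains G 1)" by (simp add: cocycles_def kernel_def)
    then show "coboundaries G 1 #>\<^bsub>cochains G 1\<^esub> f = {f}"
      using trivial_coset[of f G 1] by (simp add: coboundaries_1)
  qed simp
  finally show ?thesis .
qed

lemma subgroup_coboundaries_2:
  assumes "group G"
  shows "subgroup (coboundaries G 2) (cochains G 2)"
proof -
  interpret group G by (rule assms)
  have "group_hom (cochains G 1) (cochains G 2) (coboundary G 1)"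
  proof (intro group_hom.intro group_hom_axioms.intro group_cochains homI)
    fix f h
    show "coboundary G 1 f \<in> carrier (cochains G 2)"
      by (simp add: cochains_simps coboundary_def numeral_2_eq_2)
    show "coboundary G 1 (f \<otimes>\<^bsub>cochains G 1\<^esub> h) = coboundary G 1 f \<otimes>\<^bsub>cochains G 2\<^esub> coboundary G 1 h"
    proof
      fix xs
      show "coboundary G 1 (f \<otimes>\<^bsub>cochains G 1\<^esub> h) xs
          = (coboundary G 1 f \<otimes>\<^bsub>cochains G 2\<^esub> coboundary G 1 h) xs"
      proof (cases "xs \<in> tuples G (Suc 1)")
        case True
        then obtain g k where "g \<in> carrier G" "k \<in> carrier G" "xs = [g, k]" unfolding tuples_simps by blast
        then show ?thesis using True coboundary_1[of g G k]
          by (simp add: cochains_simps numeral_2_eq_2 tuples_def)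
      next
        case False
        then show ?thesis by (simp add: coboundary_def cochains_simps numeral_2_eq_2)
      qed
    qed
  qed
  then have "subgroup (coboundary G 1 ` carrier (cochains G 1)) (cochains G 2)"
    by (rule group_hom.img_is_subgroup)
  then show ?thesis by (simp add: coboundaries_def numeral_2_eq_2)
qed

lemma cup_singleton: "cup G p q {f} {h} = coboundaries G (p + q) #>\<^bsub>cochains G (p + q)\<^esub> cup_cochain G p q f h"
  by (simp add: cup_def)

lemma cup_1_1_trivial_iff:
  assumes "group G"
  shows "cup G 1 1 {f} {h} = \<one>\<^bsub>cohomology G (Suc 1)\<^esub> \<longleftrightarrow> cup_cochain G 1 1 f h \<in> coboundaries G 2"
proof -
  interpret C: group "cochains G 2" by (rule group_cochains)
  have sub: "subgroup (coboundaries G 2) (cochains G 2)" by (rule subgroup_coboundaries_2[OF assms])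
  have c: "cup_cochain G 1 1 f h \<in> carrier (cochains G 2)"
    by (simp add: cup_cochain_def cochains_simps numeral_2_eq_2)
  have "\<one>\<^bsub>cohomology G (Suc 1)\<^esub> = coboundaries G 2"
    by (simp add: cohomology_def FactGroup_def numeral_2_eq_2)
  then show ?thesis
    unfolding cup_singleton
    using C.coset_join1[OF _ c sub] C.coset_join2[OF c sub] subgroup.subset[OF sub]
    by (auto simp: numeral_2_eq_2)
qed

text \<open>The negative of F measures exactly what the third coordinate of a lift of the pair
  (\<beta>, \<phi>) to the Heisenberg group has to satisfy.\<close>

lemma cup_cochain_coboundary_iff:
  assumes "group G"
  shows "cup_cochain G 1 1 (\<lambda>xs\<in>tuples G 1. \<beta> (hd xs)) (\<lambda>xs\<in>tuples G 1. \<phi> (hd xs)) \<in> coboundaries G 2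
    \<longleftrightarrow> (\<exists>F. \<forall>g\<in>carrier G. \<forall>h\<in>carrier G. \<beta> g * \<phi> h = F h - F (g \<otimes>\<^bsub>G\<^esub> h) + F g)"
    (is "?c \<in> _ \<longleftrightarrow> ?R")
proof -
  interpret group G by (rule assms)
  have val: "?c [g, h] = \<beta> g * \<phi> h" if "g \<in> carrier G" "h \<in> carrier G" for g h
    using that by (simp add: cup_cochain_def tuples_def)
  have eq: "?c = coboundary G 1 f \<longleftrightarrow> (\<forall>g\<in>carrier G. \<forall>h\<in>carrier G. \<beta> g * \<phi> h = f [h] - f [g \<otimes>\<^bsub>G\<^esub> h] + f [g])" for f
  proof
    assume "?c = coboundary G 1 f"
    then show "\<forall>g\<in>carrier G. \<forall>h\<in>carrier G. \<beta> g * \<phi> h = f [h] - f [g \<otimes>\<^bsub>G\<^esub> h] + f [g]"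
      using val coboundary_1[of _ G _ f] by metis
  next
    assume R: "\<forall>g\<in>carrier G. \<forall>h\<in>carrier G. \<beta> g * \<phi> h = f [h] - f [g \<otimes>\<^bsub>G\<^esub> h] + f [g]"
    show "?c = coboundary G 1 f"
    proof
      fix xs
      show "?c xs = coboundary G 1 f xs"
      proof (cases "xs \<in> tuples G (Suc 1)")
        case True
        then obtain g k where "g \<in> carrier G" "k \<in> carrier G" "xs = [g, k]" unfolding tuples_simps by blast
        then show ?thesis using R val coboundary_1[of g G k f] by simp
      next
        case False
        then show ?thesis by (simp add: coboundary_def cup_cochain_def)
      qed
    qed
  qed
  show ?thesis
  proof
    assume "?c \<in> coboundaries G 2"
    then obtain f where "?c = coboundary G 1 f" by (auto simp: coboundaries_def numeral_2_eq_2)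
    then show ?R unfolding eq by (intro exI[of _ "\<lambda>g. f [g]"])
  next
    assume ?R
    then obtain F where F: "\<forall>g\<in>carrier G. \<forall>h\<in>carrier G. \<beta> g * \<phi> h = F h - F (g \<otimes>\<^bsub>G\<^esub> h) + F g" by blast
    define f where "f = (\<lambda>xs\<in>tuples G 1. F (hd xs))"
    have "?c = coboundary G 1 f" unfolding eq using F by (auto simp: f_def tuples_def)
    moreover have "f \<in> carrier (cochains G 1)" by (simp add: f_def cochains_simps)
    ultimately show "?c \<in> coboundaries G 2" by (auto simp: coboundaries_def numeral_2_eq_2)
  qed
qed

text \<open>Degree 0 of the algebra is the real line, so its image under multiplication by \<phi> is
  the line spanned by \<phi>. A nontrivial class is thus a second character, not a multiple of
  \<phi>, whose cup product with \<phi> is a coboundary.\<close>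

lemma resonance_variety_iff:
  assumes G: "group G" and \<phi>: "\<phi> \<in> characters G"
  shows "\<phi> \<in> resonance_variety G \<longleftrightarrow>
    (\<exists>\<beta>\<in>characters G. (\<forall>c. \<exists>g\<in>carrier G. \<beta> g \<noteq> c * \<phi> g) \<and>
      (\<exists>F. \<forall>g\<in>carrier G. \<forall>h\<in>carrier G. \<beta> g * \<phi> h = F h - F (g \<otimes>\<^bsub>G\<^esub> h) + F g))"
proof -
  interpret group G by (rule G)
  let ?cc = "\<lambda>\<beta>. (\<lambda>xs\<in>tuples G 1. \<beta> (hd xs))"
  let ?L = "\<lambda>\<beta>. \<exists>F. \<forall>g\<in>carrier G. \<forall>h\<in>carrier G. \<beta> g * \<phi> h = F h - F (g \<otimes>\<^bsub>G\<^esub> h) + F g"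
  define a where "a = char_cohomology_class G \<phi>"
  have a: "a = {?cc \<phi>}"
    unfolding a_def char_cohomology_class_def One_nat_def coboundaries_1
    using trivial_coset[of "?cc \<phi>" G "Suc 0"] by (simp add: cochains_simps)
  have inj: "?cc \<beta> = ?cc \<gamma> \<longleftrightarrow> (\<forall>g\<in>carrier G. \<beta> g = \<gamma> g)" for \<beta> \<gamma> :: "'a \<Rightarrow> real"
    by (auto simp: fun_eq_iff restrict_def tuples_simps)
  have Z: "mult_cocycles G a 1 = {{?cc \<beta>} | \<beta>. \<beta> \<in> characters G \<and> ?L \<beta>}" (is "_ = ?Z")
  proof -
    have "{f} \<in> mult_cocycles G a 1 \<longleftrightarrow> f \<in> cocycles G 1 \<and> cup_cochain G 1 1 f (?cc \<phi>) \<in> coboundaries G 2" for f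
      unfolding mult_cocycles_def kernel_def cohomology_1 a using cup_1_1_trivial_iff[OF G] by auto
    moreover have "mult_cocycles G a 1 \<subseteq> (\<lambda>f. {f}) ` cocycles G 1"
      unfolding mult_cocycles_def kernel_def cohomology_1 by auto
    ultimately have "mult_cocycles G a 1
        = {{f} | f. f \<in> cocycles G 1 \<and> cup_cochain G 1 1 f (?cc \<phi>) \<in> coboundaries G 2}" by blast
    also have "\<dots> = ?Z"
    proof (intro equalityI subsetI)
      fix X
      assume "X \<in> {{f} | f. f \<in> cocycles G 1 \<and> cup_cochain G 1 1 f (?cc \<phi>) \<in> coboundaries G 2}"
      then obtain f where f: "X = {f}" "f \<in> cocycles G 1" "cup_cochain G 1 1 f (?cc \<phi>) \<in> coboundaries G 2"
        by blast
      obtain \<beta> where "\<beta> \<in> characters G" "f = ?cc \<beta>" using cocycle_char[OF f(2) G] by blast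
      then show "X \<in> ?Z" using f cup_cochain_coboundary_iff[OF G] by blast
    next
      fix X
      assume "X \<in> ?Z"
      then show "X \<in> {{f} | f. f \<in> cocycles G 1 \<and> cup_cochain G 1 1 f (?cc \<phi>) \<in> coboundaries G 2}"
        using char_cochain[OF G] cup_cochain_coboundary_iff[OF G] by blast
    qed
    finally show ?thesis .
  qed
  have B: "mult_coboundaries G a 1 = {{?cc (\<lambda>g. c * \<phi> g)} | c. True}"
  proof -
    have cup0: "cup G 0 1 {f} a = {?cc (\<lambda>g. f [] * \<phi> g)}" for f
    proof -
      have "cup_cochain G 0 1 f (?cc \<phi>) = ?cc (\<lambda>g. f [] * \<phi> g)"
        by (auto simp: cup_cochain_def fun_eq_iff tuples_simps)
      then show ?thesis
        unfolding a cup_singleton using trivial_coset[of "?cc (\<lambda>g. f [] * \<phi> g)" G "Suc 0"]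
        by (simp add: coboundaries_1 cochains_simps)
    qed
    have "mult_coboundaries G a 1 = (\<lambda>f. {?cc (\<lambda>g. f [] * \<phi> g)}) ` extensional (tuples G 0)"
      unfolding mult_coboundaries_def by (simp add: cohomology_0 image_image cup0[simplified])
    also have "\<dots> = {{?cc (\<lambda>g. c * \<phi> g)} | c. True}"
    proof (intro equalityI subsetI)
      fix X
      assume "X \<in> {{?cc (\<lambda>g. c * \<phi> g)} | c. True}"
      then obtain c where "X = {?cc (\<lambda>g. c * \<phi> g)}" by blast
      then show "X \<in> (\<lambda>f. {?cc (\<lambda>g. f [] * \<phi> g)}) ` extensional (tuples G 0)"
        by (intro image_eqI[of _ _ "\<lambda>xs\<in>tuples G 0. c"]) (auto simp: tuples_simps)
    qed blast
    finally show ?thesis .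
  qed
  have mult: "{?cc \<beta>} \<otimes>\<^bsub>cohomology G 1\<^esub> {?cc \<gamma>} = {?cc (\<lambda>g. \<beta> g + \<gamma> g)}" for \<beta> \<gamma> :: "'a \<Rightarrow> real"
    by (auto simp: cohomology_def FactGroup_def set_mult_def cochains_simps fun_eq_iff restrict_def tuples_simps)
  have coset: "mult_coboundaries G a 1 #>\<^bsub>(cohomology G 1)\<lparr>carrier := mult_cocycles G a 1\<rparr>\<^esub> {?cc \<beta>}
      = {{?cc (\<lambda>g. c * \<phi> g + \<beta> g)} | c. True}" for \<beta>
  proof -
    have "{?cc (\<lambda>g. c * \<phi> g)} \<otimes>\<^bsub>cohomology G 1\<^esub> {?cc \<beta>} = {?cc (\<lambda>g. c * \<phi> g + \<beta> g)}" for c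
      by (rule mult)
    then show ?thesis
      unfolding r_coset_def B by (simp add: full_SetCompr_eq UNION_singleton_eq_range image_image)
  qed
  have carrier: "carrier (mult_cohomology G a 1)
      = {{{?cc (\<lambda>g. c * \<phi> g + \<beta> g)} | c. True} | \<beta>. \<beta> \<in> characters G \<and> ?L \<beta>}"
    unfolding mult_cohomology_def FactGroup_def RCOSETS_def using coset Z by auto
  have one: "\<one>\<^bsub>mult_cohomology G a 1\<^esub> = {{?cc (\<lambda>g. c * \<phi> g)} | c. True}"
    unfolding mult_cohomology_def FactGroup_def B by simp
  have trivial: "{{?cc (\<lambda>g. c * \<phi> g + \<beta> g)} | c. True} = \<one>\<^bsub>mult_cohomology G a 1\<^esub>
      \<longleftrightarrow> (\<exists>c. \<forall>g\<in>carrier G. \<beta> g = c * \<phi> g)" (is "?K = _ \<longleftrightarrow> ?M") for \<beta>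
  proof
    assume "?K = \<one>\<^bsub>mult_cohomology G a 1\<^esub>"
    moreover have "{?cc (\<lambda>g. 0 * \<phi> g + \<beta> g)} \<in> ?K" by blast
    ultimately obtain c where "?cc (\<lambda>g. 0 * \<phi> g + \<beta> g) = ?cc (\<lambda>g. c * \<phi> g)" unfolding one by blast
    then have "\<forall>g\<in>carrier G. 0 * \<phi> g + \<beta> g = c * \<phi> g" by (rule iffD1[OF inj])
    then show ?M by auto
  next
    assume ?M
    then obtain d where d: "\<forall>g\<in>carrier G. \<beta> g = d * \<phi> g" ..
    have "?cc (\<lambda>g. c * \<phi> g + \<beta> g) = ?cc (\<lambda>g. (c + d) * \<phi> g)" for c
    proof -
      have "\<forall>g\<in>carrier G. c * \<phi> g + \<beta> g = (c + d) * \<phi> g" using d by (simp add: algebra_simps)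
      then show ?thesis by (rule iffD2[OF inj[of "\<lambda>g. c * \<phi> g + \<beta> g" "\<lambda>g. (c + d) * \<phi> g"]])
    qed
    then have K: "?K = {{?cc (\<lambda>g. (c + d) * \<phi> g)} | c. True}" by simp
    show "?K = \<one>\<^bsub>mult_cohomology G a 1\<^esub>"
      unfolding K one
    proof (intro equalityI subsetI)
      fix X
      assume "X \<in> {{?cc (\<lambda>g. c * \<phi> g)} | c. True}"
      then obtain c where "X = {?cc (\<lambda>g. c * \<phi> g)}" by blast
      then have "X = {?cc (\<lambda>g. (c - d + d) * \<phi> g)}" by simp
      then show "X \<in> {{?cc (\<lambda>g. (c + d) * \<phi> g)} | c. True}" by blast
    qed blast
  qed
  \<comment> \<open>The resonance condition is stated as \<open>\<noteq> {\<one>}\<close>, which an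
    empty carrier would also satisfy. The zero character shows that the trivial coset is in the
    carrier, so the condition yields a nontrivial coset.\<close>
  have zero: "(\<lambda>g\<in>carrier G. 0) \<in> characters G" "?L (\<lambda>g\<in>carrier G. 0)"
    by (intro characterI) (auto intro!: exI[of _ "\<lambda>_. 0"])
  define K where "K \<beta> = {{?cc (\<lambda>g. c * \<phi> g + \<beta> g)} | c. True}" for \<beta>
  have carrier_K: "carrier (mult_cohomology G a 1) = {K \<beta> | \<beta>. \<beta> \<in> characters G \<and> ?L \<beta>}"
    unfolding K_def by (rule carrier)
  have K: "K \<beta> = \<one>\<^bsub>mult_cohomology G a 1\<^esub> \<longleftrightarrow> (\<exists>c. \<forall>g\<in>carrier G. \<beta> g = c * \<phi> g)" for \<beta>
    unfolding K_def by (rule trivial)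
  have "K (\<lambda>g\<in>carrier G. 0) = \<one>\<^bsub>mult_cohomology G a 1\<^esub>"
    unfolding K by (intro exI[of _ 0]) simp
  moreover have "K (\<lambda>g\<in>carrier G. 0) \<in> carrier (mult_cohomology G a 1)"
    unfolding carrier_K mem_Collect_eq
    by (rule exI[of _ "\<lambda>g\<in>carrier G. 0"]) (intro conjI refl zero)
  ultimately have ne: "\<one>\<^bsub>mult_cohomology G a 1\<^esub> \<in> carrier (mult_cohomology G a 1)" by simp
  have nontrivial: "S \<noteq> {n} \<longleftrightarrow> (\<exists>X\<in>S. X \<noteq> n)" if "n \<in> S" for S n
    using that by blast
  have unfold_K: "(\<exists>X\<in>{K \<beta> | \<beta>. P \<beta>}. X \<noteq> n) \<longleftrightarrow> (\<exists>\<beta>. P \<beta> \<and> K \<beta> \<noteq> n)" for P n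
    by blast
  have "\<phi> \<in> resonance_variety G \<longleftrightarrow> carrier (mult_cohomology G a 1) \<noteq> {\<one>\<^bsub>mult_cohomology G a 1\<^esub>}"
    unfolding resonance_variety_def a_def[symmetric] mem_Collect_eq using \<phi> by simp
  also have "\<dots> \<longleftrightarrow> (\<exists>\<beta>. (\<beta> \<in> characters G \<and> ?L \<beta>) \<and> K \<beta> \<noteq> \<one>\<^bsub>mult_cohomology G a 1\<^esub>)"
    unfolding nontrivial[OF ne] unfolding carrier_K by (rule unfold_K)
  also have "\<dots> \<longleftrightarrow> (\<exists>\<beta>. (\<beta> \<in> characters G \<and> ?L \<beta>) \<and> (\<forall>c. \<exists>g\<in>carrier G. \<beta> g \<noteq> c * \<phi> g))"
    unfolding K by (simp only: not_ex Ball_def Bex_def not_all not_imp)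
  also have "\<dots> \<longleftrightarrow> (\<exists>\<beta>\<in>characters G. (\<forall>c. \<exists>g\<in>carrier G. \<beta> g \<noteq> c * \<phi> g) \<and> ?L \<beta>)"
    unfolding Bex_def[of "characters G"] by (intro arg_cong[of _ _ Ex] ext) (intro iffI; elim conjE; intro conjI; assumption)
  finally show ?thesis .
qed

section \<open>Characters of Bestvina--Brady groups\<close>

text \<open>All real translations act, since the values of a character need not be discrete.
  Vanishing near minus infinity is built into the carrier, so every group element has such a bound
  and any finite generating set has a common one.\<close>

definition shift_group :: "((real \<Rightarrow> real) \<times> real) monoid" where
  "shift_group = \<lparr>carrier = {(a, r). \<exists>b. \<forall>z<b. a z = 0},
     monoid.mult = (\<lambda>(a, r) (b, s). (\<lambda>z. a z + b (z - r), r + s)), one = (\<lambda>_. 0, 0)\<rparr>"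

lemma shift_group_simps:
  "(a, r) \<in> carrier shift_group \<longleftrightarrow> (\<exists>b. \<forall>z<b. a z = 0)"
  "(a, r) \<otimes>\<^bsub>shift_group\<^esub> (b, s) = (\<lambda>z. a z + b (z - r), r + s)"
  "\<one>\<^bsub>shift_group\<^esub> = (\<lambda>_. 0, 0)"
  by (simp_all add: shift_group_def)

lemma group_shift_group: "group shift_group"
proof (rule groupI)
  fix p q
  assume "p \<in> carrier shift_group" "q \<in> carrier shift_group"
  moreover obtain a r b s where pq: "p = (a, r)" "q = (b, s)" by (cases p, cases q)
  ultimately obtain c d where "\<forall>z<c. a z = 0" "\<forall>z<d. b z = 0" by (auto simp: shift_group_simps)
  then have "\<forall>z<min c (d + r). a z + b (z - r) = 0" by auto
  then show "p \<otimes>\<^bsub>shift_group\<^esub> q \<in> carrier shift_group" unfolding pq shift_group_simps by blast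
next
  fix p
  assume "p \<in> carrier shift_group"
  moreover obtain a r where p: "p = (a, r)" by (cases p)
  ultimately obtain c where "\<forall>z<c. a z = 0" by (auto simp: shift_group_simps)
  then have "\<forall>z<c - r. - a (z + r) = 0" by auto
  then have "(\<lambda>z. - a (z + r), - r) \<in> carrier shift_group" unfolding shift_group_simps by blast
  then show "\<exists>q\<in>carrier shift_group. q \<otimes>\<^bsub>shift_group\<^esub> p = \<one>\<^bsub>shift_group\<^esub>"
    by (rule bexI[rotated]) (simp add: p shift_group_simps)
qed (auto simp: shift_group_simps algebra_simps)

text \<open>The triple (y, x, z) is the unitriangular matrix with y and x above the diagonal and z
  in the corner. Two elements commute exactly when their pairs (y, x) are linearly
  dependent.\<close>

definition heisenberg_group :: "(real \<times> real \<times> real) monoid" where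
  "heisenberg_group = \<lparr>carrier = UNIV,
     monoid.mult = (\<lambda>(y, x, z) (y', x', z'). (y + y', x + x', z + z' + y * x')), one = (0, 0, 0)\<rparr>"

lemma heisenberg_group_simps:
  "g \<in> carrier heisenberg_group"
  "(y, x, z) \<otimes>\<^bsub>heisenberg_group\<^esub> (y', x', z') = (y + y', x + x', z + z' + y * x')"
  "\<one>\<^bsub>heisenberg_group\<^esub> = (0, 0, 0)"
  by (simp_all add: heisenberg_group_def)

lemma group_heisenberg_group: "group heisenberg_group"
proof (rule groupI)
  fix g :: "real \<times> real \<times> real"
  obtain y x z where g: "g = (y, x, z)" by (cases g)
  show "\<exists>h\<in>carrier heisenberg_group. h \<otimes>\<^bsub>heisenberg_group\<^esub> g = \<one>\<^bsub>heisenberg_group\<^esub>"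
    by (rule bexI[of _ "(- y, - x, - z + y * x)"]) (simp_all add: g heisenberg_group_simps)
qed (auto simp: heisenberg_group_simps algebra_simps)

text \<open>
  If the vertices with \<open>x \<noteq> t\<close> are disconnected, then \<open>D\<close> is a union of components and \<open>y\<close>
  is \<open>x - t\<close> on \<open>D\<close>; if all neighbours of \<open>u\<close> have the same value \<open>t\<close> as \<open>u\<close>, then \<open>y\<close> is the indicator of
  \<open>u\<close>. The functions \<open>\<eta> p\<close> are the corresponding combinations of point masses.
\<close>

lemma (in acyclic_graph) degenerate_data:
  fixes x :: "'v \<Rightarrow> real"
  assumes irrefl: "\<And>u. (u, u) \<notin> E" and x: "\<not> robustly_connected V E x"
    and nonconst: "u0 \<in> V" "v0 \<in> V" "x u0 \<noteq> x v0"
  obtains t y \<eta> v w where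
    "\<And>p. \<exists>b. \<forall>z<b. \<eta> p z = (0::real)"
    "\<And>p q z. (p, q) \<in> E \<Longrightarrow> \<eta> p z + \<eta> q (z - (x p - t)) = \<eta> q z + \<eta> p (z - (x q - t))"
    "v \<in> V" "w \<in> V" "\<And>z. \<eta> w z = 0" "x w \<noteq> t" "\<eta> v 0 \<noteq> 0"
    "\<And>p q. (p, q) \<in> E \<Longrightarrow> y p * (x q - t) = y q * (x p - t)"
    "\<And>c d. \<exists>p\<in>V. y p \<noteq> c * x p + d"
proof -
  let ?R = "\<lambda>t. {(a, b) \<in> E. x a \<noteq> t \<and> x b \<noteq> t}"
  define \<delta> :: "real \<Rightarrow> real \<Rightarrow> real" where "\<delta> a z = (if z = a then 1 else 0)" for a z
  have \<delta>: "\<forall>z<a. \<delta> a z = 0" "\<delta> a (z - r) = \<delta> (a + r) z" for a r z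
    by (auto simp: \<delta>_def)
  consider (disconnected) t u v where "u \<in> V" "v \<in> V" "x u \<noteq> t" "x v \<noteq> t" "(u, v) \<notin> (?R t)\<^sup>*"
    | (dead) u where "u \<in> V" "\<And>v. (u, v) \<in> E \<Longrightarrow> x v = x u"
    using x unfolding robustly_connected_def by blast
  then show thesis
  proof cases
    case disconnected
    define D where "D p \<longleftrightarrow> x p \<noteq> t \<and> (u, p) \<notin> (?R t)\<^sup>*" for p
    have split: "D p \<longleftrightarrow> D q" if "(p, q) \<in> E" "x p \<noteq> t" "x q \<noteq> t" for p q
    proof -
      have "(p, q) \<in> ?R t" "(q, p) \<in> ?R t" using that edge_sym by auto
      then have "(u, p) \<in> (?R t)\<^sup>* \<longleftrightarrow> (u, q) \<in> (?R t)\<^sup>*" by (meson rtrancl.rtrancl_into_rtrancl)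
      then show ?thesis using that by (simp add: D_def)
    qed
    have D: "D v" "\<not> D u" using disconnected by (auto simp: D_def)
    \<comment> \<open>On D the pair (\<open>\<eta> p\<close>, x p - t) is the translation by x p - t
      conjugated by the function - \<delta> 0; elsewhere it is the translation itself. Vertices at
      level t go to the identity, and no edge joins D to the other vertices off this level, so
      adjacent vertices have commuting images.\<close>
    define \<eta> where "\<eta> p z = (if D p then \<delta> (x p - t) z - \<delta> 0 z else 0)" for p z
    \<comment> \<open>The pair (y p, x p - t) is a multiple of (1, 1) on D and of (0, 1) elsewhere,
      and zero at level t.\<close>
    define y where "y p = (if D p then x p - t else 0)" for p
    show thesis
    proof (rule that[of \<eta> t v u y])
      fix p
      have "\<forall>z<min (x p - t) 0. \<eta> p z = 0" using \<delta>(1)[of "x p - t"] \<delta>(1)[of 0] by (auto simp: \<eta>_def)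
      then show "\<exists>b. \<forall>z<b. \<eta> p z = 0" by blast
    next
      fix p q z
      assume pq: "(p, q) \<in> E"
      show "\<eta> p z + \<eta> q (z - (x p - t)) = \<eta> q z + \<eta> p (z - (x q - t))"
      proof (cases "x p = t \<or> x q = t")
        case True
        then show ?thesis by (auto simp: \<eta>_def D_def \<delta>(2))
      next
        case False
        then show ?thesis using split[OF pq] by (auto simp: \<eta>_def \<delta>(2) add.commute)
      qed
      show "y p * (x q - t) = y q * (x p - t)"
      proof (cases "x p = t \<or> x q = t")
        case True
        then show ?thesis by (auto simp: y_def D_def)
      next
        case False
        then show ?thesis using split[OF pq] by (auto simp: y_def)
      qed
    next
      fix c d
      \<comment> \<open>If level t were empty, the vertices off it would form the whole graph, which
        is connected. The vertices r, u and v then rule out an affine relation: y is 0 at r and u,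
        where x differs, but not at v.\<close>
      obtain r where r: "r \<in> V" "x r = t"
      proof (rule ccontr)
        assume "\<not> thesis"
        then have "x r \<noteq> t" if "r \<in> V" for r using that \<open>\<And>r. r \<in> V \<Longrightarrow> x r = t \<Longrightarrow> thesis\<close> by blast
        then have "?R t = E" using edges by auto
        then show False using connected_edges[OF disconnected(1,2)] disconnected(5) by simp
      qed
      show "\<exists>p\<in>V. y p \<noteq> c * x p + d"
      proof (rule ccontr)
        assume "\<not> (\<exists>p\<in>V. y p \<noteq> c * x p + d)"
        then have lin: "y p = c * x p + d" if "p \<in> V" for p using that by blast
        have zero: "c * t + d = 0" using lin[OF r(1)] r by (simp add: y_def D_def)
        have "c * x u + d = 0" using lin[OF disconnected(1)] D by (simp add: y_def)
        then have "c * (x u - t) = 0" using zero by (simp only: right_diff_distrib)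
        then have "c = 0" using disconnected(3) by simp
        moreover have "c * x v + d = x v - t" using lin[OF disconnected(2)] D by (simp add: y_def)
        ultimately show False using zero disconnected(4) by simp
      qed
    qed (use disconnected D in \<open>auto simp: \<eta>_def \<delta>_def\<close>)
  next
    case dead
    obtain w where w: "w \<in> V" "x w \<noteq> x u" using nonconst by metis
    then have "w \<noteq> u" by auto
    then obtain n where n: "(u, n) \<in> E"
      using connected_edges[OF dead(1) w(1)] by (auto elim: converse_rtranclE)
    \<comment> \<open>With t = x u all neighbours of u go to the identity, so the image of u is
      unrestricted.\<close>
    define \<eta> where "\<eta> p z = (if p = u then \<delta> 0 z else 0)" for p z
    define y :: "'v \<Rightarrow> real" where "y p = (if p = u then 1 else 0)" for p
    have xu: "x q = x u" if "(u, q) \<in> E \<or> (q, u) \<in> E" for q using that dead(2) edge_sym by blast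
    show thesis
    proof (rule that[of \<eta> "x u" u w y])
      fix p
      show "\<exists>b. \<forall>z<b. \<eta> p z = 0" using \<delta>(1)[of 0] by (auto simp: \<eta>_def)
    next
      fix p q z
      assume pq: "(p, q) \<in> E"
      show "\<eta> p z + \<eta> q (z - (x p - x u)) = \<eta> q z + \<eta> p (z - (x q - x u))"
        using pq xu[of p] xu[of q] by (auto simp: \<eta>_def)
      show "y p * (x q - x u) = y q * (x p - x u)"
        using pq xu[of p] xu[of q] by (auto simp: y_def)
    next
      fix c d
      \<comment> \<open>u and its neighbour n have equal x but different y.\<close>
      have "n \<in> V" "n \<noteq> u" "x n = x u" using n edges irrefl dead(2) by auto
      then show "\<exists>p\<in>V. y p \<noteq> c * x p + d"
        using dead(1) unfolding y_def by (metis zero_neq_one)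
    qed (use dead w \<open>w \<noteq> u\<close> in \<open>auto simp: \<eta>_def \<delta>_def\<close>)
  qed
qed

lemma (in group) commute_inv_right:
  "x \<in> carrier G \<Longrightarrow> y \<in> carrier G \<Longrightarrow> x \<otimes> y = y \<otimes> x \<Longrightarrow> x \<otimes> inv y = inv y \<otimes> x"
  by (metis inv_solve_left inv_solve_right m_assoc inv_closed m_closed)

lemma (in group) commute_mult_right:
  "x \<in> carrier G \<Longrightarrow> y \<in> carrier G \<Longrightarrow> z \<in> carrier G \<Longrightarrow> x \<otimes> y = y \<otimes> x \<Longrightarrow> x \<otimes> z = z \<otimes> x \<Longrightarrow>
    x \<otimes> (y \<otimes> z) = (y \<otimes> z) \<otimes> x"
  by (metis m_assoc)

lemma (in group) commute_quotients:
  assumes "x \<in> carrier G" "y \<in> carrier G" "z \<in> carrier G"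
    and "x \<otimes> y = y \<otimes> x" "x \<otimes> z = z \<otimes> x" "y \<otimes> z = z \<otimes> y"
  shows "(x \<otimes> inv y) \<otimes> (x \<otimes> inv z) = (x \<otimes> inv z) \<otimes> (x \<otimes> inv y)"
proof (rule commute_mult_right)
  have "x \<otimes> (x \<otimes> inv y) = (x \<otimes> inv y) \<otimes> x"
    using assms commute_inv_right by (intro commute_mult_right) auto
  then show "x \<otimes> inv y \<otimes> x = x \<otimes> (x \<otimes> inv y)" by simp
  have "z \<otimes> (x \<otimes> inv y) = (x \<otimes> inv y) \<otimes> z"
    using assms commute_inv_right by (intro commute_mult_right) auto
  then have "(x \<otimes> inv y) \<otimes> z = z \<otimes> (x \<otimes> inv y)" by simp
  then show "x \<otimes> inv y \<otimes> inv z = inv z \<otimes> (x \<otimes> inv y)"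
    using assms by (intro commute_inv_right) auto
qed (use assms in auto)

section \<open>The two sides for a character with a given potential\<close>

locale bestvina_brady_graph = pair_graph \<Gamma> for \<Gamma> :: "'v pair_pre_digraph" +
  assumes connected_graph: "Digraph_Component.connected (with_proj \<Gamma>)"
    and simply_connected_flag: "simply_connected (geometric_realization (flag_complex \<Gamma>))"
begin

abbreviation "V \<equiv> pverts \<Gamma>"
abbreviation "E \<equiv> parcs \<Gamma>"
abbreviation "A \<equiv> raag \<Gamma>"
abbreviation "B \<equiv> bestvina_brady \<Gamma>"
abbreviation "a \<equiv> raag_gen \<Gamma>"
abbreviation "e u v \<equiv> a u \<otimes>\<^bsub>A\<^esub> inv\<^bsub>A\<^esub> a v"

sublocale A: group A by (rule group_raag)
sublocale B: group B by (rule group_bestvina_brady)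

lemma sym_arcs: "sym E"
  using pair_sym_arcs by (simp add: symmetric_def arcs_ends_conv)

sublocale acyclic_graph V E
proof
  show "E \<subseteq> V \<times> V" using in_arcsD1 in_arcsD2 by auto
  show "sym E" by (rule sym_arcs)
  show "(u, v) \<in> E\<^sup>*" if "u \<in> V" "v \<in> V" for u v
    using connected_rtrancl[OF pair_graph_axioms connected_graph that] .
  show "\<exists>x::'v \<Rightarrow> real. \<forall>(u, v)\<in>E. c u v = x v - x u"
    if "\<And>u v. (u, v) \<in> E \<Longrightarrow> c v u = - c u v"
      "\<And>u v w. (u, v) \<in> E \<Longrightarrow> (v, w) \<in> E \<Longrightarrow> (u, w) \<in> E \<Longrightarrow> c u v + c v w = c u w" for c
    by (rule simply_connected_potential[OF pair_graph_axioms connected_graph simply_connected_flag that])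
qed

lemma no_loop: "(u, u) \<notin> E"
  using pair_no_loops by fastforce

lemma verts_nonempty: "V \<noteq> {}"
  using connected_graph unfolding Digraph_Component.connected_def strongly_connected_def
  by (simp add: mk_symmetric_def)

lemma edge_verts: "(u, v) \<in> E \<Longrightarrow> u \<in> V" "(u, v) \<in> E \<Longrightarrow> v \<in> V"
  using in_arcsD1 in_arcsD2 by auto

lemmas a_closed = raag_gen_closed[of _ \<Gamma>]

lemma e_closed: "u \<in> V \<Longrightarrow> v \<in> V \<Longrightarrow> e u v \<in> carrier B"
  by (rule edge_element_closed)

lemma e_mult: "u \<in> V \<Longrightarrow> v \<in> V \<Longrightarrow> w \<in> V \<Longrightarrow> e u v \<otimes>\<^bsub>B\<^esub> e v w = e u w"
  by (simp add: bestvina_brady_simps a_closed A.m_assoc A.cancel_left)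

lemma e_commute:
  assumes "(u, v) \<in> E" "(u, w) \<in> E" "(v, w) \<in> E"
  shows "e u v \<otimes>\<^bsub>B\<^esub> e u w = e u w \<otimes>\<^bsub>B\<^esub> e u v"
  unfolding bestvina_brady_simps
  by (intro A.commute_quotients a_closed raag_gen_commute assms edge_verts[OF assms(1)] edge_verts[OF assms(2)])

lemma e_self: "u \<in> V \<Longrightarrow> e u u = \<one>\<^bsub>B\<^esub>"
  by (simp add: bestvina_brady_simps a_closed)

lemma edge_elements_closed: "L \<subseteq> E \<Longrightarrow> edge_elements \<Gamma> L \<subseteq> carrier B"
  unfolding edge_elements_def by (clarify, rule e_closed) (auto dest: edge_verts)

lemma finite_generating_edge_elements:
  assumes "L \<subseteq> E" "sym L" "\<And>u v. u \<in> V \<Longrightarrow> v \<in> V \<Longrightarrow> (u, v) \<in> L\<^sup>*"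
  shows "finite_generating_set B (edge_elements \<Gamma> L)"
  unfolding finite_generating_set_def
  using bestvina_brady_generate[OF pair_graph_axioms assms] edge_elements_closed[OF assms(1)]
    finite_subset[OF assms(1) pair_finite_arcs]
  by (simp add: edge_elements_def)

lemma generating_edges: "finite_generating_set B (edge_elements \<Gamma> E)"
  by (rule finite_generating_edge_elements) (auto intro: sym_arcs connected_edges)

lemma character_potential:
  assumes \<phi>: "\<phi> \<in> characters B"
  obtains x where "\<And>u v. (u, v) \<in> E \<Longrightarrow> \<phi> (e u v) = x u - x v"
proof -
  note mult = character_mult[OF B.is_group \<phi>]
  have tri: "\<phi> (e u w) = \<phi> (e u v) + \<phi> (e v w)" if "u \<in> V" "v \<in> V" "w \<in> V" for u v w
    using mult[OF e_closed[OF that(1,2)] e_closed[OF that(2,3)]] e_mult[OF that] by simp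
  have self: "\<phi> (e u u) = 0" if "u \<in> V" for u using tri[OF that that that] by simp
  \<comment> \<open>The arguments of e are swapped to match the sign convention of
    \<open>potential\<close>.\<close>
  have "\<exists>x. \<forall>(u, v)\<in>E. \<phi> (e v u) = x v - x u"
  proof (rule potential)
    show "\<phi> (e u v) = - \<phi> (e v u)" if "(u, v) \<in> E" for u v
      using tri[of u v u] self[of u] edge_verts[OF that] by simp
    show "\<phi> (e v u) + \<phi> (e w v) = \<phi> (e w u)" if "(u, v) \<in> E" "(v, w) \<in> E" "(u, w) \<in> E" for u v w
      using tri[of w v u] edge_verts[OF that(1)] edge_verts[OF that(2)] by simp
  qed
  then obtain x where "\<forall>(u, v)\<in>E. \<phi> (e v u) = x v - x u" ..
  then show thesis using that[of x] edge_sym by fast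
qed

lemma additive_e:
  fixes \<theta> :: "'v word set \<Rightarrow> real"
  assumes "\<And>g h. g \<in> carrier A \<Longrightarrow> h \<in> carrier A \<Longrightarrow> \<theta> (g \<otimes>\<^bsub>A\<^esub> h) = \<theta> g + \<theta> h" "u \<in> V" "v \<in> V"
  shows "\<theta> (e u v) = \<theta> (a u) - \<theta> (a v)"
proof -
  have "e u v \<otimes>\<^bsub>A\<^esub> a v = a u" using assms(2,3) a_closed by (simp add: A.m_assoc)
  then show ?thesis using assms(1)[of "e u v" "a v"] assms(2,3) a_closed by simp
qed

text \<open>The constant t cancels in a_u a_v^-1, so a homomorphism on the whole Artin group may be
  built with whichever t is convenient and still restricts to \<phi>.\<close>

lemma character_eq_additive:
  assumes \<phi>: "\<phi> \<in> characters B" and x: "\<And>u v. (u, v) \<in> E \<Longrightarrow> \<phi> (e u v) = x u - x v"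
    and \<theta>: "\<And>g h. g \<in> carrier A \<Longrightarrow> h \<in> carrier A \<Longrightarrow> \<theta> (g \<otimes>\<^bsub>A\<^esub> h) = \<theta> g + \<theta> h"
    and gen: "\<And>v. v \<in> V \<Longrightarrow> \<theta> (a v) = x v - t" and g: "g \<in> carrier B"
  shows "\<phi> g = \<theta> g"
proof (rule additive_eq_on_generate[of B "edge_elements \<Gamma> E"])
  show "\<theta> (g \<otimes>\<^bsub>B\<^esub> h) = \<theta> g + \<theta> h" if "g \<in> carrier B" "h \<in> carrier B" for g h
    using that \<theta> by (simp add: bestvina_brady_simps)
  show "\<phi> s = \<theta> s" if s: "s \<in> edge_elements \<Gamma> E" for s
  proof -
    obtain u v where uv: "(u, v) \<in> E" "s = e u v" using s by (auto simp: edge_elements_def)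
    then have "u \<in> V" "v \<in> V" using edge_verts by auto
    then show ?thesis using x[OF uv(1)] gen additive_e[of \<theta> u v, OF \<theta>] uv(2) by simp
  qed
qed (use generating_edges g B.is_group character_mult[OF B.is_group \<phi>] in \<open>auto simp: finite_generating_set_def\<close>)

lemma character_e:
  assumes \<phi>: "\<phi> \<in> characters B" and x: "\<And>u v. (u, v) \<in> E \<Longrightarrow> \<phi> (e u v) = x u - x v"
    and uv: "u \<in> V" "v \<in> V"
  shows "\<phi> (e u v) = x u - x v"
  using connected_edges[OF uv]
proof (induction rule: rtrancl_induct)
  case base
  then show ?case using character_one[OF B.is_group \<phi>] e_self[OF uv(1)] by simp
next
  case (step v w)
  then show ?case
    using character_mult[OF B.is_group \<phi> e_closed e_closed, of u v v w] e_mult[of u v w] x[OF step(2)]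
      edge_verts[OF step(2)] uv by simp
qed

lemma half_connected_of_robust:
  assumes \<phi>: "\<phi> \<in> characters B" and x: "\<And>u v. (u, v) \<in> E \<Longrightarrow> \<phi> (e u v) = x u - x v"
    and robust: "robustly_connected V E x"
  shows "\<exists>S. finite_generating_set B S \<and> half_connected B S \<phi>"
proof -
  let ?L = "{(u, v) \<in> E. x u \<noteq> x v}"
  let ?S = "edge_elements \<Gamma> ?L"
  let ?R = "{(s, t). s \<in> ?S \<and> t \<in> ?S \<and> s \<otimes>\<^bsub>B\<^esub> t = t \<otimes>\<^bsub>B\<^esub> s}"
  have fin: "finite_generating_set B ?S"
    using living_edges_connected[OF robust] edge_sym
    by (intro finite_generating_edge_elements) (auto intro: symI)
  obtain u0 where u0: "u0 \<in> V" using verts_nonempty by blast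
  then obtain v0 where v0: "(u0, v0) \<in> E" "x v0 \<noteq> x u0" using robust by (auto simp: robustly_connected_def)
  have eS: "e u v \<in> ?S" if "(u, v) \<in> E" "x u \<noteq> x v" for u v
    using that by (force simp: edge_elements_def)
  \<comment> \<open>The indicator of one component of the commutation graph, made real-valued so
    that the cocycle argument applies. Elements of opposite edges commute as inverses, those of
    edges of a triangle leaving the same vertex by \<open>e_commute\<close>.\<close>
  define k :: "'v \<Rightarrow> 'v \<Rightarrow> real" where "k u v = (if (e u0 v0, e u v) \<in> ?R\<^sup>* then 1 else 0)" for u v
  have k_eq: "k u v = k u' v'"
    if "(u, v) \<in> E" "x u \<noteq> x v" "(u', v') \<in> E" "x u' \<noteq> x v'" "e u v \<otimes>\<^bsub>B\<^esub> e u' v' = e u' v' \<otimes>\<^bsub>B\<^esub> e u v"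
    for u v u' v'
  proof -
    have "(e u v, e u' v') \<in> ?R" "(e u' v', e u v) \<in> ?R" using that eS by auto
    then have "(e u0 v0, e u v) \<in> ?R\<^sup>* \<longleftrightarrow> (e u0 v0, e u' v') \<in> ?R\<^sup>*"
      by (meson rtrancl.rtrancl_into_rtrancl)
    then show ?thesis by (simp add: k_def)
  qed
  have "\<exists>m. \<forall>(u, v)\<in>E. x u \<noteq> x v \<longrightarrow> k u v = m"
  proof (rule triangle_invariant_constant[OF robust])
    show "k v u = k u v" if "(u, v) \<in> E" "x u \<noteq> x v" for u v
      using that edge_sym[OF that(1)] edge_verts[OF that(1)] by (intro k_eq) (auto simp: e_mult e_self)
    show "k u v = k u w" if "(u, v) \<in> E" "(v, w) \<in> E" "(u, w) \<in> E" "x u \<noteq> x v" "x u \<noteq> x w" for u v w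
      using that by (intro k_eq e_commute) auto
  qed
  then obtain m where m: "\<forall>(u, v)\<in>E. x u \<noteq> x v \<longrightarrow> k u v = m" ..
  have "k u0 v0 = 1" by (simp add: k_def)
  then have "m = 1" using m v0 by force
  then have reach: "(e u0 v0, e u v) \<in> ?R\<^sup>*" if "(u, v) \<in> E" "x u \<noteq> x v" for u v
    using m that by (force simp: k_def split: if_splits)
  have "half_connected B ?S \<phi>"
  proof (rule B.half_connected_of_commuting[OF \<phi>])
    show "e u0 v0 \<in> ?S" using v0 by (intro eS) auto
    show "\<phi> s \<noteq> 0" if "s \<in> ?S" for s using that x by (auto simp: edge_elements_def)
    show "(e u0 v0, s) \<in> ?R\<^sup>*" if "s \<in> ?S" for s using that reach by (auto simp: edge_elements_def)
  qed (use fin in \<open>auto simp: finite_generating_set_def\<close>)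
  then show ?thesis using fin by blast
qed

lemma not_resonant_of_robust:
  assumes \<phi>: "\<phi> \<in> characters B" and x: "\<And>u v. (u, v) \<in> E \<Longrightarrow> \<phi> (e u v) = x u - x v"
    and robust: "robustly_connected V E x"
  shows "\<phi> \<notin> resonance_variety B"
proof
  assume "\<phi> \<in> resonance_variety B"
  then obtain \<beta> F where \<beta>: "\<beta> \<in> characters B" "\<And>c. \<exists>g\<in>carrier B. \<beta> g \<noteq> c * \<phi> g"
    and F: "\<And>g h. g \<in> carrier B \<Longrightarrow> h \<in> carrier B \<Longrightarrow> \<beta> g * \<phi> h = F h - F (g \<otimes>\<^bsub>B\<^esub> h) + F g"
    unfolding resonance_variety_iff[OF B.is_group \<phi>] by metis
  obtain y where y: "\<And>u v. (u, v) \<in> E \<Longrightarrow> \<beta> (e u v) = y u - y v"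
    using character_potential[OF \<beta>(1)] by metis
  \<comment> \<open>For commuting g and h the coboundary of F is symmetric in g and h.\<close>
  have commute: "\<beta> g * \<phi> h = \<beta> h * \<phi> g"
    if "g \<in> carrier B" "h \<in> carrier B" "g \<otimes>\<^bsub>B\<^esub> h = h \<otimes>\<^bsub>B\<^esub> g" for g h
    using F[OF that(1,2)] F[OF that(2,1)] that(3) by simp
  have "\<exists>m. \<forall>(u, v)\<in>E. x u \<noteq> x v \<longrightarrow> (y u - y v) / (x u - x v) = m"
  proof (rule triangle_invariant_constant[OF robust])
    show "(y v - y u) / (x v - x u) = (y u - y v) / (x u - x v)" for u v
      by (metis minus_diff_eq minus_divide_divide)
    show "(y u - y v) / (x u - x v) = (y u - y w) / (x u - x w)"
      if "(u, v) \<in> E" "(v, w) \<in> E" "(u, w) \<in> E" "x u \<noteq> x v" "x u \<noteq> x w" for u v w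
      using commute[OF e_closed e_closed e_commute[OF that(1,3,2)]] that edge_verts x y
      by (simp add: frac_eq_eq)
  qed
  then obtain m where m: "\<forall>(u, v)\<in>E. x u \<noteq> x v \<longrightarrow> (y u - y v) / (x u - x v) = m" ..
  have lin: "y u - m * x u = y v - m * x v" if "u \<in> V" "v \<in> V" for u v
    using living_edges_connected[OF robust that]
  proof (induction rule: rtrancl_induct)
    case (step v w)
    then have "(y v - y w) / (x v - x w) = m" "x v - x w \<noteq> 0" using m by auto
    then have "y v - y w = m * (x v - x w)" by (simp add: field_simps)
    then show ?case using step.IH by (simp add: algebra_simps)
  qed simp
  have "\<beta> (e u v) = m * \<phi> (e u v)" if "(u, v) \<in> E" for u v
    unfolding x[OF that] y[OF that] right_diff_distrib using lin[of u v] edge_verts[OF that] by linarith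
  then have edge: "\<beta> s = m * \<phi> s" if "s \<in> edge_elements \<Gamma> E" for s
    using that by (auto simp: edge_elements_def)
  have "\<beta> g = m * \<phi> g" if "g \<in> carrier B" for g
  proof (rule additive_eq_on_generate[OF B.is_group edge_elements_closed[OF order_refl], where \<phi> = \<beta>])
    show "\<beta> (g \<otimes>\<^bsub>B\<^esub> h) = \<beta> g + \<beta> h" if "g \<in> carrier B" "h \<in> carrier B" for g h
      using that by (rule character_mult[OF B.is_group \<beta>(1)])
    show "m * \<phi> (g \<otimes>\<^bsub>B\<^esub> h) = m * \<phi> g + m * \<phi> h" if "g \<in> carrier B" "h \<in> carrier B" for g h
      using character_mult[OF B.is_group \<phi> that] by (simp add: distrib_left)
  qed (use edge generating_edges that in \<open>auto simp: finite_generating_set_def\<close>)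
  then show False using \<beta>(2) by blast
qed

text \<open>Commutators of a_v with ever lower pure translations lie in the kernel of \<phi>, yet
  their function part is nonzero arbitrarily far down.\<close>

lemma not_half_connected_of_shift:
  assumes \<phi>: "\<phi> \<in> characters B" and x: "\<And>u v. (u, v) \<in> E \<Longrightarrow> \<phi> (e u v) = x u - x v"
    and bounded: "\<And>p. \<exists>b. \<forall>z<b. \<eta> p z = (0::real)"
    and comm: "\<And>p q z. (p, q) \<in> E \<Longrightarrow> \<eta> p z + \<eta> q (z - (x p - t)) = \<eta> q z + \<eta> p (z - (x q - t))"
    and vw: "v \<in> V" "w \<in> V" "\<And>z. \<eta> w z = 0" "x w \<noteq> t" "\<eta> v 0 \<noteq> 0"
    and S: "S \<subseteq> carrier B" "finite S"
  shows "\<not> half_connected B S \<phi>"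
proof -
  have "\<exists>\<Psi>\<in>hom A shift_group. \<forall>p\<in>V. \<Psi> (a p) = (\<eta> p, x p - t)"
  proof (rule raag_lift[OF group_shift_group])
    show "(\<eta> p, x p - t) \<in> carrier shift_group" for p
      using bounded by (simp add: shift_group_simps)
    show "(\<eta> p, x p - t) \<otimes>\<^bsub>shift_group\<^esub> (\<eta> q, x q - t) = (\<eta> q, x q - t) \<otimes>\<^bsub>shift_group\<^esub> (\<eta> p, x p - t)"
      if "(p, q) \<in> E" for p q
      using comm[OF that] by (simp add: shift_group_simps)
  qed
  then obtain \<Psi> where \<Psi>: "\<Psi> \<in> hom A shift_group" "\<And>p. p \<in> V \<Longrightarrow> \<Psi> (a p) = (\<eta> p, x p - t)" by auto
  interpret \<Psi>: group_hom A shift_group \<Psi>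
    by (simp add: group_hom_def group_hom_axioms_def group_raag group_shift_group \<Psi>(1))
  define D where "D g = fst (\<Psi> g)" for g
  define \<theta> where "\<theta> g = snd (\<Psi> g)" for g
  have pair: "\<Psi> g = (D g, \<theta> g)" for g by (simp add: D_def \<theta>_def)
  have D: "D (g \<otimes>\<^bsub>A\<^esub> h) z = D g z + D h (z - \<theta> g)" and \<theta>: "\<theta> (g \<otimes>\<^bsub>A\<^esub> h) = \<theta> g + \<theta> h"
    if "g \<in> carrier A" "h \<in> carrier A" for g h z
    using \<Psi>.hom_mult[OF that] by (simp_all add: pair shift_group_simps)
  have D_gen: "D (a p) = \<eta> p" "\<theta> (a p) = x p - t" if "p \<in> V" for p
    using \<Psi>(2)[OF that] by (simp_all add: D_def \<theta>_def)
  have D_bounded: "\<exists>b. \<forall>z<b. D g z = 0" if "g \<in> carrier A" for g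
    using \<Psi>.hom_closed[OF that] by (simp add: pair shift_group_simps)
  have \<phi>\<theta>: "\<phi> g = \<theta> g" if "g \<in> carrier B" for g
    by (rule character_eq_additive[OF \<phi> x \<theta> D_gen(2) that])
  have "D \<one>\<^bsub>A\<^esub> z = 0" "\<theta> \<one>\<^bsub>A\<^esub> = 0" for z
    using \<Psi>.hom_one by (auto simp: pair shift_group_simps)
  note at_one = this
  \<comment> \<open>A pure downward translation: a_w or its inverse, depending on the sign of x w -
    t.\<close>
  obtain q where q: "q \<in> carrier A" "\<And>z. D q z = 0" "\<theta> q < 0"
  proof (cases "x w < t")
    case True
    then show thesis using that[of "a w"] a_closed[OF vw(2)] D_gen[OF vw(2)] vw(3) by simp
  next
    case False
    let ?i = "inv\<^bsub>A\<^esub> a w"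
    have i: "?i \<in> carrier A" "a w \<in> carrier A" using a_closed[OF vw(2)] by auto
    have "D ?i z = 0" for z
      using D[OF i(2,1), of "z + \<theta> (a w)"] at_one vw(3) i(2) by (simp add: D_gen[OF vw(2)])
    moreover have "\<theta> ?i < 0" using \<theta>[OF i(2,1)] at_one False vw(4) i(2) by (simp add: D_gen[OF vw(2)])
    ultimately show thesis using that[of ?i] i by simp
  qed
  have pow: "D (q [^]\<^bsub>A\<^esub> n) z = 0" "\<theta> (q [^]\<^bsub>A\<^esub> n) = real n * \<theta> q" for n :: nat and z
  proof (induction n arbitrary: z)
    case (Suc n)
    { case 1 show ?case using Suc D[of "q [^]\<^bsub>A\<^esub> n" q] q by simp }
    { case 2 show ?case using Suc \<theta>[of "q [^]\<^bsub>A\<^esub> n" q] q by (simp add: algebra_simps) }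
  qed (simp_all add: at_one)
  show ?thesis
  proof (rule B.not_half_connected_of_crossed_hom[OF \<phi> S, of D])
    show "D (g \<otimes>\<^bsub>B\<^esub> h) z = D g z + D h (z - \<phi> g)" if "g \<in> carrier B" "h \<in> carrier B" for g h z
      using that D[of g h z] \<phi>\<theta>[of g] by (simp add: bestvina_brady_simps)
    show "\<exists>b. \<forall>z<b. D s z = 0" if "s \<in> S" for s
      using that S(1) D_bounded[of s] by (auto simp: bestvina_brady_simps)
    fix b
    obtain b' where b': "\<And>z. z < b' \<Longrightarrow> \<eta> v z = 0" using bounded[of v] by blast
    \<comment> \<open>Below b the criterion asks for a nonzero value; below b' the unshifted copy of
      \<open>\<eta> v\<close> vanishes and cannot cancel the shifted one.\<close>
    obtain n :: nat where n: "- min b b' < real n * (- \<theta> q)"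
      using reals_Archimedean3[of "- \<theta> q"] q(3) by (metis neg_0_less_iff_less)
    define Q where "Q = q [^]\<^bsub>A\<^esub> n"
    define z where "z = real n * \<theta> q"
    have z: "z < b" "z < b'" using n by (auto simp: z_def)
    have Q: "Q \<in> carrier A" "\<And>s. D Q s = 0" "\<theta> Q = z" using q(1) pow by (auto simp: Q_def z_def)
    note av = a_closed[OF vw(1)]
    \<comment> \<open>Q need not have height zero, but this commutator does, and \<phi> vanishes on
      it. Its function part at z is \<eta> v 0 - \<eta> v z, because Q shifts by exactly z.\<close>
    define g where "g = (Q \<otimes>\<^bsub>A\<^esub> a v) \<otimes>\<^bsub>A\<^esub> inv\<^bsub>A\<^esub> (a v \<otimes>\<^bsub>A\<^esub> Q)"
    have gA: "g \<in> carrier A" using Q(1) av by (simp add: g_def)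
    have "raag_height g = 0"
      using Q(1) av by (simp add: g_def raag_height_mult raag_height_inv)
    then have gB: "g \<in> carrier B" using gA by (simp add: bestvina_brady_simps)
    have gQ: "g \<otimes>\<^bsub>A\<^esub> (a v \<otimes>\<^bsub>A\<^esub> Q) = Q \<otimes>\<^bsub>A\<^esub> a v"
      using Q(1) av by (simp add: g_def A.m_assoc)
    have "\<theta> g + (\<theta> (a v) + \<theta> Q) = \<theta> Q + \<theta> (a v)"
      using arg_cong[OF gQ, of \<theta>] gA Q(1) av by (simp add: \<theta>)
    then have g0: "\<theta> g = 0" by simp
    have "D g z + (D (a v) z + D Q (z - \<theta> (a v))) = D Q z + D (a v) (z - \<theta> Q)"
      using arg_cong[OF gQ, of "\<lambda>h. D h z"] gA Q(1) av g0 by (simp add: D)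
    then have "D g z \<noteq> 0" using Q vw(1,5) b'[OF z(2)] by (simp add: D_gen)
    then show "\<exists>g\<in>carrier B. 0 \<le> \<phi> g \<and> (\<exists>z<b. D g z \<noteq> 0)"
      using gB g0 \<phi>\<theta>[OF gB] z(1) by (intro bexI[of _ g] conjI exI[of _ z]) auto
  qed
qed

text \<open>The third coordinate of the map to the Heisenberg group trivializes the cup product of
  the first two. A potential is determined only up to a constant, so independence of the two
  characters requires that y is not an affine function of x.\<close>

lemma resonant_of_heisenberg:
  assumes \<phi>: "\<phi> \<in> characters B" and x: "\<And>u v. (u, v) \<in> E \<Longrightarrow> \<phi> (e u v) = x u - x v"
    and comm: "\<And>p q. (p, q) \<in> E \<Longrightarrow> y p * (x q - t) = y q * (x p - t)"
    and indep: "\<And>c d. \<exists>p\<in>V. y p \<noteq> c * x p + d"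
  shows "\<phi> \<in> resonance_variety B"
proof -
  have "\<exists>\<Psi>\<in>hom A heisenberg_group. \<forall>p\<in>V. \<Psi> (a p) = (y p, x p - t, 0)"
  proof (rule raag_lift[OF group_heisenberg_group])
    show "(y p, x p - t, 0) \<otimes>\<^bsub>heisenberg_group\<^esub> (y q, x q - t, 0)
        = (y q, x q - t, 0) \<otimes>\<^bsub>heisenberg_group\<^esub> (y p, x p - t, 0)" if "(p, q) \<in> E" for p q
      using comm[OF that] by (simp add: heisenberg_group_simps)
  qed (simp add: heisenberg_group_simps)
  then obtain \<Psi> where \<Psi>: "\<Psi> \<in> hom A heisenberg_group" "\<And>p. p \<in> V \<Longrightarrow> \<Psi> (a p) = (y p, x p - t, 0)" by auto
  define Y where "Y g = fst (\<Psi> g)" for g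
  define X where "X g = fst (snd (\<Psi> g))" for g
  define F where "F g = snd (snd (\<Psi> g))" for g
  have triple: "\<Psi> g = (Y g, X g, F g)" for g by (simp add: Y_def X_def F_def)
  have mult: "Y (g \<otimes>\<^bsub>A\<^esub> h) = Y g + Y h" "X (g \<otimes>\<^bsub>A\<^esub> h) = X g + X h" "F (g \<otimes>\<^bsub>A\<^esub> h) = F g + F h + Y g * X h"
    if "g \<in> carrier A" "h \<in> carrier A" for g h
    using hom_mult[OF \<Psi>(1) that] by (simp_all add: triple heisenberg_group_simps)
  have gen: "Y (a p) = y p" "X (a p) = x p - t" if "p \<in> V" for p
    using \<Psi>(2)[OF that] by (simp_all add: Y_def X_def)
  have \<phi>X: "\<phi> g = X g" if "g \<in> carrier B" for g
    by (rule character_eq_additive[OF \<phi> x mult(2) gen(2) that])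
  define \<beta> where "\<beta> = restrict Y (carrier B)"
  have \<beta>: "\<beta> \<in> characters B"
  proof (rule characterI)
    show "\<beta> (g \<otimes>\<^bsub>B\<^esub> h) = \<beta> g + \<beta> h" if "g \<in> carrier B" "h \<in> carrier B" for g h
      using that B.m_closed[OF that] mult(1)[of g h] by (simp add: \<beta>_def bestvina_brady_simps)
  qed (simp add: \<beta>_def)
  have "\<exists>g\<in>carrier B. \<beta> g \<noteq> c * \<phi> g" for c
  proof (rule ccontr)
    assume "\<not> (\<exists>g\<in>carrier B. \<beta> g \<noteq> c * \<phi> g)"
    then have multiple: "\<beta> g = c * \<phi> g" if "g \<in> carrier B" for g using that by blast
    obtain b where b: "b \<in> V" using verts_nonempty by blast
    have "y p = c * x p + (y b - c * x b)" if "p \<in> V" for p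
    proof -
      have "y p - y b = \<beta> (e p b)"
        using e_closed[OF that b] additive_e[of Y p b, OF mult(1)] gen that b by (simp add: \<beta>_def)
      also have "\<dots> = c * (x p - x b)"
        using multiple[OF e_closed[OF that b]] character_e[OF \<phi> x that b] by simp
      finally show ?thesis by (simp add: algebra_simps)
    qed
    then show False using indep by blast
  qed
  moreover have "\<beta> g * \<phi> h = - F h - - F (g \<otimes>\<^bsub>B\<^esub> h) + - F g" if "g \<in> carrier B" "h \<in> carrier B" for g h
    using that \<phi>X[OF that(2)] mult(3)[of g h] by (simp add: \<beta>_def bestvina_brady_simps)
  ultimately show ?thesis
    unfolding resonance_variety_iff[OF B.is_group \<phi>] using \<beta> by (blast intro: exI[of _ "\<lambda>g. - F g"])
qed

lemma bns_iff_resonance: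
  assumes \<phi>: "\<phi> \<in> nonzero_characters B"
  shows "character_class B \<phi> \<notin> bns_invariant B \<longleftrightarrow> \<phi> \<in> resonance_variety B"
proof -
  have \<phi>': "\<phi> \<in> characters B" "\<phi> \<noteq> (\<lambda>g\<in>carrier B. 0)" using \<phi> by (auto simp: nonzero_characters_def)
  obtain x where x: "\<And>u v. (u, v) \<in> E \<Longrightarrow> \<phi> (e u v) = x u - x v"
    using character_potential[OF \<phi>'(1)] by metis
  show ?thesis
  proof (cases "robustly_connected V E x")
    case True
    then have "character_class B \<phi> \<in> bns_invariant B"
      using half_connected_of_robust[OF \<phi>'(1) x] \<phi> by (auto simp: bns_invariant_def)
    then show ?thesis using not_resonant_of_robust[OF \<phi>'(1) x True] by simp
  next
    case False
    \<comment> \<open>A constant potential would make \<phi> vanish on the edge generators.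
      Nonconstancy supplies the vertex off the level t from which the downward translation is
      made.\<close>
    obtain u0 v0 where nonconst: "u0 \<in> V" "v0 \<in> V" "x u0 \<noteq> x v0"
    proof (rule ccontr)
      assume "\<not> thesis"
      then have const: "x u = x v" if "u \<in> V" "v \<in> V" for u v
        using that \<open>\<And>u0 v0. u0 \<in> V \<Longrightarrow> v0 \<in> V \<Longrightarrow> x u0 \<noteq> x v0 \<Longrightarrow> thesis\<close> by blast
      have edge: "\<phi> s = 0" if s: "s \<in> edge_elements \<Gamma> E" for s
      proof -
        obtain u v where "(u, v) \<in> E" "s = e u v" using s by (auto simp: edge_elements_def)
        then show ?thesis using x[of u v] const[of u v] edge_verts[of u v] by simp
      qed
      have "\<phi> g = 0" if "g \<in> carrier B" for g
      proof (rule additive_eq_on_generate[OF B.is_group edge_elements_closed[OF order_refl], where \<phi> = \<phi>])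
        show "\<phi> (g \<otimes>\<^bsub>B\<^esub> h) = \<phi> g + \<phi> h" if "g \<in> carrier B" "h \<in> carrier B" for g h
          using that by (rule character_mult[OF B.is_group \<phi>'(1)])
      qed (use edge generating_edges that in \<open>auto simp: finite_generating_set_def\<close>)
      then have "\<phi> = (\<lambda>g\<in>carrier B. 0)"
        using \<phi>'(1) by (intro extensionalityI[of _ "carrier B"]) (auto simp: characters_def)
      then show False using \<phi>'(2) by simp
    qed
    show ?thesis
    proof (rule degenerate_data[OF no_loop False nonconst])
      fix t y \<eta> v w
      assume data: "\<And>p. \<exists>b. \<forall>z<b. \<eta> p z = (0::real)"
        "\<And>p q z. (p, q) \<in> E \<Longrightarrow> \<eta> p z + \<eta> q (z - (x p - t)) = \<eta> q z + \<eta> p (z - (x q - t))"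
        "v \<in> V" "w \<in> V" "\<And>z. \<eta> w z = 0" "x w \<noteq> t" "\<eta> v 0 \<noteq> 0"
        "\<And>p q. (p, q) \<in> E \<Longrightarrow> y p * (x q - t) = y q * (x p - t)"
        "\<And>c d. \<exists>p\<in>V. y p \<noteq> c * x p + d"
      have "\<not> half_connected B (edge_elements \<Gamma> E) \<phi>"
        using generating_edges
        by (intro not_half_connected_of_shift[OF \<phi>'(1) x data(1-7)]) (auto simp: finite_generating_set_def)
      \<comment> \<open>\<open>bns_invariant\<close> accepts any finite generating set, so failure
        for the edge elements excludes the class only through independence of the generating
        set.\<close>
      then have "character_class B \<phi> \<notin> bns_invariant B"
        using bns_invariant_independent[OF B.is_group generating_edges \<phi>] by simp
      then show ?thesis using resonant_of_heisenberg[OF \<phi>'(1) x data(8,9)] by simp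
    qed
  qed
qed

end

theorem proposition4p43:
  fixes \<Gamma> :: "'v pair_pre_digraph"
  assumes "pair_graph \<Gamma>"
    and "biconnected \<Gamma>"
    and "simply_connected (geometric_realization (flag_complex \<Gamma>))"
  shows "bns_complement (bestvina_brady \<Gamma>) = resonance_sphere (bestvina_brady \<Gamma>) \<and>
    (\<forall>\<phi> \<in> nonzero_characters (bestvina_brady \<Gamma>).
       character_class (bestvina_brady \<Gamma>) \<phi> \<notin> bns_invariant (bestvina_brady \<Gamma>)
         \<longleftrightarrow> \<phi> \<in> resonance_variety (bestvina_brady \<Gamma>))"
proof -
  interpret bestvina_brady_graph \<Gamma>
    using assms unfolding bestvina_brady_graph_def bestvina_brady_graph_axioms_def biconnected_def by blast
  have iff: "\<forall>\<phi>\<in>nonzero_characters B. character_class B \<phi> \<notin> bns_invariant B \<longleftrightarrow> \<phi> \<in> resonance_variety B"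
    using bns_iff_resonance by simp
  moreover have "bns_complement B = resonance_sphere B"
    unfolding bns_complement_def resonance_sphere_def character_sphere_def
    using iff by (auto simp: image_iff)
  ultimately show ?thesis by (rule conjI[rotated])
qed

end
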